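(* Let $w\in C^2([-2,2])$, $\eta>0$, $\mu>0$, $f\in L^2(-1,1)$ and $0<\beta\le\alpha\le2\beta$. Then the functional $$E_1(v)=\alpha\,\sharp(S_v)+\beta\,\sharp(S_{\dot v}\setminus S_v)+\int_{-1}^1\big(\eta|\ddot v|^2-fv\big)\,dx+\mu\int_{-1}^1|v-w|^2\,dx$$ achieves a finite minimum over the functions $v\in\mathbf{H}^2(-2,2)$ such that $v=w$ a.e. in $(-2,-1)\cup(1,2)$.
   Context: $\mathbf{H}^2(-2,2)$ is the set of functions $v:(-2,2)\to\mathbb{R}$ that are piecewise $H^2$, i.e. made of finitely many $H^2$ pieces: there is a finite partition $-2=s_0<\dots<s_n=2$ with $v\in H^2(s_{i-1},s_i)$ for each $i$. $\dot v$ is the absolutely continuous part of the distributional derivative $v'$, $\ddot v$ is the absolutely continuous part of $(\dot v)'$; $S_v$ and $S_{\dot v}$ are the sets of discontinuity points of $v$ and $\dot v$ in $(-2,2)$ (possibly including the points $\pm1$); $\sharp$ is the counting measure. *)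

theory Defs
  imports "HOL-Analysis.Analysis"
begin

text \<open>Elements of \<open>L\<^sup>2\<close>, \<open>H\<^sup>2\<close> and the like are represented by total functions on the reals, of which
  only the a.e. class on the interval in question matters.\<close>

definition L2_on :: "real set \<Rightarrow> (real \<Rightarrow> real) \<Rightarrow> bool" where
  "L2_on S f \<longleftrightarrow> set_borel_measurable lebesgue S f \<and> set_integrable lebesgue S (\<lambda>x. (f x)\<^sup>2)"

definition C2_on :: "real \<Rightarrow> real \<Rightarrow> (real \<Rightarrow> real) \<Rightarrow> bool" where
  "C2_on a b w \<longleftrightarrow> (\<exists>w1 w2.
     (\<forall>x\<in>{a..b}. (w has_real_derivative w1 x) (at x within {a..b})) \<and>
     (\<forall>x\<in>{a..b}. (w1 has_real_derivative w2 x) (at x within {a..b})) \<and>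
     continuous_on {a..b} w2)"

definition test_function :: "real \<Rightarrow> real \<Rightarrow> (real \<Rightarrow> real) \<Rightarrow> bool" where
  "test_function a b \<phi> \<longleftrightarrow>
     (\<forall>n x. (deriv ^^ n) \<phi> field_differentiable (at x)) \<and>
     (\<exists>K. compact K \<and> K \<subseteq> {a<..<b} \<and> (\<forall>x. x \<notin> K \<longrightarrow> \<phi> x = 0))"

definition weak_derivative :: "real \<Rightarrow> real \<Rightarrow> (real \<Rightarrow> real) \<Rightarrow> (real \<Rightarrow> real) \<Rightarrow> bool" where
  "weak_derivative a b v g \<longleftrightarrow> (\<forall>\<phi>. test_function a b \<phi> \<longrightarrow>
     (LINT x:{a<..<b}|lebesgue. v x * deriv \<phi> x) = - (LINT x:{a<..<b}|lebesgue. g x * \<phi> x))"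

definition H2_on :: "real \<Rightarrow> real \<Rightarrow> (real \<Rightarrow> real) \<Rightarrow> bool" where
  "H2_on a b v \<longleftrightarrow> L2_on {a<..<b} v \<and>
     (\<exists>g h. L2_on {a<..<b} g \<and> L2_on {a<..<b} h \<and>
            weak_derivative a b v g \<and> weak_derivative a b g h)"

definition piecewise_H2 :: "real \<Rightarrow> real \<Rightarrow> (real \<Rightarrow> real) \<Rightarrow> bool" where
  "piecewise_H2 a b v \<longleftrightarrow> (\<exists>(n::nat) s. s 0 = a \<and> s n = b \<and>
     (\<forall>i<n. s i < s (Suc i) \<and> H2_on (s i) (s (Suc i)) v))"

text \<open>\<open>g\<close> is the density of the absolutely continuous part of the distributional derivative of \<open>v\<close>
  on \<open>(a,b)\<close>: that derivative is \<open>g dx + P - N\<close>, where the finite (positive) measures \<open>P\<close>, \<open>N\<close> are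
  concentrated on a Lebesgue null set. By the uniqueness of the Lebesgue decomposition, \<open>g\<close> is
  determined a.e. on \<open>(a,b)\<close>.\<close>

definition is_ac_derivative :: "real \<Rightarrow> real \<Rightarrow> (real \<Rightarrow> real) \<Rightarrow> (real \<Rightarrow> real) \<Rightarrow> bool" where
  "is_ac_derivative a b v g \<longleftrightarrow>
     set_integrable lebesgue {a<..<b} v \<and> set_integrable lebesgue {a<..<b} g \<and>
     (\<exists>(P :: real measure) N Z.
        finite_measure P \<and> sets P = sets borel \<and> finite_measure N \<and> sets N = sets borel \<and>
        Z \<in> null_sets lborel \<and> Z \<subseteq> {a<..<b} \<and> emeasure P (- Z) = 0 \<and> emeasure N (- Z) = 0 \<and>
        (\<forall>\<phi>. test_function a b \<phi> \<longrightarrow>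
           - (LINT x:{a<..<b}|lebesgue. v x * deriv \<phi> x) =
           (LINT x:{a<..<b}|lebesgue. g x * \<phi> x) + (LINT x|P. \<phi> x) - (LINT x|N. \<phi> x)))"

definition ac_derivative :: "real \<Rightarrow> real \<Rightarrow> (real \<Rightarrow> real) \<Rightarrow> real \<Rightarrow> real" where
  "ac_derivative a b v = (SOME g. is_ac_derivative a b v g)"

text \<open>Discontinuity points of the a.e. class of \<open>v\<close>: those at which no representative of the class
  is continuous. For piecewise Sobolev functions these are the points where the one-sided limits of
  the piecewise continuous representative differ.\<close>

definition discontinuity_set :: "real \<Rightarrow> real \<Rightarrow> (real \<Rightarrow> real) \<Rightarrow> real set" where
  "discontinuity_set a b v = {x \<in> {a<..<b}.
     \<not> (\<exists>u. (AE y in lebesgue. y \<in> {a<..<b} \<longrightarrow> u y = v y) \<and> isCont u x)}"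

definition counting :: "real set \<Rightarrow> ereal" where
  "counting S = enn2ereal (emeasure (count_space UNIV) S)"

definition E1 :: "real \<Rightarrow> real \<Rightarrow> real \<Rightarrow> real \<Rightarrow> (real \<Rightarrow> real) \<Rightarrow> (real \<Rightarrow> real) \<Rightarrow> (real \<Rightarrow> real) \<Rightarrow> ereal"
  where
  "E1 \<alpha> \<beta> \<eta> \<mu> f w v =
     (let v' = ac_derivative (-2) 2 v;
          v'' = ac_derivative (-2) 2 v';
          S = discontinuity_set (-2) 2 v;
          S' = discontinuity_set (-2) 2 v'
      in ereal \<alpha> * counting S + ereal \<beta> * counting (S' - S)
         + ereal (LINT x:{-1<..<1}|lebesgue. \<eta> * \<bar>v'' x\<bar>\<^sup>2 - f x * v x)
         + ereal (\<mu> * (LINT x:{-1<..<1}|lebesgue. \<bar>v x - w x\<bar>\<^sup>2)))"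

definition admissible :: "(real \<Rightarrow> real) \<Rightarrow> (real \<Rightarrow> real) set" where
  "admissible w = {v. piecewise_H2 (-2) 2 v \<and>
     (AE x in lebesgue. x \<in> {-2<..<-1} \<union> {1<..<2} \<longrightarrow> v x = w x)}"

end

theory Submission
  imports Defs "HOL-Complex_Analysis.Great_Picard"
begin

text \<open>On each piece an admissible \<open>v\<close> is an affine function plus the double primitive of \<open>h = v''\<close>, so \<open>v\<close>
  is encoded by its knots, finitely many affine coefficients and a single \<open>h \<in> L\<^sup>2(-2,2)\<close>; the absolutely
  continuous parts and the discontinuity sets are read off from these data, the former by uniqueness of
  the Lebesgue decomposition. Along a minimising sequence the number of knots is bounded, hence it may be
  taken constant, together with the set of knots that are jumps. The knots converge, the primitives of
  \<open>h\<close> converge uniformly (Arzela-Ascoli), and the affine coefficients converge on every piece that does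
  not collapse. Knots that merge at one point paid at least as much as the limit pays there: a single
  crease leaves the limit continuous, and two creases pay \<open>2\<beta> \<ge> \<alpha> \<ge> \<beta>\<close>. Completing the square turns the
  zero order terms into \<open>\<mu> \<integral> (v - z)\<^sup>2\<close> up to a constant, which is lower semicontinuous by Fatou.\<close>

section \<open>Smooth functions\<close>

text \<open>Encoding all pieces by one \<open>h\<close> on the whole interval makes the compactness
  of \<open>h\<close> independent of the moving knots: only the affine coefficients see the
  partition, and a collapsing piece is dropped. The energy controls \<open>h\<close> and
  \<open>v\<close> only on (-1,1), but on the outer strips v = w also fixes the second derivative,
  so squared norms over (-2,2) and over (-1,1) differ by constants depending on \<open>w\<close>
  alone. \<open>ac_derivative\<close> is a choice from an a.e. class, whose definition allows
  arbitrary singular measures; nothing can be computed from it before the density is known to be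
  unique, even locally, and the work with test functions serves this. The two inequalities play
  different roles: \<beta> \<le> \<alpha> lets a jump degenerate into a crease, \<alpha> \<le>
  2\<beta> lets two creases merge into a jump. Finally, only the sum of the two quadratic terms
  converges along a minimising sequence; making the norms of \<open>h\<close> converge along a
  subsequence forces the other term to converge too, so that each can be compared with its own
  limit.\<close>

definition smooth :: "(real \<Rightarrow> real) \<Rightarrow> bool" where
  "smooth f \<longleftrightarrow> (\<forall>n x. (deriv ^^ n) f field_differentiable (at x))"

text \<open>By induction the iterated derivatives of \<open>f\<close> never leave \<open>X\<close>.
  Smoothness thus amounts to exhibiting a family closed under differentiation, which spares formulas
  for higher derivatives.\<close>

lemma smooth_coinduct:
  assumes "f \<in> X" and "\<And>g. g \<in> X \<Longrightarrow> \<exists>g'\<in>X. \<forall>x. (g has_field_derivative g' x) (at x)"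
  shows "smooth f"
proof -
  have "deriv g \<in> X" if "g \<in> X" for g
  proof -
    from assms(2)[OF that] obtain g'
      where "g' \<in> X" "\<forall>x. (g has_field_derivative g' x) (at x)" ..
    moreover from this have "deriv g = g'"
      by (intro ext DERIV_imp_deriv) auto
    ultimately show ?thesis by simp
  qed
  then have "(deriv ^^ n) f \<in> X" for n
    by (induction n) (use assms(1) in auto)
  then show ?thesis
    unfolding smooth_def field_differentiable_def using assms(2) by blast
qed

lemma smooth_deriv: "smooth f \<Longrightarrow> smooth (deriv f)"
  unfolding smooth_def by (metis comp_apply funpow_Suc_right)

lemma smooth_DERIV: "smooth f \<Longrightarrow> (f has_field_derivative deriv f x) (at x)"
  unfolding smooth_def using field_differentiable_derivI by (metis funpow_0)

lemma smooth_isCont: "smooth f \<Longrightarrow> isCont f x"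
  using smooth_DERIV DERIV_isCont by blast

lemma smooth_continuous_on: "smooth f \<Longrightarrow> continuous_on S f"
  by (simp add: continuous_at_imp_continuous_on smooth_isCont)

lemma smooth_antiderivative:
  assumes "\<And>x. (f has_field_derivative g x) (at x)" "smooth g"
  shows "smooth f"
proof (rule smooth_coinduct[where X = "insert f {g. smooth g}"])
  fix h assume "h \<in> insert f {g. smooth g}"
  then consider "h = f" | "smooth h" by auto
  then show "\<exists>g'\<in>insert f {g. smooth g}. \<forall>x. (h has_field_derivative g' x) (at x)"
  proof cases
    case 1
    then show ?thesis using assms by (intro bexI[of _ g]) auto
  next
    case 2
    then show ?thesis using smooth_deriv smooth_DERIV by (intro bexI[of _ "deriv h"]) auto
  qed
qed auto

lemma smooth_const: "smooth (\<lambda>x. c)"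
  by (rule smooth_coinduct[where X = "{(\<lambda>x. c), (\<lambda>x. 0)}"]) (auto intro!: derivative_eq_intros)

text \<open>The derivative of a product is a sum of products, so the products of two smooth
  functions are not visibly closed under differentiation; the algebra generated by the smooth
  functions is.\<close>

inductive_set smooth_alg :: "(real \<Rightarrow> real) set" where
  base: "smooth f \<Longrightarrow> f \<in> smooth_alg"
| add: "f \<in> smooth_alg \<Longrightarrow> g \<in> smooth_alg \<Longrightarrow> (\<lambda>x. f x + g x) \<in> smooth_alg"
| mult: "f \<in> smooth_alg \<Longrightarrow> g \<in> smooth_alg \<Longrightarrow> (\<lambda>x. f x * g x) \<in> smooth_alg"

lemma smooth_alg_smooth:
  assumes "f \<in> smooth_alg" shows "smooth f"
proof (rule smooth_coinduct[OF assms])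
  fix g assume "g \<in> smooth_alg"
  then show "\<exists>g'\<in>smooth_alg. \<forall>x. (g has_field_derivative g' x) (at x)"
  proof induction
    case (base f)
    then show ?case
      by (intro bexI[of _ "deriv f"] smooth_alg.base smooth_deriv) (auto intro: smooth_DERIV)
  next
    case (add f g)
    then obtain f' g' where "f' \<in> smooth_alg" "g' \<in> smooth_alg"
      "\<And>x. (f has_field_derivative f' x) (at x)" "\<And>x. (g has_field_derivative g' x) (at x)" by blast
    then show ?case
      by (intro bexI[of _ "\<lambda>x. f' x + g' x"] smooth_alg.add allI DERIV_add)
  next
    case (mult f g)
    then obtain f' g' where "f' \<in> smooth_alg" "g' \<in> smooth_alg"
      "\<And>x. (f has_field_derivative f' x) (at x)" "\<And>x. (g has_field_derivative g' x) (at x)" by blast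
    with mult show ?case
      by (intro bexI[of _ "\<lambda>x. f x * g' x + f' x * g x"] allI DERIV_mult' smooth_alg.add
        smooth_alg.mult)
  qed
qed

lemma smooth_add: "smooth f \<Longrightarrow> smooth g \<Longrightarrow> smooth (\<lambda>x. f x + g x)"
  by (rule smooth_alg_smooth, rule smooth_alg.add) (rule smooth_alg.base, assumption)+

lemma smooth_mult: "smooth f \<Longrightarrow> smooth g \<Longrightarrow> smooth (\<lambda>x. f x * g x)"
  by (rule smooth_alg_smooth, rule smooth_alg.mult) (rule smooth_alg.base, assumption)+

lemma smooth_diff: "smooth f \<Longrightarrow> smooth g \<Longrightarrow> smooth (\<lambda>x. f x - g x)"
  using smooth_add[of f "\<lambda>x. (-1) * g x"] smooth_mult[OF smooth_const[of "-1"], of g] by simp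

text \<open>The chain rule produces a factor \<open>a\<close> at each differentiation; the free
  factor \<open>c\<close> in the closed family absorbs it.\<close>

lemma smooth_affine:
  assumes "smooth f" shows "smooth (\<lambda>x. f (a * x + b))"
proof (rule smooth_coinduct)
  show "(\<lambda>x. f (a * x + b)) \<in> {(\<lambda>x. c * g (a * x + b)) | c g. smooth g}"
    using assms by (force intro!: exI[of _ 1])
next
  fix h assume "h \<in> {(\<lambda>x. c * g (a * x + b)) | c g. smooth g}"
  then obtain c g where h: "h = (\<lambda>x. c * g (a * x + b))" "smooth g" by blast
  have "(h has_field_derivative (c * a) * deriv g (a * x + b)) (at x)" for x
  proof -
    have "((\<lambda>x. a * x + b) has_field_derivative a) (at x)"
      by (auto intro!: derivative_eq_intros)
    from DERIV_cmult[OF DERIV_chain2[where f = g, OF smooth_DERIV[OF h(2)] this], of c]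
    show ?thesis by (simp add: h(1) mult_ac)
  qed
  then show "\<exists>g'\<in>{(\<lambda>x. c * g (a * x + b)) | c g. smooth g}. \<forall>x. (h has_field_derivative g' x) (at x)"
    using smooth_deriv[OF h(2)] by (intro bexI[of _ "\<lambda>x. (c * a) * deriv g (a * x + b)"]) auto
qed

section \<open>A function flat at the origin; bumps and steps\<close>

lemma poly_div_exp_tendsto_0:
  fixes p :: "real poly"
  shows "((\<lambda>x. poly p x / exp x) \<longlongrightarrow> 0) at_top"
proof -
  have "((\<lambda>x. \<Sum>i\<le>degree p. coeff p i * (x ^ i / exp x)) \<longlongrightarrow> (\<Sum>i\<le>degree p. coeff p i * 0)) at_top"
    by (intro tendsto_intros tendsto_power_div_exp_0)
  moreover have "(\<lambda>x. \<Sum>i\<le>degree p. coeff p i * (x ^ i / exp x)) = (\<lambda>x. poly p x / exp x)"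
    by (rule ext) (simp add: poly_altdef sum_divide_distrib)
  ultimately show ?thesis by simp
qed

lemma poly_inverse_exp_tendsto_0:
  fixes p :: "real poly"
  shows "((\<lambda>x. poly p (1/x) * exp (- 1 / x)) \<longlongrightarrow> 0) (at_right 0)"
proof -
  have "filterlim (\<lambda>x::real. 1 / x) at_top (at_right 0)"
    using filterlim_inverse_at_top_right by (simp add: inverse_eq_divide)
  from filterlim_compose[OF poly_div_exp_tendsto_0 this]
  show ?thesis by (simp add: exp_minus field_simps)
qed

text \<open>For x > 0 the derivative of p(1/x) exp(-1/x) is (p - p')(1/x) x^(-2) exp(-1/x), which
  has the same shape, so the functions \<open>e p\<close> form a closed family;
  \<open>[:0,0,1:]\<close> supplies x^(-2). At 0 the exponential beats every power of 1/x.\<close>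

lemma smooth_exp_inverse:
  fixes p :: "real poly"
  shows "smooth (\<lambda>x. if x \<le> 0 then 0 else poly p (1/x) * exp (- 1 / x))"
proof (rule smooth_coinduct)
  define e where "e = (\<lambda>(p::real poly) x::real. if x \<le> 0 then 0 else poly p (1/x) * exp (- 1 / x))"
  show "(\<lambda>x. if x \<le> 0 then 0 else poly p (1/x) * exp (- 1 / x)) \<in> range e"
    unfolding e_def by blast
  fix g assume "g \<in> range e"
  then obtain p where g: "g = e p" by blast
  have "(e p has_field_derivative e ((p - pderiv p) * [:0,0,1:]) x) (at x)" for x
  proof -
    consider "x < 0" | "x > 0" | "x = 0" by linarith
    then show ?thesis
    proof cases
      case 1
      show ?thesis
        by (rule has_field_derivative_transform_within_open[where f = "\<lambda>_. 0" and S = "{..<0}"])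
          (use 1 in \<open>auto simp: e_def\<close>)
    next
      case 2
      have "((\<lambda>x. poly p (1/x) * exp (- 1 / x)) has_field_derivative e ((p - pderiv p) * [:0,0,1:]) x) (at x)"
        by (rule derivative_eq_intros refl DERIV_chain2[OF poly_DERIV] | use 2 in \<open>simp; fail\<close>)+
          (use 2 in \<open>simp add: e_def field_simps power2_eq_square\<close>)
      then show ?thesis
        by (rule has_field_derivative_transform_within_open[where S = "{0<..}"])
          (use 2 in \<open>auto simp: e_def\<close>)
    next
      case 3
      \<comment> \<open>The extra factor \<open>[:0,1:]\<close> is the 1/h of the difference
        quotient at 0.\<close>
      have "((\<lambda>h. poly (p * [:0,1:]) (1/h) * exp (- 1 / h)) \<longlongrightarrow> 0) (at_right 0)"
        by (rule poly_inverse_exp_tendsto_0)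
      then have "((\<lambda>h. (e p (0 + h) - e p 0) / h) \<longlongrightarrow> 0) (at_right 0)"
        by (rule Lim_transform_eventually)
          (auto simp: e_def eventually_at_filter)
      moreover have "((\<lambda>h. (e p (0 + h) - e p 0) / h) \<longlongrightarrow> 0) (at_left 0)"
        by (rule Lim_transform_eventually[OF tendsto_const])
          (auto simp: e_def eventually_at_filter)
      ultimately have "((\<lambda>h. (e p (0 + h) - e p 0) / h) \<longlongrightarrow> 0) (at 0)"
        by (simp add: filterlim_split_at)
      moreover have "e ((p - pderiv p) * [:0,0,1:]) 0 = 0" by (simp add: e_def)
      ultimately show ?thesis unfolding 3 by (simp only: DERIV_def)
    qed
  qed
  then show "\<exists>g'\<in>range e. \<forall>x. (g has_field_derivative g' x) (at x)" unfolding g by blast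
qed

lemma DERIV_0_imp_const:
  assumes "\<And>x. a < x \<Longrightarrow> x < b \<Longrightarrow> (f has_field_derivative 0) (at x)" "continuous_on {a..b} f"
     "x \<in> {a..b}" "y \<in> {a..b}"
  shows "f x = (f y :: real)"
proof (cases "a < b")
  case True
  then show ?thesis using DERIV_isconst2[of a b f x] DERIV_isconst2[of a b f y] assms by auto
next
  case False
  then have "x = y" using assms(3,4) by auto
  then show ?thesis by simp
qed

lemma antiderivative_const:
  assumes "\<And>x. (F has_field_derivative f x) (at x)" "\<And>x. a < x \<Longrightarrow> x < b \<Longrightarrow> f x = 0"
    "x \<in> {a..b}" "y \<in> {a..b}"
  shows "F x = (F y :: real)"
proof (rule DERIV_0_imp_const[of a b F, OF _ _ assms(3,4)])
  show "(F has_field_derivative 0) (at z)" if "a < z" "z < b" for z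
    using assms(1)[of z] assms(2)[OF that] by simp
  show "continuous_on {a..b} F"
    using assms(1) DERIV_continuous_on has_field_derivative_at_within by blast
qed

lemma smooth_bump:
  obtains b :: "real \<Rightarrow> real" where "smooth b" "\<And>x. 0 < x \<Longrightarrow> x < 1 \<Longrightarrow> 0 < b x"
    "\<And>x. x \<le> 0 \<or> 1 \<le> x \<Longrightarrow> b x = 0"
proof -
  define e where "e = (\<lambda>x::real. if x \<le> 0 then 0 else poly 1 (1/x) * exp (- 1 / x))"
  have e: "smooth e" unfolding e_def by (rule smooth_exp_inverse)
  show ?thesis
    by (rule that[of "\<lambda>x. e x * e ((-1) * x + 1)"], intro smooth_mult e smooth_affine)
      (auto simp: e_def)
qed

text \<open>Obtained by normalising the primitive \<open>B\<close> of a bump: \<open>B\<close> is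
  constant on either side of [0,1] and grows strictly across it.\<close>

lemma smooth_step:
  obtains F :: "real \<Rightarrow> real" where "smooth F" "mono F" "\<And>x. x \<le> 0 \<Longrightarrow> F x = 0" "\<And>x. 1 \<le> x \<Longrightarrow> F x = 1"
proof -
  obtain b :: "real \<Rightarrow> real" where b: "smooth b" "\<And>x. 0 < x \<Longrightarrow> x < 1 \<Longrightarrow> 0 < b x"
    "\<And>x. x \<le> 0 \<or> 1 \<le> x \<Longrightarrow> b x = 0" using smooth_bump by metis
  have b0: "0 \<le> b x" for x using b(2)[of x] b(3)[of x] by linarith
  obtain B where "\<And>x::real. (B has_vector_derivative b x) (at x)"
    using einterval_antiderivative[of "-\<infinity>" \<infinity> b] smooth_isCont[OF b(1)] by auto
  then have B: "(B has_field_derivative b x) (at x)" for x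
    by (simp add: has_real_derivative_iff_has_vector_derivative)
  have mono: "B x \<le> B y" if "x \<le> y" for x y
    using DERIV_nonneg_imp_nondecreasing[OF that] B b0 by blast
  have cB: "continuous_on S B" for S
    using B DERIV_continuous_on has_field_derivative_at_within by blast
  have "B 0 < B 1"
    by (rule DERIV_pos_imp_increasing_open[OF zero_less_one]) (use B b(2) cB in blast)+
  have left: "B x = B 0" if "x \<le> 0" for x
    by (rule antiderivative_const[OF B, of x 0]) (use b(3) that in auto)
  have right: "B x = B 1" if "1 \<le> x" for x
    by (rule antiderivative_const[OF B, of 1 x]) (use b(3) that in auto)
  have sB: "smooth B" using smooth_antiderivative B b(1) by blast
  show ?thesis
  proof (rule that[of "\<lambda>x. (1 / (B 1 - B 0)) * (B x - B 0)"])
    show "smooth (\<lambda>x. (1 / (B 1 - B 0)) * (B x - B 0))"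
      by (intro smooth_mult smooth_diff smooth_const sB)
    show "mono (\<lambda>x. (1 / (B 1 - B 0)) * (B x - B 0))"
      using mono \<open>B 0 < B 1\<close> by (intro monoI mult_left_mono) auto
    show "(1 / (B 1 - B 0)) * (B x - B 0) = 0" if "x \<le> 0" for x
      by (simp add: left[OF that])
    show "(1 / (B 1 - B 0)) * (B x - B 0) = 1" if "1 \<le> x" for x
      unfolding right[OF that] using \<open>B 0 < B 1\<close> by simp
  qed
qed

section \<open>Supports of test functions\<close>

lemma test_function_iff:
  "test_function a b \<phi> \<longleftrightarrow> smooth \<phi> \<and> (\<exists>K. compact K \<and> K \<subseteq> {a<..<b} \<and> (\<forall>x. x \<notin> K \<longrightarrow> \<phi> x = 0))"
  by (simp add: test_function_def smooth_def)

lemma test_functionI: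
  assumes "smooth \<phi>" "a < c" "d < b" "\<And>x. x < c \<or> d < x \<Longrightarrow> \<phi> x = 0"
  shows "test_function a b \<phi>"
  unfolding test_function_iff using assms
  by (intro conjI exI[of _ "{c..d}"]) auto

lemma test_functionE:
  assumes "test_function a b \<phi>" "a < b"
  obtains c d where "smooth \<phi>" "a < c" "c < d" "d < b" "\<And>x. x \<le> c \<or> d \<le> x \<Longrightarrow> \<phi> x = 0"
proof -
  obtain K where K: "compact K" "K \<subseteq> {a<..<b}" "\<And>x. x \<notin> K \<Longrightarrow> \<phi> x = 0" "smooth \<phi>"
    using assms(1) unfolding test_function_iff by blast
  obtain c d where cd: "a < c" "d < b" "K \<subseteq> {c..d}"
  proof (cases "K = {}")
    case True
    then show ?thesis by (intro that[of "(a+b)/2" "(a+b)/2"]) (use assms(2) in auto)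
  next
    case False
    then obtain c d where "c \<in> K" "d \<in> K" "\<forall>x\<in>K. c \<le> x" "\<forall>x\<in>K. x \<le> d"
      using compact_attains_inf[OF K(1)] compact_attains_sup[OF K(1)] by blast
    then show ?thesis by (intro that[of c d]) (use K(2) in auto)
  qed
  \<comment> \<open>The midpoint of (a,b) ensures \<open>c' < d'\<close> even if \<open>K\<close> is
    empty or a single point; averaging with \<open>a\<close> and \<open>b\<close> puts
    \<open>K\<close> strictly between \<open>c'\<close> and \<open>d'\<close>.\<close>
  define c' where "c' = (a + min c ((a+b)/2)) / 2"
  define d' where "d' = (max d ((a+b)/2) + b) / 2"
  show ?thesis
  proof (rule that[of c' d'])
    show "a < c'" "c' < d'" "d' < b" using cd assms(2) by (auto simp: c'_def d'_def min_def max_def field_simps)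
    show "\<phi> x = 0" if "x \<le> c' \<or> d' \<le> x" for x
    proof -
      have "c' < c" "d < d'" using cd assms(2) by (auto simp: c'_def d'_def min_def max_def field_simps)
      then have "x \<notin> K" using that cd by fastforce
      then show ?thesis using K by blast
    qed
  qed (use K in auto)
qed

section \<open>Singular measures and test functions\<close>

abbreviation L1_on :: "real set \<Rightarrow> (real \<Rightarrow> real) \<Rightarrow> bool" where
  "L1_on \<equiv> set_integrable lebesgue"

definition smoothstep :: "real \<Rightarrow> real" where
  "smoothstep = (SOME F. smooth F \<and> mono F \<and> (\<forall>x\<le>0. F x = 0) \<and> (\<forall>x\<ge>1. F x = 1))"

lemma smoothstep:
  "smooth smoothstep" "mono smoothstep" "x \<le> 0 \<Longrightarrow> smoothstep x = 0" "1 \<le> x \<Longrightarrow> smoothstep x = 1"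
proof -
  have "\<exists>F. smooth F \<and> mono F \<and> (\<forall>x\<le>0. F x = (0::real)) \<and> (\<forall>x\<ge>1. F x = (1::real))"
    using smooth_step by metis
  from someI_ex[OF this] show "smooth smoothstep" "mono smoothstep" "x \<le> 0 \<Longrightarrow> smoothstep x = 0"
    "1 \<le> x \<Longrightarrow> smoothstep x = 1"
    unfolding smoothstep_def by blast+
qed

lemma smoothstep_bounds: "0 \<le> smoothstep x" "smoothstep x \<le> 1"
  using monoD[OF smoothstep(2), of x "max x 1"] monoD[OF smoothstep(2), of "min x 0" x]
    smoothstep(3)[of "min x 0"] smoothstep(4)[of "max x 1"] by auto

text \<open>Rises from 0 to 1 on [c, c+e] and falls back on [d, d+e]. Both ramps lie to the right of
  their base point, so the limit for e to 0 is the indicator of the half-open interval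
  \<open>{c<..d}\<close>.\<close>

definition cutoff :: "real \<Rightarrow> real \<Rightarrow> real \<Rightarrow> real \<Rightarrow> real" where
  "cutoff c d e x = smoothstep ((x - c) / e) - smoothstep ((x - d) / e)"

lemma smooth_smoothstep_scaled: "smooth (\<lambda>x. smoothstep ((x - c) / e))"
  using smooth_affine[OF smoothstep(1), of "1/e" "- c/e"] by (simp add: diff_divide_distrib)

lemma test_function_cutoff:
  assumes "a < c" "c \<le> d" "0 < e" "d + e < b"
  shows "test_function a b (cutoff c d e)"
proof (rule test_functionI[of _ _ c "d + e"])
  show "smooth (cutoff c d e)"
    unfolding cutoff_def by (intro smooth_diff smooth_smoothstep_scaled)
  show "cutoff c d e x = 0" if "x < c \<or> d + e < x" for x
    using that
  proof
    assume "x < c"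
    then show ?thesis using assms by (simp add: cutoff_def smoothstep(3) divide_le_0_iff)
  next
    assume "d + e < x"
    then show ?thesis using assms by (simp add: cutoff_def smoothstep(4) le_divide_eq_1)
  qed
qed (use assms in auto)

lemma abs_cutoff_le_1: "\<bar>cutoff c d e x\<bar> \<le> 1"
  using smoothstep_bounds[of "(x - c)/e"] smoothstep_bounds[of "(x - d)/e"] by (simp add: cutoff_def)

lemma smoothstep_scaled_tendsto:
  assumes "e \<longlonglongrightarrow> 0" "\<And>k. 0 < e k"
  shows "(\<lambda>k. smoothstep ((x - c) / e k)) \<longlonglongrightarrow> (if x \<le> c then 0 else 1)"
proof (cases "x \<le> c")
  case True
  then show ?thesis using assms(2) by (simp add: smoothstep(3) divide_le_0_iff less_imp_le)
next
  case False
  then have "\<forall>\<^sub>F k in sequentially. e k < x - c"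
    using order_tendstoD(2)[OF assms(1), of "x - c"] by simp
  then have "\<forall>\<^sub>F k in sequentially. smoothstep ((x - c) / e k) = 1"
    by eventually_elim (use assms(2) in \<open>simp add: smoothstep(4)\<close>)
  with False show ?thesis using tendsto_eventually by auto
qed

lemma cutoff_tendsto:
  assumes "e \<longlonglongrightarrow> 0" "\<And>k. 0 < e k" "c \<le> d"
  shows "(\<lambda>k. cutoff c d (e k) x) \<longlonglongrightarrow> indicator {c<..d} x"
proof -
  have "(\<lambda>k. cutoff c d (e k) x) \<longlonglongrightarrow> (if x \<le> c then 0 else 1) - (if x \<le> d then 0 else 1)"
    unfolding cutoff_def by (intro tendsto_diff smoothstep_scaled_tendsto assms)
  also have "(if x \<le> c then 0 else 1) - (if x \<le> d then 0 else 1) = (indicator {c<..d} x :: real)"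
    using assms(3) by (auto simp: indicator_def)
  finally show ?thesis .
qed

section \<open>Uniqueness of the Lebesgue decomposition, by testing\<close>

lemma integrable_sub_Ioc:
  fixes g :: "real \<Rightarrow> real"
  assumes "L1_on {a<..<b} g" "a < c" "d < b" "A \<in> sets lebesgue"
  shows "L1_on (A \<inter> {c<..d}) g"
  by (rule set_integrable_subset[OF assms(1)]) (use assms in auto)

lemma lebesgue_UN_signed_sums_0:
  fixes g :: "real \<Rightarrow> real" and p :: "nat \<Rightarrow> real"
  assumes "\<And>i. A i \<in> sets lebesgue" "disjoint_family A" "L1_on (\<Union>i. A i) g"
    "p sums P" "\<And>i::nat. (LINT x:A i|lebesgue. g x) + p i = 0"
  shows "(LINT x:(\<Union>i. A i)|lebesgue. g x) + P = 0"
proof -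
  have "(LINT x:(\<Union>i. A i)|lebesgue. g x) = (\<Sum>i. (LINT x:(A i)|lebesgue. g x))"
    by (rule lebesgue_integral_countable_add) (use assms in \<open>auto simp: disjoint_family_on_def\<close>)
  also have "\<dots> = (\<Sum>i. - p i)"
    using assms(5) by (intro suminf_cong) (simp add: algebra_simps add_eq_0_iff)
  also have "\<dots> = - P"
    using sums_minus[OF assms(4)] sums_unique by fastforce
  finally show ?thesis by simp
qed

text \<open>A Dynkin class argument over half-lines: cutoffs and dominated convergence give the
  half-open intervals, and the vanishing passes to complements and disjoint unions. Intersecting
  with \<open>{c<..d}\<close> keeps everything inside (a,b), where test functions reach. The signed
  family indexed by \<open>I\<close> accommodates the difference of two decompositions.\<close>

lemma signed_measure_zero_on_borel:
  fixes g :: "real \<Rightarrow> real"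
  assumes g: "L1_on {a<..<b} g"
    and M: "\<And>i. i \<in> I \<Longrightarrow> finite_measure (M i)" "\<And>i. i \<in> I \<Longrightarrow> sets (M i) = sets borel"
    and test: "\<And>\<phi>. test_function a b \<phi> \<Longrightarrow>
      (LINT x:{a<..<b}|lebesgue. g x * \<phi> x) + (\<Sum>i\<in>I. \<sigma> i * (LINT x|M i. \<phi> x)) = 0"
    and c: "a < c" and d: "d < b" and A: "A \<in> sets borel"
  shows "(LINT x:A \<inter> {c<..d}|lebesgue. g x) + (\<Sum>i\<in>I. \<sigma> i * measure (M i) (A \<inter> {c<..d})) = 0"
proof -
  have spM: "space (M i) = UNIV" if "i \<in> I" for i
    using sets_eq_imp_space_eq[OF M(2)[OF that]] by simp
  \<comment> \<open>Stated for every right end below \<open>b\<close>, because intersecting with the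
    half-line up to x moves the end to \<open>min x d\<close>.\<close>
  have iv: "(LINT x:{c<..d}|lebesgue. g x) + (\<Sum>i\<in>I. \<sigma> i * measure (M i) {c<..d}) = 0" if "d < b" for d
  proof (cases "c \<le> d")
    case True
    \<comment> \<open>The falling ramp [d, d + e k] has to end strictly before \<open>b\<close>,
      already for k = 0; hence k + 2.\<close>
    define e where "e k = (b - d) / real (k + 2)" for k
    have e0: "e k > 0" for k using that by (simp add: e_def)
    have elim: "e \<longlonglongrightarrow> 0" unfolding e_def by real_asymp
    have eb: "d + e k < b" for k
    proof -
      have "(b - d) * 1 < (b - d) * real (k + 2)" using that by (intro mult_strict_left_mono) auto
      then show ?thesis using that by (simp add: e_def field_simps)
    qed
    let ?\<phi> = "\<lambda>k. cutoff c d (e k)"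
    have tst: "test_function a b (?\<phi> k)" for k
      using test_function_cutoff c True e0 eb by blast
    have meas: "?\<phi> k \<in> borel_measurable borel" for k
      using tst smooth_continuous_on borel_measurable_continuous_onI test_function_iff by blast
    have lim: "(\<lambda>k. ?\<phi> k x) \<longlonglongrightarrow> indicator {c<..d} x" for x
      using cutoff_tendsto elim e0 True by blast
    have M1: "(\<lambda>k. LINT x|M i. ?\<phi> k x) \<longlonglongrightarrow> (LINT x|M i. indicator {c<..d} x)" if i: "i \<in> I" for i
    proof -
      interpret finite_measure "M i" by (rule M(1)[OF i])
      have [measurable_cong]: "sets (M i) = sets borel" by (rule M(2)[OF i])
      show ?thesis
        by (rule integral_dominated_convergence[where w = "\<lambda>_. 1"])
          (use lim meas abs_cutoff_le_1 in auto)
    qed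
    let ?g = "\<lambda>x. indicat_real {a<..<b} x * g x"
    have gm: "?g \<in> borel_measurable lebesgue"
      using borel_measurable_integrable g unfolding set_integrable_def by force
    have G1: "(\<lambda>k. LINT x:{a<..<b}|lebesgue. g x * ?\<phi> k x) \<longlonglongrightarrow> (LINT x|lebesgue. (?g x) * indicator {c<..d} x)"
      unfolding set_lebesgue_integral_def real_scaleR_def mult.assoc[symmetric]
    proof (rule integral_dominated_convergence[where w = "\<lambda>x. \<bar>?g x\<bar>"])
      show "(\<lambda>x. ?g x * ?\<phi> k x) \<in> borel_measurable lebesgue" for k
        by (rule borel_measurable_times[OF gm]) (use meas[of k] in \<open>simp add: measurable_completion\<close>)
      show "(\<lambda>x. ?g x * indicator {c<..d} x) \<in> borel_measurable lebesgue"
        by (rule borel_measurable_times[OF gm], rule borel_measurable_indicator) simp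
      show "integrable lebesgue (\<lambda>x. \<bar>?g x\<bar>)"
        using g integrable_abs unfolding set_integrable_def by force
      show "AE x in lebesgue. (\<lambda>k. ?g x * ?\<phi> k x) \<longlonglongrightarrow> ?g x * indicator {c<..d} x"
        by (intro AE_I2 tendsto_intros lim)
      show "AE x in lebesgue. norm (?g x * ?\<phi> k x) \<le> \<bar>?g x\<bar>" for k
        using mult_left_mono[OF abs_cutoff_le_1[of c d "e k"] abs_ge_zero] by (intro AE_I2) (simp add: abs_mult mult_left_le abs_cutoff_le_1)
    qed
    have "(LINT x|lebesgue. (?g x) * indicator {c<..d} x) = (LINT x:{c<..d}|lebesgue. g x)"
      unfolding set_lebesgue_integral_def using c that
      by (intro Bochner_Integration.integral_cong) (auto simp: indicator_def)
    with G1 M1 have "(\<lambda>k. (LINT x:{a<..<b}|lebesgue. g x * ?\<phi> k x) + (\<Sum>i\<in>I. \<sigma> i * (LINT x|M i. ?\<phi> k x)))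
       \<longlonglongrightarrow> (LINT x:{c<..d}|lebesgue. g x) + (\<Sum>i\<in>I. \<sigma> i * (LINT x|M i. indicator {c<..d} x))"
      by (intro tendsto_add tendsto_sum tendsto_mult tendsto_const) auto
    then have "(LINT x:{c<..d}|lebesgue. g x) + (\<Sum>i\<in>I. \<sigma> i * (LINT x|M i. indicator {c<..d} x)) = 0"
      unfolding test[OF tst] by (rule LIMSEQ_unique) (rule tendsto_const)
    moreover have "(LINT x|M i. indicator {c<..d} x) = measure (M i) {c<..d}" if "i \<in> I" for i
      using spM[OF that] by simp
    ultimately show ?thesis by simp
  qed (simp add: set_lebesgue_integral_def)
  have sb: "sets (borel :: real measure) = sigma_sets UNIV (range (\<lambda>a. {..a}))"
    by (subst borel_eq_atMost) (rule sets_measure_of, simp)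
  define m where "m A = (LINT x:A \<inter> {c<..d}|lebesgue. g x) + (\<Sum>i\<in>I. \<sigma> i * measure (M i) (A \<inter> {c<..d}))" for A
  have "Int_stable (range (\<lambda>a::real. {..a}))" by (auto simp: Int_stable_def)
  moreover have "range (\<lambda>a::real. {..a}) \<subseteq> Pow UNIV" by simp
  moreover have "A \<in> sigma_sets UNIV (range (\<lambda>a::real. {..a}))" using A sb by simp
  ultimately have "m A = 0"
  proof (induction rule: sigma_sets_induct_disjoint)
    case (basic A)
    then obtain x where "A = {..x}" by blast
    then have "A \<inter> {c<..d} = {c<..min x d}" by auto
    then show ?case using iv[of "min x d"] d by (simp add: m_def)
  next
    case empty
    then show ?case by (simp add: m_def set_lebesgue_integral_def)
  next
    case (compl A)
    then have A: "A \<in> sets borel" using sb by simp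
    have u: "{c<..d} = (A \<inter> {c<..d}) \<union> ((UNIV - A) \<inter> {c<..d})" by blast
    have "(LINT x:{c<..d}|lebesgue. g x) = (LINT x:A \<inter> {c<..d}|lebesgue. g x) + (LINT x:(UNIV - A) \<inter> {c<..d}|lebesgue. g x)"
      by (subst u, rule set_integral_Un) (use A g c d in \<open>auto intro!: integrable_sub_Ioc\<close>)
    moreover have "measure (M i) {c<..d} = measure (M i) (A \<inter> {c<..d}) + measure (M i) ((UNIV - A) \<inter> {c<..d})"
      if "i \<in> I" for i
      by (subst u, rule finite_measure.finite_measure_Union[OF M(1)[OF that]]) (use A M(2)[OF that] in auto)
    then have "(\<Sum>i\<in>I. \<sigma> i * measure (M i) {c<..d}) = (\<Sum>i\<in>I. \<sigma> i * measure (M i) (A \<inter> {c<..d}))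
        + (\<Sum>i\<in>I. \<sigma> i * measure (M i) ((UNIV - A) \<inter> {c<..d}))"
      by (simp add: sum.distrib[symmetric] distrib_left[symmetric])
    ultimately show ?case using iv[OF d] compl(2) by (simp add: m_def)
  next
    case (union A)
    then have A: "A i \<in> sets borel" for i using union(2) unfolding sb by auto
    have dj: "disjoint_family (\<lambda>i. A i \<inter> {c<..d})"
      using union(1) by (auto simp: disjoint_family_on_def)
    have u: "(\<Union>i. A i) \<inter> {c<..d} = (\<Union>i. A i \<inter> {c<..d})" by blast
    show ?case unfolding m_def u
    proof (rule lebesgue_UN_signed_sums_0)
      show "L1_on (\<Union>i. A i \<inter> {c<..d}) g"
        unfolding u[symmetric] using A g c d by (intro integrable_sub_Ioc) auto
      show "(\<lambda>n. \<Sum>i\<in>I. \<sigma> i * measure (M i) (A n \<inter> {c<..d})) sums (\<Sum>i\<in>I. \<sigma> i * measure (M i) (\<Union>n. A n \<inter> {c<..d}))"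
        by (intro sums_sum sums_mult finite_measure.finite_measure_UNION[OF M(1) _ dj]) (use A M(2) in auto)
    qed (use A dj union(3) in \<open>auto simp: m_def\<close>)
  qed
  then show ?thesis by (simp add: m_def)
qed

text \<open>The set \<open>A\<close> where a Borel version of \<open>g\<close> is positive, with
  \<open>Z\<close> removed, is null for all \<open>M i\<close>. So the integral of \<open>g\<close>
  over \<open>A\<close> within \<open>{c<..d}\<close> vanishes, and since \<open>g\<close> is
  positive there, this set is Lebesgue null. Countably many intervals exhaust (a,b).\<close>

lemma test_function_nonpos:
  fixes g :: "real \<Rightarrow> real"
  assumes g: "L1_on {a<..<b} g"
    and M: "\<And>i. i \<in> I \<Longrightarrow> finite_measure (M i)" "\<And>i. i \<in> I \<Longrightarrow> sets (M i) = sets borel"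
    and Z: "Z \<in> null_sets lborel" "\<And>i. i \<in> I \<Longrightarrow> emeasure (M i) (- Z) = 0"
    and test: "\<And>\<phi>. test_function a b \<phi> \<Longrightarrow>
      (LINT x:{a<..<b}|lebesgue. g x * \<phi> x) + (\<Sum>i\<in>I. \<sigma> i * (LINT x|M i. \<phi> x)) = 0"
  shows "AE x\<in>{a<..<b} in lebesgue. g x \<le> 0"
proof -
  have Zb: "Z \<in> sets borel" using Z(1) by auto
  have gm: "(\<lambda>x. indicat_real {a<..<b} x * g x) \<in> borel_measurable lebesgue"
    using borel_measurable_integrable g unfolding set_integrable_def by force
  obtain g' where g': "g' \<in> borel_measurable borel" "AE x in lborel. indicat_real {a<..<b} x * g x = g' x"
    using completion_ex_borel_measurable_real[OF gm] by auto
  define A where "A = {x. 0 < g' x} - Z"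
  have A: "A \<in> sets borel"
    using g'(1) Zb unfolding A_def by (intro sets.Diff) auto
  have nZ: "AE x in lebesgue. x \<notin> Z"
    using Z(1) AE_completion AE_not_in by blast
  have iv: "AE x\<in>{c<..d} in lebesgue. g x \<le> 0" if c: "a < c" and d: "d < b" for c d
  proof -
    have "measure (M i) (A \<inter> {c<..d}) = 0" if i: "i \<in> I" for i
    proof -
      have "emeasure (M i) (A \<inter> {c<..d}) \<le> emeasure (M i) (- Z)"
        by (rule emeasure_mono) (use M(2)[OF i] Zb in \<open>auto simp: A_def\<close>)
      then show ?thesis using Z(2)[OF i] by (simp add: measure_def)
    qed
    then have "(LINT x:A \<inter> {c<..d}|lebesgue. g x) = 0"
      using signed_measure_zero_on_borel[where I = I and M = M, OF g M test c d A] by simp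
    moreover have "AE x in lebesgue. 0 \<le> indicat_real (A \<inter> {c<..d}) x *\<^sub>R g x"
      using AE_completion[OF g'(2)]
      by eventually_elim (use c d in \<open>auto simp: A_def indicator_def\<close>)
    moreover have "integrable lebesgue (\<lambda>x. indicat_real (A \<inter> {c<..d}) x *\<^sub>R g x)"
      using integrable_sub_Ioc[OF g c d, of A] A unfolding set_integrable_def by auto
    ultimately have "AE x in lebesgue. indicat_real (A \<inter> {c<..d}) x *\<^sub>R g x = 0"
      unfolding set_lebesgue_integral_def using integral_nonneg_eq_0_iff_AE by blast
    then show ?thesis using nZ AE_completion[OF g'(2)]
      by eventually_elim (use c d in \<open>auto simp: A_def indicator_def split: if_splits\<close>)
  qed
  have "AE x in lebesgue. \<forall>k. x \<in> {a + 1 / real (k + 1) <.. b - 1 / real (k + 1)} \<longrightarrow> g x \<le> 0"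
    unfolding AE_all_countable by (intro allI iv) auto
  then show ?thesis
  proof eventually_elim
    case (elim x)
    show ?case
    proof
      assume x: "x \<in> {a<..<b}"
      then obtain k where "inverse (real (Suc k)) < min (x - a) (b - x)"
        using reals_Archimedean[of "min (x - a) (b - x)"] by auto
      then have "x \<in> {a + 1 / real (k + 1) <.. b - 1 / real (k + 1)}" by (auto simp: field_simps)
      then show "g x \<le> 0" using elim by blast
    qed
  qed
qed

text \<open>Applies the one-sided result to \<open>g\<close> and to \<open>- g\<close>, with the
  signs \<sigma> reversed. For empty \<open>I\<close> this is the classical fundamental lemma of the
  calculus of variations.\<close>

lemma test_function_zero:
  fixes g :: "real \<Rightarrow> real"
  assumes g: "L1_on {a<..<b} g"
    and M: "\<And>i. i \<in> I \<Longrightarrow> finite_measure (M i)" "\<And>i. i \<in> I \<Longrightarrow> sets (M i) = sets borel"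
    and Z: "Z \<in> null_sets lborel" "\<And>i. i \<in> I \<Longrightarrow> emeasure (M i) (- Z) = 0"
    and test: "\<And>\<phi>. test_function a b \<phi> \<Longrightarrow>
      (LINT x:{a<..<b}|lebesgue. g x * \<phi> x) + (\<Sum>i\<in>I. \<sigma> i * (LINT x|M i. \<phi> x)) = 0"
  shows "AE x\<in>{a<..<b} in lebesgue. g x = 0"
proof -
  have "AE x\<in>{a<..<b} in lebesgue. - g x \<le> 0"
  proof (rule test_function_nonpos[where I = I and M = M and \<sigma> = "\<lambda>i. - \<sigma> i", OF _ M Z])
    show "L1_on {a<..<b} (\<lambda>x. - g x)" using g by (simp add: set_integrable_def)
    show "(LINT x:{a<..<b}|lebesgue. - g x * \<phi> x) + (\<Sum>i\<in>I. - \<sigma> i * (LINT x|M i. \<phi> x)) = 0"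
      if "test_function a b \<phi>" for \<phi>
      using test[OF that] by (simp add: set_lebesgue_integral_def sum_negf)
  qed
  moreover have "AE x\<in>{a<..<b} in lebesgue. g x \<le> 0"
    by (rule test_function_nonpos[where I = I and M = M and \<sigma> = \<sigma>, OF g M Z]) (fact test | assumption)+
  ultimately show ?thesis by eventually_elim auto
qed

section \<open>Primitives and integration by parts\<close>

lemmas HK_integral_add = Henstock_Kurzweil_Integration.integral_add
lemmas L1_on_imp_HK = set_lebesgue_integral_eq_integral(1)

text \<open>Completeness of Lebesgue measure carries measurability across a.e. equality; if
  integrability fails, it fails on both sides and both integrals have the default value 0.\<close>

lemma integrable_lebesgue_AE_cong:
  fixes f g :: "real \<Rightarrow> real"
  assumes "AE x in lebesgue. f x = g x"
  shows "integrable lebesgue f \<longleftrightarrow> integrable lebesgue g" "integral\<^sup>L lebesgue f = integral\<^sup>L lebesgue g"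
proof -
  have 1: "integrable lebesgue g" if "integrable lebesgue f" "AE x in lebesgue. f x = g x" for f g :: "real \<Rightarrow> real"
    using that borel_measurable_AE[of f g] integrable_cong_AE[of f lebesgue g] borel_measurable_integrable by blast
  show 2: "integrable lebesgue f \<longleftrightarrow> integrable lebesgue g"
    using 1[of f g] 1[of g f] assms by (auto simp: eq_commute)
  show "integral\<^sup>L lebesgue f = integral\<^sup>L lebesgue g"
  proof (cases "integrable lebesgue f")
    case True
    then show ?thesis using 2 assms by (intro integral_cong_AE) auto
  next
    case False
    then show ?thesis using 2 by (simp add: not_integrable_integral_eq)
  qed
qed

lemma set_integral_lebesgue_AE_cong:
  fixes f g :: "real \<Rightarrow> real"
  assumes "AE x\<in>S in lebesgue. f x = g x"
  shows "L1_on S f \<longleftrightarrow> L1_on S g"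
    "(LINT x:S|lebesgue. f x) = (LINT x:S|lebesgue. g x)"
proof -
  have "AE x in lebesgue. indicat_real S x *\<^sub>R f x = indicat_real S x *\<^sub>R g x"
    using assms by eventually_elim (auto simp: indicator_def)
  from integrable_lebesgue_AE_cong[OF this]
  show "L1_on S f \<longleftrightarrow> L1_on S g"
    "(LINT x:S|lebesgue. f x) = (LINT x:S|lebesgue. g x)"
    by (simp_all add: set_integrable_def set_lebesgue_integral_def)
qed

lemma L1_on_Ioo_iff_Icc:
  fixes f :: "real \<Rightarrow> real"
  shows "L1_on {a<..<b} f \<longleftrightarrow> L1_on {a..b} f"
  by (rule set_integrable_discrete_difference[where X = "{a,b}"]) auto

lemma L1_on_Ioo_integral:
  fixes f :: "real \<Rightarrow> real"
  assumes "L1_on {a..b} f"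
  shows "(LINT x:{a<..<b}|lebesgue. f x) = integral {a..b} f"
proof -
  have "(LINT x:{a<..<b}|lebesgue. f x) = (LINT x:{a..b}|lebesgue. f x)"
    by (rule set_integral_discrete_difference[where X = "{a,b}"]) auto
  then show ?thesis using set_lebesgue_integral_eq_integral[OF assms] by simp
qed

lemma L1_on_subset:
  fixes f :: "real \<Rightarrow> real"
  assumes "L1_on {a..b} f" "a \<le> c" "d \<le> b"
  shows "L1_on {c..d} f"
  by (rule set_integrable_subset[OF assms(1)]) (use assms in auto)

lemma L1_on_continuous:
  fixes f :: "real \<Rightarrow> real"
  assumes "continuous_on {a..b} f"
  shows "L1_on {a..b} f"
  using absolutely_integrable_continuous_real[OF assms] .

lemma L1_on_continuous_mult:
  fixes f g :: "real \<Rightarrow> real"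
  assumes "continuous_on {a..b} f" "L1_on {a..b} g"
  shows "L1_on {a..b} (\<lambda>x. f x * g x)"
proof (rule absolutely_integrable_bounded_measurable_product_real)
  show "f \<in> borel_measurable (lebesgue_on {a..b})"
    using assms(1) by (simp add: continuous_imp_measurable_on_sets_lebesgue)
  show "bounded (f ` {a..b})"
    using assms(1) compact_continuous_image compact_imp_bounded by blast
qed (use assms in auto)

lemma smooth_set_integrable: "smooth \<phi> \<Longrightarrow> L1_on {a..b} \<phi>"
  by (simp add: L1_on_continuous smooth_continuous_on)

lemma smooth_integral_deriv:
  assumes "smooth \<phi>" "a \<le> b" shows "integral {a..b} (deriv \<phi>) = \<phi> b - \<phi> a"
  by (rule integral_unique, rule fundamental_theorem_of_calculus[OF assms(2)])
    (use smooth_DERIV[OF assms(1)] in \<open>auto simp: has_real_derivative_iff_has_vector_derivative[symmetric]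
      intro: has_field_derivative_at_within\<close>)

text \<open>The du Bois-Reymond lemma. For a test function \<psi> with integral \<open>m\<close>,
  \<psi> - m \<theta>' is the derivative of a test function, where \<theta>' has integral 1. Testing
  with it shows that \<open>v - K\<close> is orthogonal to \<psi>, where \<open>K\<close> is the
  integral of v \<theta>'.\<close>

lemma weak_derivative_0_imp_const:
  fixes v :: "real \<Rightarrow> real"
  assumes ab: "a < b" and v: "L1_on {a..b} v"
    and test: "\<And>\<phi>. test_function a b \<phi> \<Longrightarrow> (LINT x:{a<..<b}|lebesgue. v x * deriv \<phi> x) = 0"
  obtains K where "AE x\<in>{a<..<b} in lebesgue. v x = K"
proof -
  \<comment> \<open>\<theta> climbs from 0 to 1 within the second quarter of (a,b), so its
    derivative has integral 1 and support inside (a,b).\<close>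
  define c0 where "c0 = a + (b - a) / 4"
  define e0 where "e0 = (b - a) / 4"
  define \<theta> where "\<theta> x = smoothstep ((x - c0) / e0)" for x
  have \<theta>: "smooth \<theta>" unfolding \<theta>_def by (rule smooth_smoothstep_scaled)
  have \<theta>0: "\<theta> x = 0" if "x \<le> c0" for x
    using that ab by (auto simp: \<theta>_def e0_def intro!: smoothstep(3) divide_nonpos_pos)
  have \<theta>1: "\<theta> x = 1" if "x \<ge> c0 + e0" for x
    using that ab by (auto simp: \<theta>_def e0_def intro!: smoothstep(4) simp: field_simps)
  define K where "K = (LINT x:{a<..<b}|lebesgue. v x * deriv \<theta> x)"
  have vi: "L1_on {a<..<b} (\<lambda>x. v x * \<psi> x)" if "smooth \<psi>" for \<psi>
    using L1_on_continuous_mult[OF smooth_continuous_on[OF that] v]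
    by (simp add: L1_on_Ioo_iff_Icc mult.commute)
  have si: "L1_on {a<..<b} \<psi>" if "smooth \<psi>" for \<psi>
    using smooth_set_integrable[OF that] by (simp add: L1_on_Ioo_iff_Icc)
  have key: "(LINT x:{a<..<b}|lebesgue. (v x - K) * \<psi> x) = 0" if \<psi>: "test_function a b \<psi>" for \<psi>
  proof -
    obtain c d where cd: "smooth \<psi>" "a < c" "c < d" "d < b" "\<And>x. x \<le> c \<or> d \<le> x \<Longrightarrow> \<psi> x = 0"
      using test_functionE[OF \<psi> ab] by metis
    obtain \<Psi> where "\<And>x::real. (\<Psi> has_vector_derivative \<psi> x) (at x)"
      using einterval_antiderivative[of "-\<infinity>" \<infinity> \<psi>] smooth_isCont[OF cd(1)] by auto
    then have D: "(\<Psi> has_field_derivative \<psi> x) (at x)" for x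
      by (simp add: has_real_derivative_iff_has_vector_derivative)
    have s\<Psi>: "smooth \<Psi>" using smooth_antiderivative D cd(1) by blast
    have left: "\<Psi> x = \<Psi> c" if "x \<le> c" for x
      by (rule antiderivative_const[OF D, of x c]) (use cd(5) that in auto)
    have right: "\<Psi> x = \<Psi> d" if "d \<le> x" for x
      by (rule antiderivative_const[OF D, of d x]) (use cd(5) that in auto)
    define m where "m = \<Psi> d - \<Psi> c"
    \<comment> \<open>A primitive of \<psi> equals \<open>m\<close> to the right of the support of
      \<psi>, up to its value at \<open>c\<close>; subtracting \<open>m * \<theta> x\<close>
      restores compact support.\<close>
    define \<phi> where "\<phi> x = (\<Psi> x - \<Psi> c) - m * \<theta> x" for x
    have s\<phi>: "smooth \<phi>" unfolding \<phi>_def by (intro smooth_diff smooth_mult smooth_const \<theta> s\<Psi>)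
    have t\<phi>: "test_function a b \<phi>"
    proof (rule test_functionI[OF s\<phi>, of _ "min c c0" "max d (c0 + e0)"])
      show "a < min c c0" "max d (c0 + e0) < b" using cd ab by (simp_all add: c0_def e0_def field_simps)
      show "\<phi> x = 0" if "x < min c c0 \<or> max d (c0 + e0) < x" for x
        using that
      proof
        assume "x < min c c0"
        then show ?thesis using left[of x] \<theta>0[of x] by (simp add: \<phi>_def)
      next
        assume "max d (c0 + e0) < x"
        then show ?thesis using right[of x] \<theta>1[of x] by (simp add: \<phi>_def m_def)
      qed
    qed
    have d\<Psi>: "deriv \<Psi> = \<psi>" using D DERIV_imp_deriv by blast
    have d\<phi>: "deriv \<phi> x = \<psi> x - m * deriv \<theta> x" for x
      unfolding \<phi>_def
      by (rule DERIV_imp_deriv) (auto intro!: derivative_eq_intros D smooth_DERIV[OF \<theta>])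
    have "integral {a..b} \<psi> = m"
      using smooth_integral_deriv[OF s\<Psi>, of a b] ab left[of a] right[of b] cd by (simp add: d\<Psi> m_def)
    then have m: "(LINT x:{a<..<b}|lebesgue. \<psi> x) = m"
      using L1_on_Ioo_integral smooth_set_integrable[OF cd(1)] by metis
    have "0 = (LINT x:{a<..<b}|lebesgue. v x * \<psi> x - m * (v x * deriv \<theta> x))"
      using test[OF t\<phi>] by (simp add: d\<phi> algebra_simps)
    also have "\<dots> = (LINT x:{a<..<b}|lebesgue. v x * \<psi> x) - m * K"
      unfolding K_def using vi[OF cd(1)] vi[OF smooth_deriv[OF \<theta>]]
      by (subst set_integral_diff(2)) auto
    also have "\<dots> = (LINT x:{a<..<b}|lebesgue. v x * \<psi> x) - (LINT x:{a<..<b}|lebesgue. K * \<psi> x)"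
      by (simp add: m)
    also have "\<dots> = (LINT x:{a<..<b}|lebesgue. (v x - K) * \<psi> x)"
      using vi[OF cd(1)] si[OF cd(1)] by (subst set_integral_diff(2)[symmetric]) (auto simp: algebra_simps)
    finally show ?thesis by simp
  qed
  have vK: "L1_on {a<..<b} (\<lambda>x. v x - K)"
    using v si[OF smooth_const] by (intro set_integral_diff(1)) (auto simp: L1_on_Ioo_iff_Icc)
  have "AE x\<in>{a<..<b} in lebesgue. v x - K = 0"
    using key by (intro test_function_zero[OF vK, of "{}" "\<lambda>_. borel" "{}"]) auto
  then show ?thesis by (intro that[of K]) auto
qed

text \<open>For x < a the interval \<open>{a..x}\<close> is empty and the value is 0, so that
  comparisons such as \<open>prim_cong\<close> bound x from above only.\<close>

definition prim :: "real \<Rightarrow> (real \<Rightarrow> real) \<Rightarrow> real \<Rightarrow> real" where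
  "prim a g x = integral {a..x} g"

lemma prim_self [simp]: "prim a g a = 0"
  by (simp add: prim_def)

lemma prim_diff:
  assumes "L1_on {a..b} g" "a \<le> x" "x \<le> y" "y \<le> b"
  shows "prim a g y - prim a g x = integral {x..y} g"
proof -
  have "g integrable_on {a..y}"
    using L1_on_subset[OF assms(1), of a y] assms L1_on_imp_HK by auto
  then show ?thesis using Henstock_Kurzweil_Integration.integral_combine[of a x y g] assms
    by (simp add: prim_def)
qed

lemma prim_shift:
  assumes "L1_on {a..b} g" "a \<le> c" "c \<le> x" "x \<le> b"
  shows "prim a g x = prim a g c + prim c g x"
  using prim_diff[OF assms(1), of c x] assms by (simp add: prim_def)

lemma continuous_on_prim:
  assumes "L1_on {a..b} g"
  shows "continuous_on {a..b} (prim a g)"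
  using indefinite_integral_continuous_1[of g a b] L1_on_imp_HK[OF assms]
  by (simp add: prim_def[abs_def])

lemma abs_integral_le:
  fixes f :: "real \<Rightarrow> real"
  assumes "L1_on {a..b} f"
  shows "\<bar>integral {a..b} f\<bar> \<le> integral {a..b} (\<lambda>x. \<bar>f x\<bar>)"
  using integral_norm_bound_integral[of f "{a..b}" "\<lambda>x. \<bar>f x\<bar>"]
    L1_on_imp_HK[OF assms]
    L1_on_imp_HK[OF set_integrable_abs[OF assms]]
  by auto

text \<open>\<open>D\<close> below has derivative zero: its increments are bounded by the increment of the argument
  times an increment of the continuous function \<open>\<integral> \<bar>g\<bar>\<close>.\<close>

lemma prim_integration_by_parts:
  assumes ab: "a < b" and g: "L1_on {a..b} g" and \<phi>: "smooth \<phi>"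
  shows "integral {a..b} (\<lambda>x. prim a g x * deriv \<phi> x + g x * \<phi> x) = prim a g b * \<phi> b"
proof -
  define G where "G = prim a g"
  define \<Gamma> where "\<Gamma> = prim a (\<lambda>x. \<bar>g x\<bar>)"
  define k where "k x = G x * deriv \<phi> x + g x * \<phi> x" for x
  have ag: "L1_on {a..b} (\<lambda>x. \<bar>g x\<bar>)"
    by (rule set_integrable_abs[OF g])
  have cG: "continuous_on {a..b} G" unfolding G_def by (rule continuous_on_prim[OF g])
  have c\<Gamma>: "continuous_on {a..b} \<Gamma>" unfolding \<Gamma>_def by (rule continuous_on_prim[OF ag])
  have c\<phi>: "continuous_on S \<phi>" "continuous_on S (deriv \<phi>)" for S
    using smooth_continuous_on \<phi> smooth_deriv by blast+
  have i1: "L1_on {a..b} (\<lambda>x. G x * deriv \<phi> x)"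
    by (intro L1_on_continuous continuous_intros cG c\<phi>)
  have i2: "L1_on {a..b} (\<lambda>x. g x * \<phi> x)"
    using L1_on_continuous_mult[OF c\<phi>(1) g] by (simp add: mult.commute)
  have ik: "L1_on {a..b} k"
    unfolding k_def by (intro set_integral_add i1 i2)
  obtain M where M: "M > 0" "\<And>x. x \<in> {a..b} \<Longrightarrow> \<bar>deriv \<phi> x\<bar> \<le> M"
    using compact_imp_bounded[OF compact_continuous_image[OF c\<phi>(2)[of "{a..b}"] compact_Icc]]
    unfolding bounded_pos by auto
  define D where "D x = prim a k x - G x * \<phi> x" for x
  have \<phi>lip: "\<bar>\<phi> s - \<phi> t\<bar> \<le> M * (y - x)" if "a \<le> x" "x \<le> s" "s \<le> y" "x \<le> t" "t \<le> y" "y \<le> b" for x y s t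
  proof -
    have "norm (\<phi> s - \<phi> t) \<le> M * norm (s - t)"
      by (rule field_differentiable_bound[of "{x..y}" \<phi> "deriv \<phi>"])
        (use that M(2) smooth_DERIV[OF \<phi>] in \<open>auto intro: has_field_derivative_at_within\<close>)
    also have "\<dots> \<le> M * (y - x)" using that M(1) by (intro mult_left_mono) auto
    finally show ?thesis by simp
  qed
  have \<Gamma>mono: "\<Gamma> x \<le> \<Gamma> y" if xy: "a \<le> x" "x \<le> y" "y \<le> b" for x y
  proof -
    have "0 \<le> integral {x..y} (\<lambda>x. \<bar>g x\<bar>)"
      by (rule Henstock_Kurzweil_Integration.integral_nonneg[OF L1_on_imp_HK[OF L1_on_subset[OF ag]]])
            (use xy in auto)
    then show ?thesis unfolding \<Gamma>_def using prim_diff[OF ag, of x y] xy by auto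
  qed
  have inc: "\<bar>D y - D x\<bar> \<le> 2 * M * (y - x) * (\<Gamma> y - \<Gamma> x)" if xy: "a \<le> x" "x \<le> y" "y \<le> b" for x y
  proof -
    have sub: "L1_on {x..y} h" if "L1_on {a..b} h" for h :: "real \<Rightarrow> real"
      using L1_on_subset[OF that] xy by auto
      have \<Gamma>xy: "integral {x..y} (\<lambda>x. \<bar>g x\<bar>) = \<Gamma> y - \<Gamma> x"
      unfolding \<Gamma>_def using prim_diff[OF ag] xy by auto
    have Gxy: "integral {x..y} g = G y - G x"
      unfolding G_def using prim_diff[OF g] xy by auto
    have p1: "L1_on {x..y} (\<lambda>t. (G t - G x) * deriv \<phi> t)"
      by (intro L1_on_continuous continuous_intros continuous_on_subset[OF cG] c\<phi>) (use xy in auto)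
    have p2: "L1_on {x..y} (\<lambda>t. (\<phi> t - \<phi> y) * g t)"
      by (intro L1_on_continuous_mult continuous_intros c\<phi> sub g)
    have i\<phi>: "L1_on {x..y} (\<lambda>t. G x * deriv \<phi> t)"
      by (intro L1_on_continuous continuous_intros c\<phi>)
    have ig: "L1_on {x..y} (\<lambda>t. \<phi> y * g t)"
      by (intro L1_on_continuous_mult continuous_intros sub g)
    have "prim a k y - prim a k x = integral {x..y} k"
      using prim_diff[OF ik] xy by auto
    also have "\<dots> = integral {x..y} (\<lambda>t. ((G t - G x) * deriv \<phi> t + (\<phi> t - \<phi> y) * g t) + (G x * deriv \<phi> t + \<phi> y * g t))"
      by (rule arg_cong[where f = "integral _"]) (simp add: k_def fun_eq_iff algebra_simps)
    also have "\<dots> = (integral {x..y} (\<lambda>t. (G t - G x) * deriv \<phi> t) + integral {x..y} (\<lambda>t. (\<phi> t - \<phi> y) * g t))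
        + (G x * (\<phi> y - \<phi> x) + \<phi> y * (G y - G x))"
      using L1_on_imp_HK[OF p1] L1_on_imp_HK[OF p2] L1_on_imp_HK[OF i\<phi>] L1_on_imp_HK[OF ig] smooth_integral_deriv[OF \<phi>, of x y] xy
      by (simp add: HK_integral_add integrable_add Gxy)
    finally have "D y - D x = integral {x..y} (\<lambda>t. (G t - G x) * deriv \<phi> t) + integral {x..y} (\<lambda>t. (\<phi> t - \<phi> y) * g t)"
      by (simp add: D_def algebra_simps)
    moreover have "norm (integral {x..y} (\<lambda>t. (G t - G x) * deriv \<phi> t)) \<le> integral {x..y} (\<lambda>t. (\<Gamma> y - \<Gamma> x) * M)"
    proof (rule integral_norm_bound_integral[OF L1_on_imp_HK[OF p1]])
      fix t assume t: "t \<in> {x..y}"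
      have "\<bar>G t - G x\<bar> \<le> integral {x..t} (\<lambda>x. \<bar>g x\<bar>)"
        unfolding G_def using prim_diff[OF g, of x t] t xy
          abs_integral_le[OF L1_on_subset[OF g], of x t] by auto
      also have "\<dots> = \<Gamma> t - \<Gamma> x" unfolding \<Gamma>_def using prim_diff[OF ag, of x t] t xy by auto
      also have "\<dots> \<le> \<Gamma> y - \<Gamma> x" using \<Gamma>mono[of t y] t xy by auto
      finally show "norm ((G t - G x) * deriv \<phi> t) \<le> (\<Gamma> y - \<Gamma> x) * M"
        using M(2)[of t] t xy by (simp add: abs_mult mult_mono)
    qed (auto intro: integrable_const_ivl)
    moreover have "norm (integral {x..y} (\<lambda>t. (\<phi> t - \<phi> y) * g t)) \<le> integral {x..y} (\<lambda>t. M * (y - x) * \<bar>g t\<bar>)"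
    proof (rule integral_norm_bound_integral[OF L1_on_imp_HK[OF p2]])
      show "(\<lambda>t. M * (y - x) * \<bar>g t\<bar>) integrable_on {x..y}"
        by (intro L1_on_imp_HK set_integrable_mult_right sub[OF ag])
      fix t assume "t \<in> {x..y}"
      then show "norm ((\<phi> t - \<phi> y) * g t) \<le> M * (y - x) * \<bar>g t\<bar>"
        using \<phi>lip[of x t y y] xy by (simp add: abs_mult mult_right_mono)
    qed
    ultimately have "\<bar>D y - D x\<bar> \<le> integral {x..y} (\<lambda>t. (\<Gamma> y - \<Gamma> x) * M) + integral {x..y} (\<lambda>t. M * (y - x) * \<bar>g t\<bar>)"
      unfolding real_norm_def by linarith
    also have "\<dots> = 2 * M * (y - x) * (\<Gamma> y - \<Gamma> x)"
      using xy by (simp add: \<Gamma>xy)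
    finally show ?thesis .
  qed
  have "D a = D b"
  proof (rule DERIV_0_imp_const[of a b D])
    show "continuous_on {a..b} D"
      unfolding D_def by (intro continuous_intros continuous_on_prim[OF ik] cG c\<phi>)
    fix x assume x: "a < x" "x < b"
    \<comment> \<open>The factor y - x of the increment bound cancels in the difference quotient,
      which leaves an increment of the continuous \<Gamma>.\<close>
    have lim: "((\<lambda>y. 2 * M * \<bar>\<Gamma> y - \<Gamma> x\<bar>) \<longlongrightarrow> 0) (at x)"
    proof -
      have "(\<Gamma> \<longlongrightarrow> \<Gamma> x) (at x)"
        using c\<Gamma> x by (metis at_within_Icc_at atLeastAtMost_iff continuous_on less_imp_le)
      then have "((\<lambda>y. 2 * M * \<bar>\<Gamma> y - \<Gamma> x\<bar>) \<longlongrightarrow> 2 * M * \<bar>\<Gamma> x - \<Gamma> x\<bar>) (at x)"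
        by (intro tendsto_intros)
      then show ?thesis by simp
    qed
    have "\<forall>\<^sub>F y in at x. norm ((D y - D x) / (y - x)) \<le> 2 * M * \<bar>\<Gamma> y - \<Gamma> x\<bar>"
    proof -
      have "\<forall>\<^sub>F y in at x. y \<in> {a<..<b} - {x}"
        using x by (intro eventually_at_in_open) auto
      then show ?thesis
      proof eventually_elim
        case (elim y)
        have "\<bar>D y - D x\<bar> \<le> 2 * M * \<bar>\<Gamma> y - \<Gamma> x\<bar> * \<bar>y - x\<bar>"
        proof (cases "x \<le> y")
          case True
          then show ?thesis using inc[of x y] \<Gamma>mono[of x y] elim x by (simp add: algebra_simps)
        next
          case False
          then show ?thesis using inc[of y x] \<Gamma>mono[of y x] elim x by (simp add: algebra_simps abs_minus_commute)
        qed
        then show ?case using elim by (simp add: divide_le_eq)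
      qed
    qed
    then have "((\<lambda>y. (D y - D x) / (y - x)) \<longlongrightarrow> 0) (at x)"
      by (rule Lim_null_comparison[OF _ lim])
    then show "(D has_field_derivative 0) (at x)"
      by (simp add: has_field_derivative_iff)
  qed (use ab in auto)
  then have "prim a k b = G b * \<phi> b" by (simp add: D_def G_def)
  then show ?thesis by (simp add: prim_def k_def[abs_def] G_def)
qed

section \<open>Square integrable functions and \<open>H\<^sup>2\<close> pieces\<close>

lemma L2_on_iff:
  "L2_on S f \<longleftrightarrow> (\<lambda>x. indicat_real S x * f x) \<in> borel_measurable lebesgue \<and>
     integrable lebesgue (\<lambda>x. (indicat_real S x * f x)\<^sup>2)"
proof -
  have "(\<lambda>x. indicat_real S x *\<^sub>R (f x)\<^sup>2) = (\<lambda>x. (indicat_real S x * f x)\<^sup>2)"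
    by (auto simp: indicator_def fun_eq_iff)
  then show ?thesis by (simp add: L2_on_def set_borel_measurable_def set_integrable_def)
qed

lemma L2_on_AE_cong:
  assumes "AE x in lebesgue. indicat_real S x * f x = indicat_real T x * g x"
  shows "L2_on S f \<longleftrightarrow> L2_on T g"
proof -
  have sym: "AE x in lebesgue. indicat_real T x * g x = indicat_real S x * f x"
    using assms by eventually_elim simp
  have "AE x in lebesgue. (indicat_real S x * f x)\<^sup>2 = (indicat_real T x * g x)\<^sup>2"
    using assms by eventually_elim simp
  from integrable_lebesgue_AE_cong(1)[OF this]
  have "integrable lebesgue (\<lambda>x. (indicat_real S x * f x)\<^sup>2) \<longleftrightarrow>
    integrable lebesgue (\<lambda>x. (indicat_real T x * g x)\<^sup>2)" .
  moreover have "(\<lambda>x. indicat_real S x * f x) \<in> borel_measurable lebesgue \<longleftrightarrow>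
    (\<lambda>x. indicat_real T x * g x) \<in> borel_measurable lebesgue"
    using borel_measurable_AE[OF _ assms] borel_measurable_AE[OF _ sym] by blast
  ultimately show ?thesis unfolding L2_on_iff by blast
qed

lemma L2_on_cong:
  assumes "AE x\<in>S in lebesgue. f x = g x"
  shows "L2_on S f \<longleftrightarrow> L2_on S g"
  by (rule L2_on_AE_cong, use assms in eventually_elim) (auto simp: indicator_def)

lemma L2_on_mult:
  assumes "L2_on S f" "L2_on S g"
  shows "L1_on S (\<lambda>x. f x * g x)"
proof -
  let ?f = "\<lambda>x. indicat_real S x * f x" and ?g = "\<lambda>x. indicat_real S x * g x"
  have "integrable lebesgue (\<lambda>x. ?f x * ?g x)"
  proof (rule Bochner_Integration.integrable_bound)
    show "integrable lebesgue (\<lambda>x. (?f x)\<^sup>2 + (?g x)\<^sup>2)"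
      using assms by (simp add: L2_on_iff)
    show "AE x in lebesgue. norm (?f x * ?g x) \<le> norm ((?f x)\<^sup>2 + (?g x)\<^sup>2)"
    proof (rule AE_I2)
      have bound: "norm (p * q) \<le> norm (p\<^sup>2 + q\<^sup>2)" for p q :: real
      proof -
        have "2 * \<bar>p * q\<bar> \<le> p\<^sup>2 + q\<^sup>2"
          using sum_squares_bound[of "\<bar>p\<bar>" "\<bar>q\<bar>"] by (simp add: abs_mult mult.assoc)
        then show ?thesis unfolding real_norm_def by linarith
      qed
      show "norm (?f x * ?g x) \<le> norm ((?f x)\<^sup>2 + (?g x)\<^sup>2)" for x by (rule bound)
    qed
    show "(\<lambda>x. ?f x * ?g x) \<in> borel_measurable lebesgue"
      by (rule borel_measurable_times) (use assms in \<open>auto simp: L2_on_iff\<close>)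
  qed
  moreover have "(\<lambda>x. ?f x * ?g x) = (\<lambda>x. indicat_real S x *\<^sub>R (f x * g x))"
    by (auto simp: indicator_def fun_eq_iff)
  ultimately show ?thesis by (simp add: set_integrable_def)
qed

lemma L2_on_cmult: "L2_on S f \<Longrightarrow> L2_on S (\<lambda>x. c * f x)"
proof -
  assume f: "L2_on S f"
  have "(\<lambda>x. c * (indicat_real S x * f x)) \<in> borel_measurable lebesgue"
    by (rule borel_measurable_times) (use f in \<open>auto simp: L2_on_iff\<close>)
  moreover have "integrable lebesgue (\<lambda>x. c\<^sup>2 * (indicat_real S x * f x)\<^sup>2)"
    using f by (auto simp: L2_on_iff)
  ultimately show "L2_on S (\<lambda>x. c * f x)"
    by (simp add: L2_on_iff mult.left_commute power_mult_distrib)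
qed

lemma L2_on_add:
  assumes "L2_on S f" "L2_on S g"
  shows "L2_on S (\<lambda>x. f x + g x)"
proof -
  have "(\<lambda>x. indicat_real S x * f x + indicat_real S x * g x) \<in> borel_measurable lebesgue"
    by (rule borel_measurable_add) (use assms in \<open>auto simp: L2_on_iff\<close>)
  moreover have "L1_on S (\<lambda>x. (f x)\<^sup>2 + 2 * (f x * g x) + (g x)\<^sup>2)"
    using assms L2_on_mult[OF assms] by (intro set_integral_add) (auto simp: L2_on_def)
  moreover have "(\<lambda>x. (f x)\<^sup>2 + 2 * (f x * g x) + (g x)\<^sup>2) = (\<lambda>x. (f x + g x)\<^sup>2)"
    by (auto simp: power2_eq_square algebra_simps)
  ultimately show ?thesis by (simp add: L2_on_def set_borel_measurable_def algebra_simps)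
qed

lemma L2_on_diff:
  assumes "L2_on S f" "L2_on S g"
  shows "L2_on S (\<lambda>x. f x - g x)"
  using L2_on_add[OF assms(1) L2_on_cmult[OF assms(2), of "-1"]] by simp

lemma L2_on_subset:
  assumes "L2_on S f" "T \<subseteq> S" "T \<in> sets lebesgue"
  shows "L2_on T f"
proof -
  have "(\<lambda>x. indicat_real T x * (indicat_real S x * f x)) \<in> borel_measurable lebesgue"
    by (rule borel_measurable_times, rule borel_measurable_indicator) (use assms in \<open>simp_all add: L2_on_iff\<close>)
  moreover have "(\<lambda>x. indicat_real T x * (indicat_real S x * f x)) = (\<lambda>x. indicat_real T x * f x)"
    using assms(2) by (auto simp: indicator_def fun_eq_iff)
  ultimately show ?thesis
    using assms set_integrable_subset[of lebesgue S "\<lambda>x. (f x)\<^sup>2" T] by (simp add: L2_on_def set_borel_measurable_def)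
qed

lemma L2_on_join:
  assumes "L2_on {a<..<c} f" "L2_on {c<..<d} f" "a < c" "c < d"
  shows "L2_on {a<..<d} f"
proof -
  have 1: "L2_on {a<..<d} (\<lambda>x. indicat_real {a<..<c} x * f x)"
    by (rule L2_on_AE_cong[THEN iffD1, OF _ assms(1)]) (use assms in \<open>auto simp: indicator_def\<close>)
  have 2: "L2_on {a<..<d} (\<lambda>x. indicat_real {c<..<d} x * f x)"
    by (rule L2_on_AE_cong[THEN iffD1, OF _ assms(2)]) (use assms in \<open>auto simp: indicator_def\<close>)
  have "AE x in lebesgue. x \<noteq> c"
    using AE_not_in[of "{c}" lebesgue] by simp
  then have "AE x\<in>{a<..<d} in lebesgue. indicat_real {a<..<c} x * f x + indicat_real {c<..<d} x * f x = f x"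
    by eventually_elim (use assms in \<open>auto simp: indicator_def\<close>)
  from L2_on_cong[OF this] show ?thesis using L2_on_add[OF 1 2] by simp
qed

lemma L2_on_continuous:
  assumes "continuous_on {a..b} f"
  shows "L2_on {a<..<b} f"
proof -
  have "L1_on {a<..<b} f" "L1_on {a<..<b} (\<lambda>x. (f x)\<^sup>2)"
    unfolding L1_on_Ioo_iff_Icc
    by (intro L1_on_continuous continuous_intros assms)+
  then show ?thesis
    unfolding L2_on_def set_borel_measurable_def set_integrable_def using borel_measurable_integrable by blast
qed

lemma L2_on_imp_L1_on:
  assumes "L2_on {a<..<b} f"
  shows "L1_on {a..b} f"
  using L2_on_mult[OF assms L2_on_continuous[of a b "\<lambda>_. 1"]]
  by (simp add: L1_on_Ioo_iff_Icc)

lemma weak_derivative_cong: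
  assumes "AE x\<in>{a<..<b} in lebesgue. v x = v' x"
  shows "weak_derivative a b v g \<longleftrightarrow> weak_derivative a b v' g"
proof -
  have "(LINT x:{a<..<b}|lebesgue. v x * deriv \<phi> x) = (LINT x:{a<..<b}|lebesgue. v' x * deriv \<phi> x)" for \<phi>
    by (rule set_integral_lebesgue_AE_cong(2), use assms in eventually_elim) auto
  then show ?thesis by (simp add: weak_derivative_def)
qed

lemma continuous_on_prim_shift:
  assumes "L1_on {p..b} g" "p \<le> a"
  shows "continuous_on {a..b} (prim p g)"
  using continuous_on_prim[OF assms(1)] continuous_on_subset assms(2) by (metis atLeastatMost_subset_iff order_refl)

text \<open>The base point \<open>p\<close> may lie to the left of the piece, since all pieces share
  one primitive. The offset accumulated up to \<open>a\<close> is a constant, and constants are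
  orthogonal to derivatives of test functions.\<close>

lemma prim_test_function:
  assumes "p \<le> a" "a < b" "L1_on {p..b} g" "test_function a b \<phi>"
  shows "(LINT x:{a<..<b}|lebesgue. (C + prim p g x) * deriv \<phi> x) = - (LINT x:{a<..<b}|lebesgue. g x * \<phi> x)"
proof -
  obtain c d where \<phi>: "smooth \<phi>" "a < c" "c < d" "d < b" "\<And>x. x \<le> c \<or> d \<le> x \<Longrightarrow> \<phi> x = 0"
    using test_functionE[OF assms(4,2)] by metis
  have \<phi>0: "\<phi> a = 0" "\<phi> b = 0" using \<phi> by auto
  have c\<phi>: "continuous_on S \<phi>" "continuous_on S (deriv \<phi>)" for S
    using smooth_continuous_on \<phi>(1) smooth_deriv by blast+
  have g: "L1_on {a..b} g"
    using L1_on_subset[OF assms(3)] assms by auto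
  define K where "K = C + prim p g a"
  have K: "C + prim p g x = K + prim a g x" if "x \<in> {a..b}" for x
    using prim_shift[OF assms(3), of a x] that assms by (auto simp: K_def)
  have i0: "L1_on {a..b} (\<lambda>x. K * deriv \<phi> x)"
    by (intro L1_on_continuous continuous_intros c\<phi>)
  have i1: "L1_on {a..b} (\<lambda>x. prim a g x * deriv \<phi> x)"
    by (intro L1_on_continuous continuous_intros c\<phi> continuous_on_prim g)
  have i2: "L1_on {a..b} (\<lambda>x. g x * \<phi> x)"
    using L1_on_continuous_mult[OF c\<phi>(1) g] by (simp add: mult.commute)
  have "(LINT x:{a<..<b}|lebesgue. (C + prim p g x) * deriv \<phi> x) =
     (LINT x:{a<..<b}|lebesgue. K * deriv \<phi> x + prim a g x * deriv \<phi> x)"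
    by (rule set_lebesgue_integral_cong) (use K in \<open>auto simp: algebra_simps\<close>)
  also have "\<dots> = integral {a..b} (\<lambda>x. K * deriv \<phi> x + prim a g x * deriv \<phi> x)"
    by (intro L1_on_Ioo_integral set_integral_add i0 i1)
  also have "\<dots> = K * (\<phi> b - \<phi> a) + integral {a..b} (\<lambda>x. prim a g x * deriv \<phi> x)"
    using L1_on_imp_HK[OF i0] L1_on_imp_HK[OF i1] smooth_integral_deriv[OF \<phi>(1), of a b] assms
    by (simp add: HK_integral_add)
  also have "\<dots> = integral {a..b} (\<lambda>x. prim a g x * deriv \<phi> x)" using \<phi>0 by simp
  also have "\<dots> = - integral {a..b} (\<lambda>x. g x * \<phi> x)"
    using prim_integration_by_parts[OF assms(2) g \<phi>(1)] L1_on_imp_HK[OF i1] L1_on_imp_HK[OF i2] \<phi>0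
    by (simp add: HK_integral_add)
  also have "\<dots> = - (LINT x:{a<..<b}|lebesgue. g x * \<phi> x)"
    using L1_on_Ioo_integral[OF i2] by simp
  finally show ?thesis .
qed

lemma weak_derivative_prim:
  assumes "p \<le> a" "a < b" "L1_on {p..b} g"
  shows "weak_derivative a b (\<lambda>x. C + prim p g x) g"
  using prim_test_function[OF assms] by (simp add: weak_derivative_def)

text \<open>\<open>v\<close> minus the primitive of \<open>g\<close> has weak derivative zero, so
  the du Bois-Reymond lemma applies to it.\<close>

lemma weak_derivative_imp_prim:
  assumes "a < b" "L1_on {a..b} v" "L1_on {a..b} g" "weak_derivative a b v g"
  obtains K where "AE x\<in>{a<..<b} in lebesgue. v x = K + prim a g x"
proof -
  have ip: "L1_on {a..b} (prim a g)"
    by (intro L1_on_continuous continuous_on_prim assms)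
  have "(LINT x:{a<..<b}|lebesgue. (v x - prim a g x) * deriv \<phi> x) = 0" if \<phi>: "test_function a b \<phi>" for \<phi>
  proof -
    have c: "continuous_on {a..b} (deriv \<phi>)"
      using \<phi> smooth_continuous_on smooth_deriv test_function_iff by blast
    have "L1_on {a<..<b} (\<lambda>x. v x * deriv \<phi> x)"
      "L1_on {a<..<b} (\<lambda>x. prim a g x * deriv \<phi> x)"
      using L1_on_continuous_mult[OF c assms(2)] L1_on_continuous_mult[OF c ip]
      by (simp_all add: L1_on_Ioo_iff_Icc mult.commute)
    then have "(LINT x:{a<..<b}|lebesgue. v x * deriv \<phi> x - prim a g x * deriv \<phi> x) =
      (LINT x:{a<..<b}|lebesgue. v x * deriv \<phi> x) - (LINT x:{a<..<b}|lebesgue. prim a g x * deriv \<phi> x)"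
      by (rule set_integral_diff(2))
    moreover have "(LINT x:{a<..<b}|lebesgue. v x * deriv \<phi> x) = - (LINT x:{a<..<b}|lebesgue. g x * \<phi> x)"
      using assms(4) \<phi> by (auto simp: weak_derivative_def)
    moreover have "(LINT x:{a<..<b}|lebesgue. prim a g x * deriv \<phi> x) = - (LINT x:{a<..<b}|lebesgue. g x * \<phi> x)"
      using prim_test_function[OF _ assms(1,3) \<phi>, of 0] by simp
    ultimately show ?thesis by (simp add: left_diff_distrib)
  qed
  then obtain K where "AE x\<in>{a<..<b} in lebesgue. v x - prim a g x = K"
    using weak_derivative_0_imp_const[OF assms(1) set_integral_diff(1)[OF assms(2) ip]] by blast
  then show ?thesis by (intro that[of K]) auto
qed

section \<open>Double primitives and the shape of a piece\<close>

definition dprim :: "real \<Rightarrow> (real \<Rightarrow> real) \<Rightarrow> real \<Rightarrow> real" where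
  "dprim a h = prim a (prim a h)"

lemma prim_cong:
  assumes "AE x\<in>{a<..<b} in lebesgue. g x = g' x" "x \<le> b"
  shows "prim a g x = prim a g' x"
proof -
  have "AE x in lebesgue. x \<notin> {a, b}"
    by (rule AE_not_in) (auto intro: null_sets_completionI countable_imp_null_set_lborel)
  with assms(1) have "AE x\<in>{a..b} in lebesgue. g x = g' x"
    by eventually_elim auto
  then obtain N where N: "negligible N" "{x. \<not> (x \<in> {a..b} \<longrightarrow> g x = g' x)} \<subseteq> N"
    unfolding eventually_ae_filter_negligible by blast
  show ?thesis unfolding prim_def
    by (rule integral_spike[OF N(1)]) (use N(2) assms(2) in auto)
qed

lemma dprim_cong:
  assumes "AE x\<in>{a<..<b} in lebesgue. h x = h' x" "x \<le> b"
  shows "dprim a h x = dprim a h' x"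
  unfolding dprim_def
  by (rule prim_cong[of _ b]) (use prim_cong[OF assms(1)] assms(2) in auto)

lemma prim_cong_restrict:
  assumes "\<And>x. x \<in> {a..b} \<Longrightarrow> g x = g' x" "x \<in> {a..b}"
  shows "prim a g x = prim a g' x"
  unfolding prim_def by (rule Henstock_Kurzweil_Integration.integral_cong) (use assms in auto)

lemma prim_affine:
  assumes "continuous_on {a..b} g" "a \<le> x" "x \<le> b"
  shows "prim a (\<lambda>x. B + g x) x = B * (x - a) + prim a g x"
proof -
  have "g integrable_on {a..x}"
    using assms by (intro integrable_continuous_real) (auto intro: continuous_on_subset)
  then show ?thesis using assms(2)
    by (simp add: prim_def HK_integral_add integrable_const_ivl)
qed

text \<open>A first order Taylor expansion at \<open>c\<close> with integral remainder: changing the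
  base point of a double primitive costs an affine function. This is why all pieces can share one
  base point.\<close>

lemma dprim_shift:
  assumes h: "L1_on {a..b} h" and "a \<le> c" "c \<le> x" "x \<le> b"
  shows "dprim a h x = dprim a h c + prim a h c * (x - c) + dprim c h x"
proof -
  have hc: "L1_on {c..b} h" using L1_on_subset[OF h] assms by auto
  have ip: "L1_on {a..b} (prim a h)"
    by (intro L1_on_continuous continuous_on_prim h)
  have "dprim a h x = dprim a h c + prim c (prim a h) x"
    unfolding dprim_def by (rule prim_shift[OF ip]) (use assms in auto)
  also have "prim c (prim a h) x = prim c (\<lambda>t. prim a h c + prim c h t) x"
  proof (rule prim_cong_restrict[of c b])
    show "prim a h t = prim a h c + prim c h t" if "t \<in> {c..b}" for t
      by (rule prim_shift[OF h]) (use that assms in auto)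
  qed (use assms in auto)
  also have "\<dots> = prim a h c * (x - c) + dprim c h x"
    unfolding dprim_def using assms continuous_on_prim[OF hc] by (intro prim_affine) auto
  finally show ?thesis by simp
qed

lemma H2_on_imp_dprim:
  assumes "a < b" "H2_on a b v"
  obtains h A B where "L2_on {a<..<b} h" "AE x\<in>{a<..<b} in lebesgue. v x = A + B * x + dprim a h x"
proof -
  from assms(2) obtain g h where gh: "L2_on {a<..<b} v" "L2_on {a<..<b} g" "L2_on {a<..<b} h"
    "weak_derivative a b v g" "weak_derivative a b g h" unfolding H2_on_def by blast
  note int = gh(1-3)[THEN L2_on_imp_L1_on]
  obtain B where B: "AE x\<in>{a<..<b} in lebesgue. g x = B + prim a h x"
    using weak_derivative_imp_prim[OF assms(1) int(2,3) gh(5)] by blast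
  obtain A where A: "AE x\<in>{a<..<b} in lebesgue. v x = A + prim a g x"
    using weak_derivative_imp_prim[OF assms(1) int(1,2) gh(4)] by blast
  have e: "prim a g x = B * (x - a) + dprim a h x" if "x \<in> {a<..<b}" for x
    using prim_cong[OF B, of x] prim_affine[OF continuous_on_prim[OF int(3)], of x B] that by (simp add: dprim_def)
  from A have "AE x\<in>{a<..<b} in lebesgue. v x = (A - B * a) + B * x + dprim a h x"
    by eventually_elim (simp add: e algebra_simps)
  then show ?thesis using that gh(3) by blast
qed

text \<open>The weak derivatives are explicit, \<open>B + prim p h\<close> and \<open>h\<close>.
  Since p and q may be the ends of a larger interval, the same \<open>h\<close> serves every piece
  of a partition.\<close>

lemma H2_onI:
  assumes "p \<le> a" "a < b" "b \<le> q" "L2_on {p<..<q} h"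
    and v: "AE x\<in>{a<..<b} in lebesgue. v x = A + B * x + dprim p h x"
  shows "H2_on a b v"
proof -
  have hi: "L1_on {p..b} h"
    using L1_on_subset[OF L2_on_imp_L1_on[OF assms(4)]] assms by auto
  define g where "g x = B + prim p h x" for x
  have cg: "continuous_on {p..b} g" unfolding g_def by (intro continuous_intros continuous_on_prim hi)
  have gi: "L1_on {p..b} g" by (intro L1_on_continuous cg)
  have vg: "AE x\<in>{a<..<b} in lebesgue. v x = (A + B * p) + prim p g x"
    using v
  proof eventually_elim
    case (elim x)
    show ?case
    proof
      assume x: "x \<in> {a<..<b}"
      have "prim p g x = B * (x - p) + dprim p h x"
        unfolding g_def dprim_def by (rule prim_affine[OF continuous_on_prim[OF hi]]) (use x assms in auto)
      then show "v x = (A + B * p) + prim p g x" using elim x by (simp add: algebra_simps)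
    qed
  qed
  show ?thesis unfolding H2_on_def
  proof (intro conjI exI)
    show "L2_on {a<..<b} v"
      unfolding L2_on_cong[OF vg]
      by (intro L2_on_continuous continuous_intros continuous_on_prim_shift gi assms)
    show "L2_on {a<..<b} g"
      by (intro L2_on_continuous continuous_on_subset[OF cg]) (use assms in auto)
    show "L2_on {a<..<b} h"
      by (rule L2_on_subset[OF assms(4)]) (use assms in auto)
    show "weak_derivative a b v g"
      unfolding weak_derivative_cong[OF vg] by (intro weak_derivative_prim gi assms)
    show "weak_derivative a b g h"
      unfolding g_def by (intro weak_derivative_prim hi assms)
  qed
qed

text \<open>What is affine on (a,b) is \<open>v\<close> minus \<open>dprim p h\<close>, where
  \<open>p\<close> and \<open>h\<close> are common to all pieces. The coefficients \<open>A\<close>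
  and \<open>B\<close> alone vary from piece to piece.\<close>

definition affine_on :: "real \<Rightarrow> (real \<Rightarrow> real) \<Rightarrow> (real \<Rightarrow> real) \<Rightarrow> real \<Rightarrow> real \<Rightarrow> real \<Rightarrow> real \<Rightarrow> bool" where
  "affine_on p h v a b A B \<longleftrightarrow> (AE x\<in>{a<..<b} in lebesgue. v x = A + B * x + dprim p h x)"

text \<open>Second derivatives of the pieces are glued into one \<open>h\<close>. Appending a piece
  does not affect the earlier ones, since a primitive up to x \<le> c sees \<open>h\<close> only to
  the left of \<open>c\<close>; on the new piece the base point moves back to \<open>s 0\<close> at
  the price of an affine correction.\<close>

lemma piecewise_H2_imp_affine_on:
  assumes "\<forall>i<n. s i < s (Suc i) \<and> H2_on (s i) (s (Suc i)) v"
  shows "\<exists>h A B. L2_on {s 0<..<s n} h \<and> (\<forall>i<n. affine_on (s 0) h v (s i) (s (Suc i)) (A i) (B i))"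
  using assms
proof (induction n)
  case 0
  have "L2_on {} (\<lambda>_. 0)" by (simp add: L2_on_iff)
  then show ?case by auto
next
  case (Suc n)
  define a c d where "a = s 0" "c = s n" "d = s (Suc n)"
  have mono: "s i \<le> s j" if "i \<le> j" "j \<le> Suc n" for i j
    using that
  proof (induction j rule: dec_induct)
    case (step j)
    then show ?case using Suc.prems by (meson Suc_le_lessD less_imp_le less_le_trans order_trans Suc_leD)
  qed simp
  have cd: "a \<le> c" "c < d" using mono[of 0 n] Suc.prems by (auto simp: a_c_d_def)
  obtain h A B where IH: "L2_on {a<..<c} h" "\<And>i. i < n \<Longrightarrow> affine_on a h v (s i) (s (Suc i)) (A i) (B i)"
  proof -
    have "\<forall>i<n. s i < s (Suc i) \<and> H2_on (s i) (s (Suc i)) v" using Suc.prems by auto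
    from Suc.IH[OF this] show ?thesis using that unfolding a_c_d_def by blast
  qed
  obtain h1 A1 B1 where h1: "L2_on {c<..<d} h1" "AE x\<in>{c<..<d} in lebesgue. v x = A1 + B1 * x + dprim c h1 x"
    using H2_on_imp_dprim[of c d v] Suc.prems cd unfolding a_c_d_def by (metis lessI)
  define h' where "h' x = (if x \<le> c then h x else h1 x)" for x
  have L1: "L2_on {a<..<c} h'"
    by (rule L2_on_cong[THEN iffD1, OF _ IH(1)]) (auto simp: h'_def)
  have L2: "L2_on {c<..<d} h'"
    by (rule L2_on_cong[THEN iffD1, OF _ h1(1)]) (auto simp: h'_def)
  have L: "L2_on {a<..<d} h'"
    using L2_on_join[OF L1 L2] L2 cd by (cases "a = c") auto
  have e1: "dprim a h' x = dprim a h x" if "x \<le> c" for x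
    by (rule dprim_cong[of _ c]) (use that in \<open>auto simp: h'_def\<close>)
  have e2: "dprim c h' x = dprim c h1 x" if "x \<le> d" for x
    by (rule dprim_cong[of _ d]) (use that in \<open>auto simp: h'_def\<close>)
  \<comment> \<open>Moving the base point from \<open>c\<close> to \<open>a\<close> adds the affine
    function \<open>dprim a h' c + prim a h' c * (x - c)\<close>, which the new coefficients
    subtract.\<close>
  have "affine_on a h' v c d (A1 - dprim a h' c + prim a h' c * c) (B1 - prim a h' c)"
    unfolding affine_on_def using h1(2)
  proof eventually_elim
    case (elim x)
    show ?case
    proof
      assume x: "x \<in> {c<..<d}"
      have "dprim a h' x = dprim a h' c + prim a h' c * (x - c) + dprim c h1 x"
        using dprim_shift[OF L2_on_imp_L1_on[OF L], of c x] x cd e2[of x] by auto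
      then show "v x = A1 - dprim a h' c + prim a h' c * c + (B1 - prim a h' c) * x + dprim a h' x"
        using elim x by (simp add: algebra_simps)
    qed
  qed
  moreover have "affine_on a h' v (s i) (s (Suc i)) (A i) (B i)" if "i < n" for i
    using IH(2)[OF that] mono[of "Suc i" n] that e1 unfolding affine_on_def
    by (elim eventually_mono) (auto simp: a_c_d_def)
  ultimately show ?case using L
    by (intro exI[of _ h'] exI[of _ "A(n := A1 - dprim a h' c + prim a h' c * c)"] exI[of _ "B(n := B1 - prim a h' c)"])
      (auto simp: less_Suc_eq a_c_d_def)
qed

section \<open>Absolutely continuous parts and discontinuity sets\<close>

lemma set_integral_sum_lebesgue:
  fixes f :: "'i \<Rightarrow> real \<Rightarrow> real"
  assumes "finite I" "\<And>i. i \<in> I \<Longrightarrow> L1_on S (f i)"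
  shows "L1_on S (\<lambda>x. \<Sum>i\<in>I. f i x)"
    "(LINT x:S|lebesgue. \<Sum>i\<in>I. f i x) = (\<Sum>i\<in>I. LINT x:S|lebesgue. f i x)"
  using assms by (induction I) (auto simp: set_integrable_def set_lebesgue_integral_def distrib_left)

lemma test_function_outside:
  assumes "test_function c d \<phi>" "c < d" "x \<notin> {c<..<d}"
  shows "\<phi> x = 0" "deriv \<phi> x = 0"
proof -
  obtain c' d' where \<phi>: "c < c'" "c' < d'" "d' < d" "\<And>x. x \<le> c' \<or> d' \<le> x \<Longrightarrow> \<phi> x = 0"
    using test_functionE[OF assms(1,2)] by metis
  show "\<phi> x = 0" using \<phi> assms(3) by (cases "x \<le> c") auto
  have "(\<phi> has_field_derivative 0) (at x)"
    by (rule has_field_derivative_transform_within_open[where f = "\<lambda>_. 0" and S = "{..<c'} \<union> {d'<..}"])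
      (use \<phi> assms(3) in \<open>auto simp: less_imp_le\<close>)
  then show "deriv \<phi> x = 0" by (rule DERIV_imp_deriv)
qed

lemma test_function_mono:
  assumes "test_function c d \<phi>" "a \<le> c" "d \<le> b"
  shows "test_function a b \<phi>"
proof -
  have "{c<..<d} \<subseteq> {a<..<b}" using assms by auto
  then show ?thesis using assms(1) unfolding test_function_iff by (meson order_trans)
qed

lemma set_integral_restrict:
  fixes f :: "real \<Rightarrow> real"
  assumes "S \<subseteq> T" "\<And>x. x \<in> T - S \<Longrightarrow> f x = 0"
  shows "(LINT x:T|lebesgue. f x) = (LINT x:S|lebesgue. f x)"
  unfolding set_lebesgue_integral_def
  by (rule Bochner_Integration.integral_cong) (use assms in \<open>auto simp: indicator_def\<close>)

text \<open>Subtracting the two decompositions, tested with functions supported in (c,d), leaves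
  four finite measures carried by the null set \<open>Z1 \<union> Z2\<close>. The local form
  matters: it compares \<open>v\<close> with one affine formula on one piece, and an admissible
  \<open>v\<close> with \<open>w\<close> on an outer strip.\<close>

lemma is_ac_derivative_unique_on:
  assumes v1: "is_ac_derivative a b v1 g1" and v2: "is_ac_derivative a b v2 g2"
    and cd: "a \<le> c" "c < d" "d \<le> b" and eq: "AE x\<in>{c<..<d} in lebesgue. v1 x = v2 x"
  shows "AE x\<in>{c<..<d} in lebesgue. g1 x = g2 x"
proof -
  obtain P1 N1 Z1 where 1: "finite_measure P1" "sets P1 = sets borel" "finite_measure N1" "sets N1 = sets borel"
     "Z1 \<in> null_sets lborel" "emeasure P1 (- Z1) = 0" "emeasure N1 (- Z1) = 0"
     "\<And>\<phi>. test_function a b \<phi> \<Longrightarrow> - (LINT x:{a<..<b}|lebesgue. v1 x * deriv \<phi> x) =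
           (LINT x:{a<..<b}|lebesgue. g1 x * \<phi> x) + (LINT x|P1. \<phi> x) - (LINT x|N1. \<phi> x)"
    using v1 unfolding is_ac_derivative_def by blast
  obtain P2 N2 Z2 where 2: "finite_measure P2" "sets P2 = sets borel" "finite_measure N2" "sets N2 = sets borel"
     "Z2 \<in> null_sets lborel" "emeasure P2 (- Z2) = 0" "emeasure N2 (- Z2) = 0"
     "\<And>\<phi>. test_function a b \<phi> \<Longrightarrow> - (LINT x:{a<..<b}|lebesgue. v2 x * deriv \<phi> x) =
           (LINT x:{a<..<b}|lebesgue. g2 x * \<phi> x) + (LINT x|P2. \<phi> x) - (LINT x|N2. \<phi> x)"
    using v2 unfolding is_ac_derivative_def by blast
  have sub: "{c<..<d} \<subseteq> {a<..<b}" using cd by auto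
  have gi: "L1_on {c<..<d} g1" "L1_on {c<..<d} g2"
    using v1 v2 unfolding is_ac_derivative_def by (auto intro: set_integrable_subset[OF _ _ sub])
  \<comment> \<open>The measures of the difference, with signs + - for the first decomposition and -
    + for the second.\<close>
  define M where "M k = [P1, N1, P2, N2] ! k" for k
  define \<sigma> :: "nat \<Rightarrow> real" where "\<sigma> k = [1, -1, -1, 1] ! k" for k
  have four: "{..<4::nat} = {0,1,2,3}" by auto
  have Zb: "Z1 \<in> sets borel" "Z2 \<in> sets borel" using 1(5) 2(5) by auto
  have zero: "emeasure M (- (Z1 \<union> Z2)) = 0" if "sets M = sets borel" "emeasure M (- Z1) = 0 \<or> emeasure M (- Z2) = 0" for M
  proof -
    have "emeasure M (- (Z1 \<union> Z2)) \<le> emeasure M (- Z1)" "emeasure M (- (Z1 \<union> Z2)) \<le> emeasure M (- Z2)"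
      by (rule emeasure_mono; use that Zb in auto)+
    then show ?thesis using that by auto
  qed
  have "AE x\<in>{c<..<d} in lebesgue. g1 x - g2 x = 0"
  proof (rule test_function_zero[where I = "{..<4}" and M = M and \<sigma> = \<sigma> and Z = "Z1 \<union> Z2"])
    show "L1_on {c<..<d} (\<lambda>x. g1 x - g2 x)"
      by (intro set_integral_diff gi)
    show "finite_measure (M i)" "sets (M i) = sets borel" "emeasure (M i) (- (Z1 \<union> Z2)) = 0" if "i \<in> {..<4}" for i
      using that 1 2 zero unfolding four by (auto simp: M_def)
    show "Z1 \<union> Z2 \<in> null_sets lborel" using 1 2 by auto
    fix \<phi> assume \<phi>: "test_function c d \<phi>"
    have \<phi>ab: "test_function a b \<phi>" using test_function_mono[OF \<phi>] cd by auto
    have r: "(LINT x:{a<..<b}|lebesgue. k x * \<phi> x) = (LINT x:{c<..<d}|lebesgue. k x * \<phi> x)"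
      "(LINT x:{a<..<b}|lebesgue. k x * deriv \<phi> x) = (LINT x:{c<..<d}|lebesgue. k x * deriv \<phi> x)" for k
      using test_function_outside[OF \<phi> cd(2)] by (intro set_integral_restrict sub; auto)+
    have c\<phi>: "continuous_on {c..d} \<phi>"
      using \<phi> smooth_continuous_on test_function_iff by blast
    have gpi: "L1_on {c<..<d} (\<lambda>x. g1 x * \<phi> x)" "L1_on {c<..<d} (\<lambda>x. g2 x * \<phi> x)"
      using L1_on_continuous_mult[OF c\<phi>, of g1] L1_on_continuous_mult[OF c\<phi>, of g2] gi
      by (auto simp: L1_on_Ioo_iff_Icc mult.commute)
    have "(LINT x:{c<..<d}|lebesgue. v1 x * deriv \<phi> x) = (LINT x:{c<..<d}|lebesgue. v2 x * deriv \<phi> x)"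
      by (rule set_integral_lebesgue_AE_cong(2), use eq in eventually_elim) auto
    then have "(LINT x:{c<..<d}|lebesgue. g1 x * \<phi> x) + (LINT x|P1. \<phi> x) - (LINT x|N1. \<phi> x) =
       (LINT x:{c<..<d}|lebesgue. g2 x * \<phi> x) + (LINT x|P2. \<phi> x) - (LINT x|N2. \<phi> x)"
      using 1(8)[OF \<phi>ab] 2(8)[OF \<phi>ab] unfolding r by linarith
    then show "(LINT x:{c<..<d}|lebesgue. (g1 x - g2 x) * \<phi> x) + (\<Sum>i\<in>{..<4}. \<sigma> i * (LINT x|M i. \<phi> x)) = 0"
      using set_integral_diff(2)[OF gpi] by (simp add: four M_def \<sigma>_def left_diff_distrib)
  qed
  then show ?thesis by eventually_elim auto
qed

lemma is_ac_derivative_cong: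
  assumes "AE x\<in>{a<..<b} in lebesgue. v x = v' x" "AE x\<in>{a<..<b} in lebesgue. g x = g' x"
  shows "is_ac_derivative a b v g \<longleftrightarrow> is_ac_derivative a b v' g'"
proof -
  have "(LINT x:{a<..<b}|lebesgue. v x * deriv \<phi> x) = (LINT x:{a<..<b}|lebesgue. v' x * deriv \<phi> x)" for \<phi>
    by (rule set_integral_lebesgue_AE_cong(2), use assms(1) in eventually_elim) auto
  moreover have "(LINT x:{a<..<b}|lebesgue. g x * \<phi> x) = (LINT x:{a<..<b}|lebesgue. g' x * \<phi> x)" for \<phi>
    by (rule set_integral_lebesgue_AE_cong(2), use assms(2) in eventually_elim) auto
  ultimately show ?thesis
    using set_integral_lebesgue_AE_cong(1)[OF assms(1)] set_integral_lebesgue_AE_cong(1)[OF assms(2)]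
    by (simp add: is_ac_derivative_def)
qed

lemma is_ac_derivative_imp_ac_derivative:
  assumes "is_ac_derivative a b v g" "a < b"
  shows "is_ac_derivative a b v (ac_derivative a b v)"
    "AE x\<in>{a<..<b} in lebesgue. ac_derivative a b v x = g x"
proof -
  show 1: "is_ac_derivative a b v (ac_derivative a b v)"
    unfolding ac_derivative_def by (rule someI[of "is_ac_derivative a b v", OF assms(1)])
  show "AE x\<in>{a<..<b} in lebesgue. ac_derivative a b v x = g x"
    by (rule is_ac_derivative_unique_on[OF 1 assms(1)]) (use assms in auto)
qed

section \<open>Partitions, step functions and their jump measures\<close>

definition partition :: "nat \<Rightarrow> (nat \<Rightarrow> real) \<Rightarrow> real \<Rightarrow> real \<Rightarrow> bool" where
  "partition n s a b \<longleftrightarrow> s 0 = a \<and> s n = b \<and> (\<forall>i<n. s i < s (Suc i))"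

lemma partition_less:
  assumes "partition n s a b" "i < j" "j \<le> n"
  shows "s i < s j"
  using assms(2,3)
proof (induction j)
  case (Suc j)
  then have "s j < s (Suc j)" using assms(1) by (auto simp: partition_def)
  moreover have "s i \<le> s j" using Suc by (cases "i = j") auto
  ultimately show ?case by linarith
qed simp

lemma partition_le:
  assumes "partition n s a b" "i \<le> j" "j \<le> n"
  shows "s i \<le> s j"
  using partition_less[OF assms(1), of i j] assms by (cases "i = j") auto

lemma partition_less_iff:
  assumes "partition n s a b" "i \<le> n" "j \<le> n"
  shows "s i < s j \<longleftrightarrow> i < j"
  using partition_less[OF assms(1), of i j] partition_le[OF assms(1), of j i] assms by (cases "i < j") auto

lemma partition_bounds:
  assumes "partition n s a b" "i \<le> n" shows "a \<le> s i" "s i \<le> b"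
  using partition_le[OF assms(1), of 0 i] partition_le[OF assms(1), of i n] assms by (auto simp: partition_def)

text \<open>Some consecutive pair of knots crosses x from below to above. This is applied to
  partitions and to limits of knots, which may coincide.\<close>

lemma between_consecutive:
  fixes s :: "nat \<Rightarrow> real"
  assumes "s 0 < x" "x < s n" "x \<notin> s ` {..n}"
  shows "\<exists>i<n. s i < x \<and> x < s (Suc i)"
  using assms
proof (induction n)
  case (Suc n)
  show ?case
  proof (cases "x < s n")
    case True
    have "x \<notin> s ` {..n}" using Suc.prems by (auto simp: atMost_Suc)
    then obtain i where "i < n" "s i < x" "x < s (Suc i)" using Suc.IH Suc.prems True by blast
    then show ?thesis by (intro exI[of _ i]) auto
  next
    case False
    moreover have "x \<noteq> s n" using Suc.prems by auto
    ultimately show ?thesis using Suc.prems by (intro exI[of _ n]) auto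
  qed
qed simp

lemma AE_not_in_finite: "finite S \<Longrightarrow> AE x in lebesgue. x \<notin> (S :: real set)"
  by (rule AE_not_in) (auto intro: null_sets_completionI countable_imp_null_set_lborel countable_finite)

lemma AE_pieces:
  fixes s :: "nat \<Rightarrow> real"
  assumes "\<And>i. i < n \<Longrightarrow> AE x\<in>{s i<..<s (Suc i)} in lebesgue. P i x"
  shows "AE x\<in>{s 0<..<s n} in lebesgue. (\<exists>i<n. x \<in> {s i<..<s (Suc i)} \<and> P i x)"
proof -
  have "AE x in lebesgue. \<forall>i\<in>{..<n}. x \<in> {s i<..<s (Suc i)} \<longrightarrow> P i x"
    by (rule AE_finite_allI) (use assms in auto)
  moreover have "AE x in lebesgue. x \<notin> s ` {..n}" by (rule AE_not_in_finite) auto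
  ultimately show ?thesis
  proof eventually_elim
    case (elim x)
    show ?case
    proof
      assume "x \<in> {s 0<..<s n}"
      then obtain i where "i < n" "s i < x" "x < s (Suc i)" using between_consecutive[of s x n] elim by auto
      then show "\<exists>i<n. x \<in> {s i<..<s (Suc i)} \<and> P i x" using elim by auto
    qed
  qed
qed

text \<open>A sum of point masses at the points \<open>s j\<close>. Only the positive parts of the
  weights are kept, so that the measures for \<open>w\<close> and \<open>- w\<close> together
  represent signed masses, as the pair P, N in \<open>is_ac_derivative\<close> requires.\<close>

definition jump_measure :: "'i set \<Rightarrow> ('i \<Rightarrow> real) \<Rightarrow> ('i \<Rightarrow> real) \<Rightarrow> real measure" where
  "jump_measure I w s = distr (point_measure I (\<lambda>j. ennreal (max 0 (w j)))) borel s"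

lemma integrable_indicator_Ioo:
  fixes a b :: real
  shows "integrable lebesgue (indicat_real {a<..<b})"
  using L1_on_continuous[OF continuous_on_const, of a b "1 :: real"]
  unfolding L1_on_Ioo_iff_Icc[symmetric] by (simp add: set_integrable_def)

lemma jump_measure:
  assumes "finite I"
  shows "finite_measure (jump_measure I w s)" "sets (jump_measure I w s) = sets borel"
    "emeasure (jump_measure I w s) (- s ` I) = 0"
    "\<phi> \<in> borel_measurable borel \<Longrightarrow> (LINT x|jump_measure I w s. \<phi> x) = (\<Sum>j\<in>I. max 0 (w j) * \<phi> (s j))"
proof -
  have m: "s \<in> measurable (point_measure I (\<lambda>j. ennreal (max 0 (w j)))) borel"
    by (simp add: measurable_def space_point_measure sets_point_measure)
  show "sets (jump_measure I w s) = sets borel" by (simp add: jump_measure_def)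
  have e: "emeasure (jump_measure I w s) A = (\<Sum>j\<in>s -` A \<inter> I. ennreal (max 0 (w j)))" if "A \<in> sets borel" for A
    unfolding jump_measure_def
    by (subst emeasure_distr[OF m that]) (simp add: space_point_measure emeasure_point_measure_finite assms)
  have sp: "space (jump_measure I w s) = UNIV" by (simp add: jump_measure_def)
  show "finite_measure (jump_measure I w s)"
    by (rule finite_measureI) (simp add: sp e)
  have "- s ` I \<in> sets borel" using assms by (intro borel_open open_Compl finite_imp_closed) auto
  moreover have "s -` (- s ` I) \<inter> I = {}" by auto
  ultimately show "emeasure (jump_measure I w s) (- s ` I) = 0" by (simp add: e)
  show "(LINT x|jump_measure I w s. \<phi> x) = (\<Sum>j\<in>I. max 0 (w j) * \<phi> (s j))" if "\<phi> \<in> borel_measurable borel"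
    unfolding jump_measure_def
    by (subst integral_distr[OF m that]) (simp add: lebesgue_integral_point_measure_finite assms)
qed

text \<open>The jumps at the knots to the left of x telescope to \<open>c i - c 0\<close>.\<close>

lemma step_sum_eq:
  fixes c :: "nat \<Rightarrow> real"
  assumes "partition n s a b" "i < n" "s i < x" "x < s (Suc i)"
  shows "c 0 + (\<Sum>j\<in>{1..<n}. (c j - c (j - 1)) * indicator {s j<..<b} x) = c i"
proof -
  have xb: "x < b" using partition_bounds(2)[OF assms(1), of "Suc i"] assms by auto
  have "s j < x \<longleftrightarrow> j \<le> i" if "j \<in> {1..<n}" for j
  proof
    assume "s j < x"
    then have "s j < s (Suc i)" using assms by auto
    then show "j \<le> i" using partition_less_iff[OF assms(1), of j "Suc i"] that assms(2) by auto
  next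
    assume "j \<le> i"
    then show "s j < x" using partition_le[OF assms(1), of j i] assms by auto
  qed
  then have "(\<Sum>j\<in>{1..<n}. (c j - c (j - 1)) * indicator {s j<..<b} x) = (\<Sum>j\<in>{1..<n}. if j \<le> i then c j - c (j - 1) else 0)"
    using xb by (intro sum.cong) auto
  also have "\<dots> = (\<Sum>j\<in>{1..i}. c j - c (j - 1))"
    using assms(2) by (intro sum.mono_neutral_cong_right) auto
  also have "\<dots> = c i - c 0" by (induction i) auto
  finally show ?thesis by simp
qed

text \<open>Integration by parts turns the continuous part into \<open>g\<close>, while the
  indicator of \<open>{s j<..<b}\<close> tested with \<phi>' gives \<open>- \<phi> (s j)\<close>, as
  \<phi> vanishes at \<open>b\<close>. The singular part is therefore the sum of the jumps \<Delta>
  j times point masses, split by sign.\<close>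

lemma is_ac_derivative_step:
  assumes part: "partition n s a b" and ab: "a < b" and g: "L1_on {a..b} g"
    and u: "\<And>i. i < n \<Longrightarrow> AE x\<in>{s i<..<s (Suc i)} in lebesgue. u x = c i + prim a g x"
  shows "is_ac_derivative a b u g"
proof -
  define \<Delta> where "\<Delta> j = c j - c (j - 1)" for j
  let ?I = "{1..<n}"
  let ?U = "\<lambda>x. (c 0 + prim a g x) + (\<Sum>j\<in>?I. \<Delta> j * indicator {s j<..<b} x)"
  have sI: "a < s j \<and> s j < b" if "j \<in> ?I" for j
    using partition_less[OF part, of 0 j] partition_less[OF part, of j n] that part by (auto simp: partition_def)
  have s0n: "s 0 = a" "s n = b" using part by (auto simp: partition_def)
  have ueq: "AE x\<in>{a<..<b} in lebesgue. u x = ?U x"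
  proof -
    have "AE x\<in>{a<..<b} in lebesgue. (\<exists>i<n. x \<in> {s i<..<s (Suc i)} \<and> u x = c i + prim a g x)"
      using AE_pieces[of n s "\<lambda>i x. u x = c i + prim a g x"] u unfolding s0n by blast
    then show ?thesis
    proof eventually_elim
    case (elim x)
    then show ?case using step_sum_eq[OF part, of _ x c] by (fastforce simp: \<Delta>_def)
    qed
  qed
  have cp: "continuous_on {a..b} (\<lambda>x. c 0 + prim a g x)" by (intro continuous_intros continuous_on_prim g)
  have i0: "L1_on {a<..<b} (\<lambda>x. c 0 + prim a g x)"
    unfolding L1_on_Ioo_iff_Icc by (intro L1_on_continuous cp)
  have ii: "L1_on {a<..<b} (\<lambda>x. \<Delta> j * indicator {s j<..<b} x)" if j: "j \<in> ?I" for j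
  proof (intro set_integrable_mult_right)
    have e: "(\<lambda>x. indicat_real {a<..<b} x *\<^sub>R indicat_real {s j<..<b} x) = indicat_real {s j<..<b}"
      using sI[OF j] by (auto simp: indicator_def fun_eq_iff)
    have "integrable lebesgue (indicat_real {s j<..<b})" by (rule integrable_indicator_Ioo)
    then show "L1_on {a<..<b} (\<lambda>x. indicat_real {s j<..<b} x)"
      unfolding set_integrable_def e .
  qed
  have "is_ac_derivative a b ?U g"
    unfolding is_ac_derivative_def
  proof (intro conjI exI allI impI)
    show "L1_on {a<..<b} g" using g by (simp add: L1_on_Ioo_iff_Icc)
    show "L1_on {a<..<b} ?U"
      by (intro set_integral_add(1)[OF i0] set_integral_sum_lebesgue(1) ii) auto
    show "finite_measure (jump_measure ?I \<Delta> s)" "finite_measure (jump_measure ?I (\<lambda>j. - \<Delta> j) s)"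
      "sets (jump_measure ?I \<Delta> s) = sets borel" "sets (jump_measure ?I (\<lambda>j. - \<Delta> j) s) = sets borel"
      "emeasure (jump_measure ?I \<Delta> s) (- s ` ?I) = 0" "emeasure (jump_measure ?I (\<lambda>j. - \<Delta> j) s) (- s ` ?I) = 0"
      by (simp_all add: jump_measure)
    show "s ` ?I \<in> null_sets lborel" by (intro countable_imp_null_set_lborel countable_finite) auto
    show "s ` ?I \<subseteq> {a<..<b}" using sI by auto
    fix \<phi> assume \<phi>: "test_function a b \<phi>"
    have sm: "smooth \<phi>" using \<phi> by (simp add: test_function_iff)
    have c\<phi>: "continuous_on S \<phi>" "continuous_on S (deriv \<phi>)" for S
      using smooth_continuous_on sm smooth_deriv by blast+
    have \<phi>b: "\<phi> b = 0" using test_function_outside[OF \<phi> ab] by simp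
    have k0: "L1_on {a<..<b} (\<lambda>x. (c 0 + prim a g x) * deriv \<phi> x)"
      unfolding L1_on_Ioo_iff_Icc by (intro L1_on_continuous continuous_intros cp c\<phi>)
    have kj: "L1_on {a<..<b} (\<lambda>x. indicator {s j<..<b} x * deriv \<phi> x) \<and>
        (LINT x:{a<..<b}|lebesgue. indicator {s j<..<b} x * deriv \<phi> x) = - \<phi> (s j)" if j: "j \<in> ?I" for j
    proof
      have e: "(\<lambda>x. indicat_real {a<..<b} x *\<^sub>R (indicator {s j<..<b} x * deriv \<phi> x)) = (\<lambda>x. indicat_real {s j<..<b} x *\<^sub>R deriv \<phi> x)"
        using sI[OF j] by (auto simp: indicator_def fun_eq_iff)
      have i: "L1_on {s j..b} (deriv \<phi>)" by (intro L1_on_continuous c\<phi>)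
      then have "L1_on {s j<..<b} (deriv \<phi>)" unfolding L1_on_Ioo_iff_Icc .
      then show "L1_on {a<..<b} (\<lambda>x. indicator {s j<..<b} x * deriv \<phi> x)"
        unfolding set_integrable_def e .
      have "(LINT x:{a<..<b}|lebesgue. indicator {s j<..<b} x * deriv \<phi> x) = (LINT x:{s j<..<b}|lebesgue. deriv \<phi> x)"
        unfolding set_lebesgue_integral_def e ..
      also have "\<dots> = \<phi> b - \<phi> (s j)"
        using L1_on_Ioo_integral[OF i] smooth_integral_deriv[OF sm, of "s j" b] sI[OF j] by simp
      finally show "(LINT x:{a<..<b}|lebesgue. indicator {s j<..<b} x * deriv \<phi> x) = - \<phi> (s j)"
        by (simp add: \<phi>b)
    qed
    have "(LINT x:{a<..<b}|lebesgue. ?U x * deriv \<phi> x)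
        = (LINT x:{a<..<b}|lebesgue. (c 0 + prim a g x) * deriv \<phi> x + (\<Sum>j\<in>?I. \<Delta> j * (indicator {s j<..<b} x * deriv \<phi> x)))"
      by (rule arg_cong[where f = "\<lambda>f. LINT x:{a<..<b}|lebesgue. f x"], rule ext)
        (simp only: distrib_right sum_distrib_right mult.assoc)
    also have "\<dots> = (LINT x:{a<..<b}|lebesgue. (c 0 + prim a g x) * deriv \<phi> x) + (\<Sum>j\<in>?I. \<Delta> j * - \<phi> (s j))"
      using kj by (subst set_integral_add(2)[OF k0]; (subst set_integral_sum_lebesgue(2))?; (intro set_integral_sum_lebesgue(1))?) auto
    also have "\<dots> = - (LINT x:{a<..<b}|lebesgue. g x * \<phi> x) - (\<Sum>j\<in>?I. \<Delta> j * \<phi> (s j))"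
      using prim_test_function[OF _ ab g \<phi>, of "c 0"] by (simp add: sum_negf)
    finally have "- (LINT x:{a<..<b}|lebesgue. ?U x * deriv \<phi> x)
       = (LINT x:{a<..<b}|lebesgue. g x * \<phi> x) + (\<Sum>j\<in>?I. \<Delta> j * \<phi> (s j))" by simp
    moreover have "(\<Sum>j\<in>?I. \<Delta> j * \<phi> (s j)) = (\<Sum>j\<in>?I. max 0 (\<Delta> j) * \<phi> (s j)) - (\<Sum>j\<in>?I. max 0 (- \<Delta> j) * \<phi> (s j))"
      by (subst sum_subtractf[symmetric], rule sum.cong) (auto simp: max_def)
    moreover have "\<phi> \<in> borel_measurable borel" by (intro borel_measurable_continuous_onI c\<phi>)
    ultimately show "- (LINT x:{a<..<b}|lebesgue. ?U x * deriv \<phi> x) =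
       (LINT x:{a<..<b}|lebesgue. g x * \<phi> x) + (LINT x|jump_measure ?I \<Delta> s. \<phi> x) - (LINT x|jump_measure ?I (\<lambda>j. - \<Delta> j) s. \<phi> x)"
      by (simp add: jump_measure(4))
  qed
  then show ?thesis using is_ac_derivative_cong[OF ueq, of g g] by auto
qed

section \<open>One-sided limits and discontinuities of a.e. classes\<close>

lemma AE_Ioo_exists:
  assumes "AE x\<in>{c<..<d} in lebesgue. P x" "c < (d::real)"
  shows "\<exists>x. c < x \<and> x < d \<and> P x"
proof (rule ccontr)
  assume "\<not> ?thesis"
  then have "AE x in lebesgue. x \<notin> {c<..<d}" using assms(1) by (elim eventually_mono) auto
  then have "{c<..<d} \<in> null_sets lebesgue"
    by (subst (asm) AE_iff_null_sets[symmetric]) auto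
  then have "emeasure lborel {c<..<d} = 0" by (auto simp: null_sets_def)
  then show False using assms(2) by simp
qed

text \<open>Every interval adjacent to x has positive measure, so \<open>f\<close> vanishes at
  points arbitrarily close to x on the given side.\<close>

lemma tendsto_AE_zero:
  fixes f :: "real \<Rightarrow> real"
  assumes lim: "(f \<longlongrightarrow> l) (at x within {c<..<d})" and ae: "AE y\<in>{c<..<d} in lebesgue. f y = 0" 
    and x: "x = c \<or> x = d" "c < d"
  shows "l = 0"
proof (rule ccontr)
  assume "l \<noteq> 0"
  then have "\<forall>\<^sub>F y in at x within {c<..<d}. f y \<noteq> 0" using lim tendsto_imp_eventually_ne by blast
  then obtain e where e: "e > 0" "\<And>y. c < y \<Longrightarrow> y < d \<Longrightarrow> y \<noteq> x \<Longrightarrow> \<bar>y - x\<bar> < e \<Longrightarrow> f y \<noteq> 0"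
    unfolding eventually_at by (auto simp: dist_real_def)
  have "AE y\<in>{max c (x - e)<..<min d (x + e)} in lebesgue. f y = 0" using ae by eventually_elim auto
  from AE_Ioo_exists[OF this] obtain y where "max c (x - e) < y" "y < min d (x + e)" "f y = 0" 
    using e x by auto
  then show False using e(2)[of y] x by auto
qed

text \<open>If the one-sided limits agree, redefining the function on a null set, with the common
  limit as value at x, gives a continuous representative. Conversely, a representative continuous at
  x must have both limits as its value there, since a.e. equality determines one-sided
  limits.\<close>

lemma discontinuity_set_iff:
  assumes x: "a \<le> c" "c < x" "x < d" "d \<le> b"
    and L: "AE y\<in>{c<..<x} in lebesgue. u y = U1 y" "(U1 \<longlongrightarrow> l1) (at_left x)"
    and R: "AE y\<in>{x<..<d} in lebesgue. u y = U2 y" "(U2 \<longlongrightarrow> l2) (at_right x)"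
  shows "x \<in> discontinuity_set a b u \<longleftrightarrow> l1 \<noteq> l2"
proof
  assume "x \<in> discontinuity_set a b u"
  show "l1 \<noteq> l2"
  proof
    assume eq: "l1 = l2"
    define r where "r y = (if y \<in> {c<..<x} then U1 y else if y \<in> {x<..<d} then U2 y else if y = x then l1 else u y)" for y
    have "AE y in lebesgue. y \<notin> {x}" by (rule AE_not_in_finite) simp
    with L(1) R(1) have "AE y\<in>{a<..<b} in lebesgue. r y = u y"
      by eventually_elim (auto simp: r_def)
    moreover have "(r \<longlongrightarrow> l1) (at_left x)"
    proof (rule Lim_transform_eventually[OF L(2)])
      show "\<forall>\<^sub>F y in at_left x. U1 y = r y"
        unfolding eventually_at_left[OF x(2)] by (rule exI[of _ c]) (use x in \<open>auto simp: r_def\<close>)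
    qed
    moreover have "(r \<longlongrightarrow> l1) (at_right x)"
      unfolding eq
    proof (rule Lim_transform_eventually[OF R(2)])
      show "\<forall>\<^sub>F y in at_right x. U2 y = r y"
        unfolding eventually_at_right[OF x(3)] by (rule exI[of _ d]) (use x in \<open>auto simp: r_def\<close>)
    qed
    ultimately have "(AE y\<in>{a<..<b} in lebesgue. r y = u y) \<and> isCont r x"
      by (simp add: isCont_def filterlim_split_at r_def)
    then show False using \<open>x \<in> discontinuity_set a b u\<close> unfolding discontinuity_set_def by blast
  qed
next
  assume ne: "l1 \<noteq> l2"
  have "False" if r: "AE y\<in>{a<..<b} in lebesgue. r y = u y" "isCont r x" for r
  proof -
    have "((\<lambda>y. r y - U1 y) \<longlongrightarrow> r x - l1) (at_left x)"
      using r(2) L(2) by (intro tendsto_diff) (auto simp: isCont_def filterlim_at_split)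
    moreover have "AE y\<in>{c<..<x} in lebesgue. r y - U1 y = 0"
      using r(1) L(1) by eventually_elim (use x in auto)
    ultimately have "r x - l1 = 0"
      by (intro tendsto_AE_zero[of "\<lambda>y. r y - U1 y" _ x c x]) (use x in \<open>auto elim: tendsto_within_subset\<close>)
    moreover have "((\<lambda>y. r y - U2 y) \<longlongrightarrow> r x - l2) (at_right x)"
      using r(2) R(2) by (intro tendsto_diff) (auto simp: isCont_def filterlim_at_split)
    moreover have "AE y\<in>{x<..<d} in lebesgue. r y - U2 y = 0"
      using r(1) R(1) by eventually_elim (use x in auto)
    ultimately have "r x - l2 = 0"
      by (intro tendsto_AE_zero[of "\<lambda>y. r y - U2 y" _ x x d]) (use x in \<open>auto elim: tendsto_within_subset\<close>)
    with \<open>r x - l1 = 0\<close> ne show False by simp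
  qed
  then show "x \<in> discontinuity_set a b u" using x by (auto simp: discontinuity_set_def)
qed

section \<open>Piecewise \<open>H\<^sup>2\<close> functions\<close>

lemma affine_on_join:
  assumes "affine_on p h v a c A B" "affine_on p h v c d A B"
  shows "affine_on p h v a d A B"
proof -
  have "AE x in lebesgue. x \<notin> {c}" by (rule AE_not_in_finite) simp
  with assms show ?thesis unfolding affine_on_def by eventually_elim (metis greaterThanLessThan_iff insertI1 linorder_cases)
qed

lemma affine_on_subset:
  assumes "affine_on p h v a b A B" "a \<le> c" "d \<le> b"
  shows "affine_on p h v c d A B"
  using assms(1) unfolding affine_on_def by eventually_elim (use assms in auto)

text \<open>Adjacent pieces may carry equal coefficients, so a knot need not be a singularity of
  \<open>v\<close>; such spurious knots are removed separately in
  \<open>nform_minimal\<close>.\<close>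

definition nform :: "real \<Rightarrow> real \<Rightarrow> (real \<Rightarrow> real) \<Rightarrow> nat \<Rightarrow> (nat \<Rightarrow> real) \<Rightarrow> (nat \<Rightarrow> real) \<Rightarrow> (nat \<Rightarrow> real) \<Rightarrow> (real \<Rightarrow> real) \<Rightarrow> bool" where
  "nform a b h n s A B v \<longleftrightarrow> partition n s a b \<and> L2_on {a<..<b} h \<and>
     (\<forall>i<n. affine_on a h v (s i) (s (Suc i)) (A i) (B i))"

lemma piecewise_H2_imp_nform:
  assumes "piecewise_H2 a b v"
  obtains h n s A B where "nform a b h n s A B v"
proof -
  obtain n s where s: "s 0 = a" "s n = b" "\<forall>i<n. s i < s (Suc i) \<and> H2_on (s i) (s (Suc i)) v"
    using assms unfolding piecewise_H2_def by blast
  show ?thesis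
    using piecewise_H2_imp_affine_on[OF s(3)] s that unfolding nform_def partition_def by metis
qed

lemma nform_imp_piecewise_H2:
  assumes "nform a b h n s A B v"
  shows "piecewise_H2 a b v"
  unfolding piecewise_H2_def
proof (intro exI conjI allI impI)
  have part: "partition n s a b" using assms by (simp add: nform_def)
  then show "s 0 = a" "s n = b" by (auto simp: partition_def)
  fix i assume i: "i < n"
  then show "s i < s (Suc i)" using part by (auto simp: partition_def)
  then show "H2_on (s i) (s (Suc i)) v"
    using assms i partition_bounds[OF part, of i] partition_bounds[OF part, of "Suc i"]
    by (intro H2_onI[where p = a and q = b and h = h]) (auto simp: nform_def affine_on_def)
qed

lemma continuous_on_dprim:
  assumes "L1_on {a..b} h"
  shows "continuous_on {a..b} (dprim a h)"
  unfolding dprim_def by (intro continuous_on_prim L1_on_continuous assms)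

lemma L2_on_pieces:
  assumes "\<forall>i<n. s i < s (Suc i) \<and> L2_on {s i<..<s (Suc i)} v"
  shows "s 0 \<le> s n \<and> L2_on {s 0<..<s n} v"
  using assms
proof (induction n)
  case 0
  then show ?case by (simp add: L2_on_iff)
next
  case (Suc n)
  then have IH: "s 0 \<le> s n" "L2_on {s 0<..<s n} v" and *: "s n < s (Suc n)" "L2_on {s n<..<s (Suc n)} v" by auto
  then show ?case using L2_on_join[of "s 0" "s n" v "s (Suc n)"] by (cases "s 0 = s n") auto
qed

lemma piecewise_H2_imp_L2_on:
  assumes "piecewise_H2 a b v"
  shows "L2_on {a<..<b} v"
proof -
  obtain n s where s: "s 0 = a" "s n = b" "\<forall>i<n. s i < s (Suc i) \<and> H2_on (s i) (s (Suc i)) v"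
    using assms unfolding piecewise_H2_def by blast
  then show ?thesis using L2_on_pieces[of n s v] by (auto simp: H2_on_def)
qed

text \<open>The candidate \<open>g\<close> is the step function of the slopes plus
  \<open>prim a h\<close>, to which \<open>is_ac_derivative_step\<close> applies. As
  \<open>v\<close> is a primitive of \<open>g\<close> up to a constant on each piece, the same
  result then gives its derivative.\<close>

lemma nform_ac_derivative:
  assumes nf: "nform a b h n s A B v" and ab: "a < b"
  obtains g where "is_ac_derivative a b v g" "is_ac_derivative a b g h"
proof -
  have part: "partition n s a b" and L2: "L2_on {a<..<b} h"
    and aff: "\<And>i. i < n \<Longrightarrow> affine_on a h v (s i) (s (Suc i)) (A i) (B i)"
    using nf by (auto simp: nform_def)
  have hi: "L1_on {a..b} h" by (rule L2_on_imp_L1_on[OF L2])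
  define g where "g x = B 0 + (\<Sum>j\<in>{1..<n}. (B j - B (j - 1)) * indicator {s j<..<b} x) + prim a h x" for x
  have gp: "g x = B i + prim a h x" if "i < n" "x \<in> {s i<..<s (Suc i)}" for i x
    using step_sum_eq[OF part that(1), of x B] that by (simp add: g_def)
  have gh: "is_ac_derivative a b g h"
    by (rule is_ac_derivative_step[OF part ab hi]) (auto simp: gp)
  have gi: "L1_on {a..b} g"
    using gh by (simp add: is_ac_derivative_def L1_on_Ioo_iff_Icc)
  have "is_ac_derivative a b v g"
  proof (rule is_ac_derivative_step[OF part ab gi])
    fix i assume i: "i < n"
    note bd = partition_bounds[OF part, of i] partition_bounds[OF part, of "Suc i"]
    show "AE x\<in>{s i<..<s (Suc i)} in lebesgue.
        v x = (A i + B i * s i + dprim a h (s i) - prim a g (s i)) + prim a g x"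
      using aff[OF i] unfolding affine_on_def
    proof eventually_elim
      case (elim x)
      show ?case
      proof
        assume x: "x \<in> {s i<..<s (Suc i)}"
        have sub: "L1_on {s i..x} (prim a h)"
          by (rule L1_on_subset[OF L1_on_continuous[OF continuous_on_prim[OF hi]]]) (use x i bd in auto)
        have "prim a g x - prim a g (s i) = prim (s i) g x"
          using prim_diff[OF gi, of "s i" x] x i bd by (simp add: prim_def)
        also have "\<dots> = prim (s i) (\<lambda>t. B i + prim a h t) x"
          by (rule prim_cong[of _ x]) (use gp[OF i] x in auto)
        also have "\<dots> = B i * (x - s i) + prim (s i) (prim a h) x"
          by (rule prim_affine[of _ x]) (use x i bd continuous_on_prim[OF hi] continuous_on_subset in \<open>auto intro: continuous_on_subset\<close>)
        also have "prim (s i) (prim a h) x = dprim a h x - dprim a h (s i)"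
          unfolding dprim_def using prim_diff[OF L1_on_continuous[OF continuous_on_prim[OF hi]], of "s i" x] x i bd
          by (simp add: prim_def)
        finally show "v x = (A i + B i * s i + dprim a h (s i) - prim a g (s i)) + prim a g x"
          using elim x by (simp add: algebra_simps)
      qed
    qed
  qed
  then show ?thesis using gh that by blast
qed

lemma partition_singleton: "a < b \<Longrightarrow> partition 1 (\<lambda>i. if i = 0 then a else b) a b"
  by (simp add: partition_def)

text \<open>The formula \<open>A + B * x + dprim a h x\<close>, taken on all of (a,b), has an
  explicit derivative without singular part; local uniqueness compares it with \<open>v\<close> on
  (c,d) only.\<close>

lemma affine_on_ac_derivative:
  assumes v: "is_ac_derivative a b v g" and L2: "L2_on {a<..<b} h" and aff: "affine_on a h v c d A B"
    and cd: "a \<le> c" "c < d" "d \<le> b"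
  shows "AE x\<in>{c<..<d} in lebesgue. g x = B + prim a h x"
proof -
  have ab: "a < b" using cd by auto
  have hi: "L1_on {a..b} h" by (rule L2_on_imp_L1_on[OF L2])
  have cp: "continuous_on {a..b} (prim a h)" by (rule continuous_on_prim[OF hi])
  have "is_ac_derivative a b (\<lambda>x. A + B * x + dprim a h x) (\<lambda>x. B + prim a h x)"
  proof (rule is_ac_derivative_step[OF partition_singleton[OF ab] ab, where c = "\<lambda>_. A + B * a"])
    show "L1_on {a..b} (\<lambda>x. B + prim a h x)"
      by (intro L1_on_continuous continuous_intros cp)
    show "AE x\<in>{(if i = 0 then a else b)<..<if Suc i = 0 then a else b} in lebesgue.
            A + B * x + dprim a h x = A + B * a + prim a (\<lambda>x. B + prim a h x) x" if "i < 1" for i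
      using that by (auto simp: prim_affine[OF cp] dprim_def algebra_simps)
  qed
  from is_ac_derivative_unique_on[OF v this cd] aff show ?thesis by (simp add: affine_on_def)
qed

text \<open>\<open>ac_derivative a b v\<close> is some function a.e. equal to the explicit
  \<open>g\<close>. Being a density depends on a.e. classes only, so the second derivative may be
  computed from \<open>g\<close>.\<close>

lemma nform_second_ac_derivative:
  assumes nf: "nform a b h n s A B v" and ab: "a < b"
  shows "is_ac_derivative a b v (ac_derivative a b v)"
    "AE x\<in>{a<..<b} in lebesgue. ac_derivative a b (ac_derivative a b v) x = h x"
    "is_ac_derivative a b (ac_derivative a b v) h"
proof -
  obtain g where g: "is_ac_derivative a b v g" "is_ac_derivative a b g h"
    using nform_ac_derivative[OF nf ab] by blast
  show "is_ac_derivative a b v (ac_derivative a b v)"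
    by (rule is_ac_derivative_imp_ac_derivative[OF g(1) ab])
  have "AE x\<in>{a<..<b} in lebesgue. g x = ac_derivative a b v x"
    using is_ac_derivative_imp_ac_derivative(2)[OF g(1) ab] by eventually_elim auto
  from is_ac_derivative_cong[OF this, of h h] g(2) show 1: "is_ac_derivative a b (ac_derivative a b v) h"
    by simp
  show "AE x\<in>{a<..<b} in lebesgue. ac_derivative a b (ac_derivative a b v) x = h x"
    by (rule is_ac_derivative_imp_ac_derivative(2)[OF 1 ab])
qed

text \<open>\<open>dprim a h\<close> and \<open>prim a h\<close> are continuous and common to both
  sides, so they cancel in the comparison of one-sided limits.\<close>

lemma affine_discontinuity_iff:
  assumes v: "is_ac_derivative a b v (ac_derivative a b v)" and L2: "L2_on {a<..<b} h"
    and x: "a \<le> c" "c < x" "x < d" "d \<le> b"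
    and L: "affine_on a h v c x A1 B1" and R: "affine_on a h v x d A2 B2"
  shows "x \<in> discontinuity_set a b v \<longleftrightarrow> A1 + B1 * x \<noteq> A2 + B2 * x"
    "x \<in> discontinuity_set a b (ac_derivative a b v) \<longleftrightarrow> B1 \<noteq> B2"
proof -
  have hi: "L1_on {a..b} h" by (rule L2_on_imp_L1_on[OF L2])
  have at: "at x within {a..b} = at x" using x by (intro at_within_Icc_at) auto
  have xin: "x \<in> {a..b}" using x by auto
  have "(dprim a h \<longlongrightarrow> dprim a h x) (at x)" "(prim a h \<longlongrightarrow> prim a h x) (at x)"
    using bspec[OF continuous_on_dprim[OF hi, unfolded continuous_on] xin]
      bspec[OF continuous_on_prim[OF hi, unfolded continuous_on] xin] unfolding at by auto
  then have D: "(dprim a h \<longlongrightarrow> dprim a h x) (at_left x)" "(dprim a h \<longlongrightarrow> dprim a h x) (at_right x)"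
    and P: "(prim a h \<longlongrightarrow> prim a h x) (at_left x)" "(prim a h \<longlongrightarrow> prim a h x) (at_right x)"
    by (auto simp: filterlim_at_split)
  have "x \<in> discontinuity_set a b v \<longleftrightarrow> A1 + B1 * x + dprim a h x \<noteq> A2 + B2 * x + dprim a h x"
    by (rule discontinuity_set_iff[OF x L[unfolded affine_on_def] _ R[unfolded affine_on_def]])
      (intro tendsto_intros D)+
  then show "x \<in> discontinuity_set a b v \<longleftrightarrow> A1 + B1 * x \<noteq> A2 + B2 * x" by simp
  have "x \<in> discontinuity_set a b (ac_derivative a b v) \<longleftrightarrow> B1 + prim a h x \<noteq> B2 + prim a h x"
    by (rule discontinuity_set_iff[OF x affine_on_ac_derivative[OF v L2 L] _ affine_on_ac_derivative[OF v L2 R]])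
      (use x in \<open>auto intro!: tendsto_add P\<close>)
  then show "x \<in> discontinuity_set a b (ac_derivative a b v) \<longleftrightarrow> B1 \<noteq> B2" by simp
qed

text \<open>A point that is not a knot has the same coefficients on both sides. The indices 0 and n
  drop out because \<open>p 0\<close> and \<open>p n\<close> are the ends of the open interval. Used
  for strict partitions and for limits of knots alike.\<close>

lemma discontinuity_sets_subset_knots:
  fixes p :: "nat \<Rightarrow> real"
  assumes v: "is_ac_derivative a b v (ac_derivative a b v)" and L2: "L2_on {a<..<b} h"
    and aff: "\<And>i. i < n \<Longrightarrow> affine_on a h v (p i) (p (Suc i)) (A i) (B i)"
    and p: "p 0 = a" "p n = b" "\<And>i. i \<le> n \<Longrightarrow> p i \<in> {a..b}"
  shows "discontinuity_set a b v \<union> discontinuity_set a b (ac_derivative a b v) \<subseteq> p ` {1..<n}"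
proof (rule subsetI, rule ccontr)
  fix q assume q: "q \<in> discontinuity_set a b v \<union> discontinuity_set a b (ac_derivative a b v)"
    and no: "q \<notin> p ` {1..<n}"
  have qab: "a < q" "q < b" using q by (auto simp: discontinuity_set_def)
  have "q \<noteq> p j" if "j \<le> n" for j
    using that no qab p by (cases "j = 0 \<or> j = n") auto
  then obtain i where i: "i < n" "p i < q" "q < p (Suc i)"
    using between_consecutive[of p q n] qab p by auto
  have "affine_on a h v (p i) q (A i) (B i)" "affine_on a h v q (p (Suc i)) (A i) (B i)"
    by (rule affine_on_subset[OF aff[OF i(1)]]; use i in simp)+
  from affine_discontinuity_iff[OF v L2 _ i(2,3) _ this] p(3)[of i] p(3)[of "Suc i"] i(1)
  show False using q by auto
qed

lemma nform_discontinuity_sets: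
  assumes nf: "nform a b h n s A B v" and ab: "a < b"
  shows "discontinuity_set a b v = s ` {j\<in>{1..<n}. A (j - 1) + B (j - 1) * s j \<noteq> A j + B j * s j}"
    "discontinuity_set a b (ac_derivative a b v) = s ` {j\<in>{1..<n}. B (j - 1) \<noteq> B j}"
proof -
  have part: "partition n s a b" and L2: "L2_on {a<..<b} h"
    and aff: "\<And>i. i < n \<Longrightarrow> affine_on a h v (s i) (s (Suc i)) (A i) (B i)"
    using nf by (auto simp: nform_def)
  have s0n: "s 0 = a" "s n = b" using part by (auto simp: partition_def)
  note v = nform_second_ac_derivative(1)[OF nf ab]
  have knot: "s j \<in> discontinuity_set a b v \<longleftrightarrow> A (j - 1) + B (j - 1) * s j \<noteq> A j + B j * s j"
    "s j \<in> discontinuity_set a b (ac_derivative a b v) \<longleftrightarrow> B (j - 1) \<noteq> B j" if j: "j \<in> {1..<n}" for j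
  proof -
    have bd: "a \<le> s (j - 1)" "s (j - 1) < s j" "s j < s (Suc j)" "s (Suc j) \<le> b"
      using part j partition_less[OF part, of "j - 1" j] partition_bounds[OF part, of "j - 1"]
        partition_bounds[OF part, of "Suc j"] by (auto simp: partition_def)
    have L: "affine_on a h v (s (j - 1)) (s j) (A (j - 1)) (B (j - 1))"
      and R: "affine_on a h v (s j) (s (Suc j)) (A j) (B j)"
      using aff[of "j - 1"] aff[of j] j by auto
    show "s j \<in> discontinuity_set a b v \<longleftrightarrow> A (j - 1) + B (j - 1) * s j \<noteq> A j + B j * s j"
      "s j \<in> discontinuity_set a b (ac_derivative a b v) \<longleftrightarrow> B (j - 1) \<noteq> B j"
      by (rule affine_discontinuity_iff[OF v L2 bd L R])+
  qed
  have interior: "\<exists>j\<in>{1..<n}. x = s j"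
    if "x \<in> discontinuity_set a b v \<or> x \<in> discontinuity_set a b (ac_derivative a b v)" for x
    using discontinuity_sets_subset_knots[OF v L2 aff s0n] partition_bounds[OF part] that by auto
  show "discontinuity_set a b v = s ` {j\<in>{1..<n}. A (j - 1) + B (j - 1) * s j \<noteq> A j + B j * s j}"
    "discontinuity_set a b (ac_derivative a b v) = s ` {j\<in>{1..<n}. B (j - 1) \<noteq> B j}"
    using knot interior by blast+
qed

lemma nform_remove_knot:
  assumes nf: "nform a b h n s A B v" and j: "j \<in> {1..<n}" "A (j - 1) = A j" "B (j - 1) = B j"
  shows "\<exists>s' A' B'. nform a b h (n - 1) s' A' B' v"
proof -
  have part: "partition n s a b" and L2: "L2_on {a<..<b} h"
    and aff: "\<And>i. i < n \<Longrightarrow> affine_on a h v (s i) (s (Suc i)) (A i) (B i)"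
    using nf by (auto simp: nform_def)
  \<comment> \<open>Renumbering that skips \<open>j\<close>: piece \<open>j - 1\<close> becomes the
    union of the old pieces \<open>j - 1\<close> and \<open>j\<close>.\<close>
  define \<tau> where "\<tau> i = (if i < j then i else Suc i)" for i
  have "partition (n - 1) (s \<circ> \<tau>) a b"
    unfolding partition_def
  proof (intro conjI allI impI)
    show "(s \<circ> \<tau>) 0 = a" "(s \<circ> \<tau>) (n - 1) = b" using part j by (auto simp: partition_def \<tau>_def)
    fix i assume i: "i < n - 1"
    show "(s \<circ> \<tau>) i < (s \<circ> \<tau>) (Suc i)"
      using i by (auto simp: \<tau>_def intro!: partition_less[OF part])
  qed
  moreover have "affine_on a h v ((s \<circ> \<tau>) i) ((s \<circ> \<tau>) (Suc i)) ((A \<circ> \<tau>) i) ((B \<circ> \<tau>) i)" if "i < n - 1" for i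
  proof (cases "Suc i = j")
    case True
    then show ?thesis using affine_on_join[of a h v "s i" "s j" "A j" "B j" "s (Suc j)"] aff[of i] aff[of j] j
      by (auto simp: \<tau>_def)
  next
    case False
    then show ?thesis using aff[of i] aff[of "Suc i"] that by (auto simp: \<tau>_def)
  qed
  ultimately show ?thesis using L2 unfolding nform_def by blast
qed

text \<open>Chooses the least number of pieces, since a knot with equal coefficients on both sides
  could be removed. Every interior knot is then paid for in the energy, which is what bounds the
  number of knots along a minimising sequence.\<close>

lemma nform_minimal:
  assumes "piecewise_H2 a b v"
  obtains h n s A B where "nform a b h n s A B v" "\<And>j. j \<in> {1..<n} \<Longrightarrow> A (j - 1) \<noteq> A j \<or> B (j - 1) \<noteq> B j"
proof -
  define Q where "Q n \<longleftrightarrow> (\<exists>h s A B. nform a b h n s A B v)" for n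
  have "\<exists>n. Q n" using piecewise_H2_imp_nform[OF assms] Q_def by metis
  then obtain n where n: "Q n" "\<And>m. m < n \<Longrightarrow> \<not> Q m" using exists_least_iff[of Q] by blast
  then obtain h s A B where nf: "nform a b h n s A B v" unfolding Q_def by blast
  show ?thesis
  proof (rule that[OF nf], rule ccontr)
    fix j assume j: "j \<in> {1..<n}" "\<not> (A (j - 1) \<noteq> A j \<or> B (j - 1) \<noteq> B j)"
    then have "Q (n - 1)" using nform_remove_knot[OF nf j(1)] unfolding Q_def by blast
    then show False using n(2)[of "n - 1"] j by auto
  qed
qed

section \<open>Weak limits\<close>

text \<open>Fatou's lemma yields integrability of the limit together with the bound. The numbers
  \<open>q n\<close> stand in for the integrals because near-minimisers of a norm come with
  convergent upper bounds.\<close>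

lemma fatou_bound:
  fixes f :: "nat \<Rightarrow> 'a \<Rightarrow> real"
  assumes f: "\<And>n. integrable M (f n)" "\<And>n x. 0 \<le> f n x" and g: "g \<in> borel_measurable M"
    and lim: "AE x in M. (\<lambda>n. f n x) \<longlonglongrightarrow> g x" and q: "\<And>n. integral\<^sup>L M (f n) \<le> q n" "q \<longlonglongrightarrow> Q"
  shows "integrable M g" "integral\<^sup>L M g \<le> Q"
proof -
  have g0: "AE x in M. 0 \<le> g x"
    using lim by eventually_elim (rule LIMSEQ_le_const, use f(2) in auto)
  have q0: "0 \<le> q n" for n
    using order_trans[OF Bochner_Integration.integral_nonneg q(1)[of n]] f(2) by blast
  have Q0: "0 \<le> Q" by (rule LIMSEQ_le_const[OF q(2)]) (use q0 in auto)
  have "(\<integral>\<^sup>+x. ennreal (g x) \<partial>M) = (\<integral>\<^sup>+x. liminf (\<lambda>n. ennreal (f n x)) \<partial>M)"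
  proof (rule nn_integral_cong_AE, use lim in eventually_elim)
    fix x assume "(\<lambda>n. f n x) \<longlonglongrightarrow> g x"
    then have "(\<lambda>n. ennreal (f n x)) \<longlonglongrightarrow> ennreal (g x)" by (rule tendsto_ennrealI)
    then show "ennreal (g x) = liminf (\<lambda>n. ennreal (f n x))"
      using lim_imp_Liminf[of sequentially] by (metis sequentially_bot)
  qed
  also have "\<dots> \<le> liminf (\<lambda>n. \<integral>\<^sup>+x. ennreal (f n x) \<partial>M)"
    by (rule nn_integral_liminf) (use f(1) borel_measurable_integrable in auto)
  also have "\<dots> \<le> liminf (\<lambda>n. ennreal (q n))"
  proof (rule Liminf_mono, rule always_eventually, rule allI)
    fix n
    have "(\<integral>\<^sup>+x. ennreal (f n x) \<partial>M) = ennreal (integral\<^sup>L M (f n))"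
      by (rule nn_integral_eq_integral) (use f in auto)
    then show "(\<integral>\<^sup>+x. ennreal (f n x) \<partial>M) \<le> ennreal (q n)" using q(1) by (simp add: ennreal_leI)
  qed
  also have "\<dots> = ennreal Q"
    using lim_imp_Liminf[OF _ tendsto_ennrealI[OF q(2)]] by simp
  finally have le: "(\<integral>\<^sup>+x. ennreal (g x) \<partial>M) \<le> ennreal Q" .
  show i: "integrable M g"
    by (rule integrableI_nonneg[OF g g0]) (use le in \<open>auto simp: order_le_less_trans\<close>)
  have "ennreal (integral\<^sup>L M g) \<le> ennreal Q"
    using nn_integral_eq_integral[OF i g0] le by simp
  then show "integral\<^sup>L M g \<le> Q" using Q0 by (simp add: ennreal_le_iff)
qed

lemma AE_summable:
  fixes u :: "nat \<Rightarrow> 'a \<Rightarrow> real"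
  assumes "\<And>n. integrable M (u n)" "summable (\<lambda>n. \<integral>x. \<bar>u n x\<bar> \<partial>M)"
  shows "AE x in M. summable (\<lambda>n. \<bar>u n x\<bar>)"
proof -
  have "(\<integral>\<^sup>+x. (\<Sum>n. ennreal \<bar>u n x\<bar>) \<partial>M) = (\<Sum>n. \<integral>\<^sup>+x. ennreal \<bar>u n x\<bar> \<partial>M)"
    by (rule nn_integral_suminf) (use assms(1) borel_measurable_integrable in auto)
  also have "\<dots> = (\<Sum>n. ennreal (\<integral>x. \<bar>u n x\<bar> \<partial>M))"
    by (intro suminf_cong nn_integral_eq_integral) (use assms(1) in auto)
  also have "\<dots> < \<infinity>"
    using assms(2) by (subst suminf_ennreal2) auto
  finally have "(\<integral>\<^sup>+x. (\<Sum>n. ennreal \<bar>u n x\<bar>) \<partial>M) \<noteq> \<infinity>" by simp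
  then have "AE x in M. (\<Sum>n. ennreal \<bar>u n x\<bar>) \<noteq> \<infinity>"
    by (rule nn_integral_PInf_AE[rotated]) (use assms(1) borel_measurable_integrable in auto)
  then show ?thesis
    by eventually_elim (rule summable_suminf_not_top, auto)
qed

section \<open>Strong and weak limits of square integrable functions\<close>

lemma prim_eq_lebesgue:
  assumes "L1_on {a<..<b} y" "a \<le> x" "x \<le> b"
  shows "prim a y x = (LINT t|lebesgue. indicat_real {a<..<x} t * (indicat_real {a<..<b} t * y t))"
proof -
  have i: "L1_on {a..x} y"
    using L1_on_subset[of a b y a x] assms by (simp add: L1_on_Ioo_iff_Icc)
  have "(\<lambda>t. indicat_real {a<..<x} t * (indicat_real {a<..<b} t * y t)) = (\<lambda>t. indicat_real {a<..<x} t *\<^sub>R y t)"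
    using assms by (auto simp: indicator_def fun_eq_iff)
  then show ?thesis
    using L1_on_Ioo_integral[OF i] by (simp add: prim_def set_lebesgue_integral_def)
qed

definition sqn :: "real \<Rightarrow> real \<Rightarrow> (real \<Rightarrow> real) \<Rightarrow> real" where
  "sqn a b y = (LINT x:{a<..<b}|lebesgue. (y x)\<^sup>2)"

lemma sqn_eq: "sqn a b y = (LINT x|lebesgue. (indicat_real {a<..<b} x * y x)\<^sup>2)"
  unfolding sqn_def set_lebesgue_integral_def
  by (rule Bochner_Integration.integral_cong) (auto simp: indicator_def)

lemma sqn_nonneg: "0 \<le> sqn a b y"
  unfolding sqn_eq by (rule Bochner_Integration.integral_nonneg) simp

text \<open>The rate \<open>(1/4) ^ n\<close> makes the integrals of the absolute increments
  summable. This gives a.e. convergence and an integrable majorant, hence convergence of primitives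
  by dominated convergence; Fatou's lemma gives the norm bound.\<close>

lemma L2_Cauchy_limit:
  assumes ab: "a < b" and y: "\<And>n. L2_on {a<..<b} (y n)"
    and C: "\<And>n. sqn a b (\<lambda>x. y (Suc n) x - y n x) \<le> (1/4) ^ n"
    and q: "\<And>n. sqn a b (y n) \<le> q n" "q \<longlonglongrightarrow> Q"
  obtains h where "L2_on {a<..<b} h" "sqn a b h \<le> Q"
    "\<And>x. x \<in> {a..b} \<Longrightarrow> (\<lambda>n. prim a (y n) x) \<longlonglongrightarrow> prim a h x"
proof -
  define Y where "Y n x = indicat_real {a<..<b} x * y n x" for n x
  define u where "u n x = Y (Suc n) x - Y n x" for n x
  have yi: "L1_on {a<..<b} (y n)" for n
    using L2_on_imp_L1_on[OF y] by (simp add: L1_on_Ioo_iff_Icc)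
  have Yi: "integrable lebesgue (Y n)" for n
    using yi[of n] by (simp add: Y_def[abs_def] set_integrable_def)
  have Y2: "integrable lebesgue (\<lambda>x. (Y n x)\<^sup>2)" for n
    using y[of n] by (simp add: L2_on_iff Y_def)
  have ui: "integrable lebesgue (u n)" for n unfolding u_def using Yi by simp
  have u_eq: "u n x = indicat_real {a<..<b} x * (y (Suc n) x - y n x)" for n x
    by (simp add: u_def Y_def right_diff_distrib)
  have u2: "integrable lebesgue (\<lambda>x. (u n x)\<^sup>2)" for n
    using L2_on_diff[OF y[of "Suc n"] y[of n]] by (simp add: L2_on_iff u_eq)
  have u2C: "(LINT x|lebesgue. (u n x)\<^sup>2) \<le> (1/4)^n" for n
    using C[of n] by (simp add: sqn_eq u_eq)
  note ii = integrable_indicator_Ioo[of a b]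
  define L where "L = (LINT x|lebesgue. indicat_real {a<..<b} x)"
  have u1: "(LINT x|lebesgue. \<bar>u n x\<bar>) \<le> (L + 1) * (1/2)^n" for n
  proof -
    \<comment> \<open>The weights are balanced: with squared norms of order 4^(-n), both terms
      integrate to order 2^(-n).\<close>
    have young: "\<bar>t\<bar> \<le> (1/2)^n + 2^n * t\<^sup>2" for t :: real
    proof (cases "\<bar>t\<bar> \<le> (1/2)^n")
      case False
      then have "1 \<le> 2^n * \<bar>t\<bar>" by (simp add: field_simps power_divide)
      then have "\<bar>t\<bar> * 1 \<le> \<bar>t\<bar> * (2^n * \<bar>t\<bar>)" by (intro mult_left_mono) auto
      then have "\<bar>t\<bar> \<le> 2^n * t\<^sup>2" by (simp add: power2_eq_square mult.left_commute)
      then show ?thesis by (simp add: add_increasing)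
    qed (simp add: add_increasing2)
    have "(LINT x|lebesgue. \<bar>u n x\<bar>) \<le> (LINT x|lebesgue. (1/2)^n * indicat_real {a<..<b} x + 2^n * (u n x)\<^sup>2)"
    proof (rule integral_mono)
      show "\<bar>u n x\<bar> \<le> (1/2)^n * indicat_real {a<..<b} x + 2^n * (u n x)\<^sup>2" for x
        using young[of "u n x"] by (cases "x \<in> {a<..<b}") (auto simp: u_eq)
    qed (use ui ii u2 in auto)
    also have "\<dots> = (1/2)^n * L + 2^n * (LINT x|lebesgue. (u n x)\<^sup>2)"
      using ii u2 by (simp add: L_def)
    also have "\<dots> \<le> (1/2)^n * L + 2^n * (1/4)^n"
      using u2C by (intro add_left_mono mult_left_mono) auto
    also have "2^n * (1/4::real)^n = (1/2)^n" by (simp add: power_mult_distrib[symmetric])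
    finally show ?thesis by (simp add: algebra_simps)
  qed
  have sm: "summable (\<lambda>n. LINT x|lebesgue. \<bar>u n x\<bar>)"
  proof (rule summable_comparison_test')
    show "summable (\<lambda>n. (L + 1) * (1/2::real)^n)" by (intro summable_mult summable_geometric) simp
  qed (use u1 in auto)
  have AEs: "AE x in lebesgue. summable (\<lambda>n. \<bar>u n x\<bar>)" by (rule AE_summable[OF ui sm])
  define h where "h x = Y 0 x + (\<Sum>n. u n x)" for x
  \<comment> \<open>Majorises all \<open>Y n\<close> at once, by the triangle inequality in the
    telescoping sum.\<close>
  define W where "W x = \<bar>Y 0 x\<bar> + (\<Sum>n. \<bar>u n x\<bar>)" for x
  have hi: "integrable lebesgue h"
    unfolding h_def by (intro Bochner_Integration.integrable_add Yi integrable_suminf) (use ui AEs sm in auto)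
  have Wi: "integrable lebesgue W"
    unfolding W_def by (intro Bochner_Integration.integrable_add integrable_abs Yi integrable_suminf) (use ui AEs sm in auto)
  have tele: "Y n x = Y 0 x + (\<Sum>i<n. u i x)" for n x
    by (induction n) (auto simp: u_def)
  have lim: "AE x in lebesgue. (\<lambda>n. Y n x) \<longlonglongrightarrow> h x"
    using AEs
  proof eventually_elim
    case (elim x)
    then have "(\<lambda>n. \<Sum>i<n. u i x) \<longlonglongrightarrow> (\<Sum>n. u n x)"
      by (rule summable_LIMSEQ[OF summable_rabs_cancel])
    then have "(\<lambda>n. Y 0 x + (\<Sum>i<n. u i x)) \<longlonglongrightarrow> h x"
      unfolding h_def by (intro tendsto_add tendsto_const)
    moreover have "(\<lambda>n. Y n x) = (\<lambda>n. Y 0 x + (\<Sum>i<n. u i x))" by (rule ext) (rule tele)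
    ultimately show ?case by (simp only:)
  qed
  have dom: "AE x in lebesgue. norm (Y n x) \<le> W x" for n
    using AEs
  proof eventually_elim
    case (elim x)
    have "\<bar>Y n x\<bar> \<le> \<bar>Y 0 x\<bar> + (\<Sum>i<n. \<bar>u i x\<bar>)"
      unfolding tele[of n x] using sum_abs[of "\<lambda>i. u i x" "{..<n}"] by linarith
    also have "(\<Sum>i<n. \<bar>u i x\<bar>) \<le> (\<Sum>n. \<bar>u n x\<bar>)"
      by (rule sum_le_suminf[OF elim]) auto
    finally show ?case by (simp add: W_def)
  qed
  have hm: "h \<in> borel_measurable lebesgue" using hi by auto
  have h0: "indicat_real {a<..<b} x * h x = h x" for x
    by (auto simp: h_def u_eq Y_def indicator_def)
  have h2: "integrable lebesgue (\<lambda>x. (h x)\<^sup>2)" "(LINT x|lebesgue. (h x)\<^sup>2) \<le> Q"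
  proof -
    have l2: "AE x in lebesgue. (\<lambda>n. (Y n x)\<^sup>2) \<longlonglongrightarrow> (h x)\<^sup>2"
      using lim by eventually_elim (intro tendsto_intros)
    have m2: "(\<lambda>x. (h x)\<^sup>2) \<in> borel_measurable lebesgue" using hm by (rule borel_measurable_power)
    have q2: "(LINT x|lebesgue. (Y n x)\<^sup>2) \<le> q n" for n using q(1)[of n] by (simp add: sqn_eq Y_def)
    show "integrable lebesgue (\<lambda>x. (h x)\<^sup>2)" "(LINT x|lebesgue. (h x)\<^sup>2) \<le> Q"
      using fatou_bound[OF Y2 _ m2 l2 q2 q(2)] by auto
  qed
  show ?thesis
  proof
    show L: "L2_on {a<..<b} h" using h2 hm by (simp add: L2_on_iff h0)
    show "sqn a b h \<le> Q" using h2 by (simp add: sqn_eq h0)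
    fix x assume x: "x \<in> {a..b}"
    have hs: "L1_on {a<..<b} h"
      using L2_on_imp_L1_on[OF L] by (simp add: L1_on_Ioo_iff_Icc)
    have "(\<lambda>n. LINT t|lebesgue. indicat_real {a<..<x} t * Y n t) \<longlonglongrightarrow> (LINT t|lebesgue. indicat_real {a<..<x} t * h t)"
    proof (rule integral_dominated_convergence[OF _ _ Wi])
      show "(\<lambda>t. indicat_real {a<..<x} t * h t) \<in> borel_measurable lebesgue"
        by (rule borel_measurable_times[OF borel_measurable_indicator hm]) simp
      show "(\<lambda>t. indicat_real {a<..<x} t * Y n t) \<in> borel_measurable lebesgue" for n
        by (rule borel_measurable_times[OF borel_measurable_indicator borel_measurable_integrable[OF Yi]]) simp
      show "AE t in lebesgue. (\<lambda>n. indicat_real {a<..<x} t * Y n t) \<longlonglongrightarrow> indicat_real {a<..<x} t * h t"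
        using lim by eventually_elim (intro tendsto_intros)
      show "AE t in lebesgue. norm (indicat_real {a<..<x} t * Y n t) \<le> W t" for n
        using dom[of n] by eventually_elim (auto simp: indicator_def)
    qed
    then show "(\<lambda>n. prim a (y n) x) \<longlonglongrightarrow> prim a h x"
      using prim_eq_lebesgue[OF yi, of x] prim_eq_lebesgue[OF hs, of x] x by (simp add: Y_def h0)
  qed
qed

lemma sqn_parallelogram:
  assumes "L2_on {a<..<b} y" "L2_on {a<..<b} z"
  shows "sqn a b (\<lambda>x. y x - z x) + sqn a b (\<lambda>x. y x + z x) = 2 * sqn a b y + 2 * sqn a b z"
proof -
  have "sqn a b (\<lambda>x. y x - z x) + sqn a b (\<lambda>x. y x + z x) =
     (LINT x:{a<..<b}|lebesgue. (y x - z x)\<^sup>2 + (y x + z x)\<^sup>2)"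
    unfolding sqn_def using L2_on_diff[OF assms] L2_on_add[OF assms]
    by (intro set_integral_add(2)[symmetric]) (auto simp: L2_on_def)
  also have "\<dots> = (LINT x:{a<..<b}|lebesgue. 2 * (y x)\<^sup>2 + 2 * (z x)\<^sup>2)"
    by (rule set_lebesgue_integral_cong) (auto simp: power2_eq_square algebra_simps)
  also have "\<dots> = 2 * sqn a b y + 2 * sqn a b z"
    unfolding sqn_def using assms by (subst set_integral_add(2)) (auto simp: L2_on_def)
  finally show ?thesis .
qed

lemma sqn_cmult: "sqn a b (\<lambda>x. c * y x) = c\<^sup>2 * sqn a b y"
  by (simp add: sqn_def power_mult_distrib)

lemma prim_cmult: "prim a (\<lambda>x. c * y x) x = c * prim a y x"
  by (simp add: prim_def)

lemma prim_add:
  assumes "L1_on {a..b} y" "L1_on {a..b} z" "x \<le> b"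
  shows "prim a (\<lambda>x. y x + z x) x = prim a y x + prim a z x"
  unfolding prim_def
  by (intro HK_integral_add L1_on_imp_HK)
    (use L1_on_subset[OF assms(1)] L1_on_subset[OF assms(2)] assms(3) in auto)

text \<open>The weak limit is obtained without weak compactness: the functions whose primitives are
  uniformly close to \<open>H\<close> form decreasing convex sets, and near-minimisers of the norm on
  these sets form a Cauchy sequence by the parallelogram law.\<close>

lemma L2_weak_limit:
  assumes ab: "a < b" and hk: "\<And>k. L2_on {a<..<b} (h k)" and C: "\<And>k. sqn a b (h k) \<le> C"
    and H: "\<And>e. 0 < e \<Longrightarrow> \<exists>N::nat. \<forall>k\<ge>N. \<forall>x\<in>{a..b}. \<bar>prim a (h k) x - H x\<bar> \<le> e"
  obtains g where "L2_on {a<..<b} g" "\<And>x. x \<in> {a..b} \<Longrightarrow> prim a g x = H x"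
    "\<And>c. (\<And>N. \<exists>k\<ge>N. sqn a b (h k) \<le> c) \<Longrightarrow> sqn a b g \<le> c"
proof -
  define K where "K n = {y. L2_on {a<..<b} y \<and> (\<forall>x\<in>{a..b}. \<bar>prim a y x - H x\<bar> \<le> 1 / real (Suc n))}" for n
  define d where "d n = (INF y\<in>K n. sqn a b y)" for n
  have hK: "\<exists>N. \<forall>k\<ge>N. h k \<in> K n" for n
    using H[of "1 / real (Suc n)"] hk by (simp add: K_def)
  have bdd: "bdd_below (sqn a b ` K n)" for n
    using sqn_nonneg by (intro bdd_belowI[of _ 0]) auto
  have dle: "d n \<le> sqn a b y" if "y \<in> K n" for n y
    unfolding d_def by (rule cINF_lower[OF bdd that])
  have Kmono: "K n \<subseteq> K m" if "m \<le> n" for m n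
  proof -
    have "1 / real (Suc n) \<le> 1 / real (Suc m)" using that by (simp add: frac_le)
    then show ?thesis unfolding K_def by (auto intro: order_trans)
  qed
  have Kne: "K n \<noteq> {}" for n using hK[of n] by blast
  have dmono: "incseq d"
    unfolding d_def by (intro monoI cINF_superset_mono Kne bdd Kmono) auto
  \<comment> \<open>This carries the lower semicontinuity: the \<open>h k\<close> eventually belong
    to \<open>K n\<close>, so a bound met infinitely often also bounds the infimum over
    \<open>K n\<close>.\<close>
  have dc: "d n \<le> c" if c: "\<And>N. \<exists>k\<ge>N. sqn a b (h k) \<le> c" for n c
  proof -
    obtain N where "\<forall>k\<ge>N. h k \<in> K n" using hK by blast
    moreover obtain k where "k \<ge> N" "sqn a b (h k) \<le> c" using c by blast
    ultimately show ?thesis using dle[of "h k" n] by force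
  qed
  have dC: "d n \<le> C" for n by (rule dc) (use C in blast)
  obtain D where D: "d \<longlonglongrightarrow> D" "\<And>n. d n \<le> D"
    using incseq_convergent[OF dmono, of C] dC by blast
  \<comment> \<open>The parallelogram law below costs a factor 8, and \<open>L2_Cauchy_limit\<close>
    asks for increments of size \<open>(1/4)^n\<close>.\<close>
  define \<epsilon> where "\<epsilon> n = (1/4::real)^n / 8" for n
  have \<epsilon>: "\<epsilon> n > 0" for n by (simp add: \<epsilon>_def)
  have "\<exists>y m. y \<in> K m \<and> n \<le> m \<and> D - \<epsilon> n < d m \<and> sqn a b y \<le> D + \<epsilon> n" for n
  proof -
    obtain M where "\<forall>m\<ge>M. D - \<epsilon> n < d m"
      using order_tendstoD(1)[OF D(1), of "D - \<epsilon> n"] \<epsilon>[of n] by (auto simp: eventually_sequentially)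
    then have "D - \<epsilon> n < d (max M n)" by simp
    moreover have "(INF y\<in>K (max M n). sqn a b y) < D + \<epsilon> n"
      using D(2)[of "max M n"] \<epsilon>[of n] by (simp add: d_def)
    then obtain y where "y \<in> K (max M n)" "sqn a b y < D + \<epsilon> n"
      by (subst (asm) cINF_less_iff[OF Kne bdd]) blast
    ultimately show ?thesis by (intro exI[of _ y] exI[of _ "max M n"]) auto
  qed
  then obtain y m where ym: "\<And>n. y n \<in> K (m n)" "\<And>n. n \<le> m n" "\<And>n. D - \<epsilon> n < d (m n)" "\<And>n. sqn a b (y n) \<le> D + \<epsilon> n"
    by metis
  have yL: "L2_on {a<..<b} (y n)" for n using ym(1)[of n] by (simp add: K_def)
  have step: "sqn a b (\<lambda>x. y (Suc n) x - y n x) \<le> (1/4) ^ n" for n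
  proof -
    define M where "M = min (m n) (m (Suc n))"
    \<comment> \<open>The midpoint of two elements of the convex set \<open>K M\<close> stays in it,
      so its squared norm is at least \<open>d M\<close>; the parallelogram law converts this into a
      bound for the difference.\<close>
    define z where "z x = (1/2) * (y (Suc n) x + y n x)" for x
    have \<epsilon>S: "\<epsilon> (Suc n) \<le> \<epsilon> n" by (simp add: \<epsilon>_def)
    have "d M > D - \<epsilon> n" using ym(3)[of n] ym(3)[of "Suc n"] \<epsilon>S by (auto simp: M_def min_def)
    have yM: "y n \<in> K M" "y (Suc n) \<in> K M"
      using ym(1) Kmono[of M "m n"] Kmono[of M "m (Suc n)"] by (auto simp: M_def)
    have "\<bar>prim a z x - H x\<bar> \<le> 1 / real (Suc M)" if x: "x \<in> {a..b}" for x
    proof -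
      have "prim a z x = (1/2) * (prim a (y (Suc n)) x + prim a (y n) x)"
        unfolding z_def prim_cmult using prim_add[OF L2_on_imp_L1_on[OF yL] L2_on_imp_L1_on[OF yL]] x by auto
      moreover have "\<bar>prim a (y (Suc n)) x - H x\<bar> \<le> 1 / real (Suc M)" "\<bar>prim a (y n) x - H x\<bar> \<le> 1 / real (Suc M)"
        using yM x by (auto simp: K_def)
      ultimately show ?thesis by (simp only: abs_le_iff) argo
    qed
    moreover have "L2_on {a<..<b} z" unfolding z_def by (rule L2_on_cmult[OF L2_on_add[OF yL yL]])
    ultimately have "z \<in> K M" by (simp add: K_def)
    then have "D - \<epsilon> n < sqn a b z" using dle \<open>d M > D - \<epsilon> n\<close> by fastforce
    also have "sqn a b z = (1/4) * sqn a b (\<lambda>x. y (Suc n) x + y n x)"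
      unfolding z_def sqn_cmult by (simp add: power2_eq_square)
    finally have "4 * (D - \<epsilon> n) \<le> sqn a b (\<lambda>x. y (Suc n) x + y n x)" by simp
    then have "sqn a b (\<lambda>x. y (Suc n) x - y n x) \<le> 8 * \<epsilon> n"
    proof -
      have arith: "q \<le> 8 * e" if "4 * (D - e) \<le> p" "q + p = 2 * s + 2 * t" "t \<le> D + e" "s \<le> D + e'" "e' \<le> e"
        for p q s t e e' :: real using that by argo
      show ?thesis using \<open>4 * (D - \<epsilon> n) \<le> sqn a b (\<lambda>x. y (Suc n) x + y n x)\<close>
        by (rule arith[OF _ sqn_parallelogram[OF yL yL] ym(4) ym(4) \<epsilon>S])
    qed
    then show ?thesis by (simp add: \<epsilon>_def)
  qed
  have "\<epsilon> \<longlonglongrightarrow> 0" unfolding \<epsilon>_def using LIMSEQ_power_zero[of "1/4::real"] tendsto_divide_zero by fastforce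
  then have qlim: "(\<lambda>n. D + \<epsilon> n) \<longlonglongrightarrow> D" using tendsto_add[OF tendsto_const[of D]] by fastforce
  obtain g where g: "L2_on {a<..<b} g" "sqn a b g \<le> D"
    "\<And>x. x \<in> {a..b} \<Longrightarrow> (\<lambda>n. prim a (y n) x) \<longlonglongrightarrow> prim a g x"
    using L2_Cauchy_limit[OF ab yL step ym(4) qlim] by blast
  show ?thesis
  proof (rule that[OF g(1)])
    fix x assume x: "x \<in> {a..b}"
    have "(\<lambda>n. prim a (y n) x - H x) \<longlonglongrightarrow> 0"
    proof (rule Lim_null_comparison[OF _ LIMSEQ_inverse_real_of_nat])
      have "\<bar>prim a (y n) x - H x\<bar> \<le> inverse (real (Suc n))" for n
        using Kmono[OF ym(2)[of n]] ym(1)[of n] x by (auto simp: K_def inverse_eq_divide)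
      then show "\<forall>\<^sub>F n in sequentially. norm (prim a (y n) x - H x) \<le> inverse (real (Suc n))" by simp
    qed
    then have "(\<lambda>n. prim a (y n) x) \<longlonglongrightarrow> H x" by (simp add: LIM_zero_iff)
    then show "prim a g x = H x" using g(3)[OF x] LIMSEQ_unique by blast
  next
    fix c assume c: "\<And>N. \<exists>k\<ge>N. sqn a b (h k) \<le> c"
    have "D \<le> c" by (rule LIMSEQ_le_const2[OF D(1)]) (use dc[OF c] in auto)
    then show "sqn a b g \<le> c" using g(2) by linarith
  qed
qed

section \<open>Compactness\<close>

lemma constant_subsequence:
  fixes f :: "nat \<Rightarrow> 'a"
  assumes "finite F" "\<And>k. f k \<in> F"
  obtains r c where "strict_mono (r :: nat \<Rightarrow> nat)" "\<And>k. f (r k) = c"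
proof -
  have "finite (f ` UNIV)" using assms finite_subset[of "range f" F] by blast
  then obtain k0 where k0: "infinite {k \<in> UNIV. f k = f k0}"
    using pigeonhole_infinite[of UNIV f] by auto
  then obtain r where "strict_mono (r :: nat \<Rightarrow> nat)" "\<And>k. r k \<in> {k \<in> UNIV. f k = f k0}"
    using infinite_enumerate by blast
  then show ?thesis using that[of r "f k0"] by auto
qed

lemma convergent_subsequence_family:
  fixes x :: "nat \<Rightarrow> nat \<Rightarrow> real"
  assumes "\<And>i. i < N \<Longrightarrow> Bseq (x i)"
  obtains r l where "strict_mono (r :: nat \<Rightarrow> nat)" "\<And>i. i < N \<Longrightarrow> (\<lambda>k. x i (r k)) \<longlonglongrightarrow> l i"
proof -
  have "\<exists>r l. strict_mono (r :: nat \<Rightarrow> nat) \<and> (\<forall>i<N. (\<lambda>k. x i (r k)) \<longlonglongrightarrow> l i)"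
    using assms
  proof (induction N)
    case 0
    show ?case by (intro exI[of _ id]) (auto simp: strict_mono_def)
  next
    case (Suc N)
    then obtain r l where r: "strict_mono r" "\<And>i. i < N \<Longrightarrow> (\<lambda>k. x i (r k)) \<longlonglongrightarrow> l i"
      by (metis less_Suc_eq)
    have "Bseq (\<lambda>k. x N (r k))" using Bseq_subseq[OF Suc.prems[of N]] by simp
    then obtain l' r' where r': "strict_mono r'" "((\<lambda>k. x N (r k)) \<circ> r') \<longlonglongrightarrow> l'"
      using bounded_imp_convergent_subsequence[of "\<lambda>k. x N (r k)"] unfolding Bseq_eq_bounded by blast
    show ?case
    proof (intro exI conjI allI impI)
      show "strict_mono (r \<circ> r')" using r r' by (simp add: strict_mono_o)
      fix i assume "i < Suc N"
      then consider "i < N" | "i = N" by linarith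
      then show "(\<lambda>k. x i ((r \<circ> r') k)) \<longlonglongrightarrow> (l(N := l')) i"
      proof cases
        case 1
        then show ?thesis using LIMSEQ_subseq_LIMSEQ[OF r(2) r'(1)] by (auto simp: o_def)
      next
        case 2
        then show ?thesis using r' by (simp add: o_def)
      qed
    qed
  qed
  then show ?thesis using that by blast
qed

text \<open>Limits of knots may coincide, whereas \<open>partition\<close> asks for strict increase.
  The relation \<open>R\<close> transports what is known on the nondegenerate pieces to the shorter
  list of knots.\<close>

lemma compress_partition:
  fixes s :: "nat \<Rightarrow> real"
  assumes "s 0 < s n" "\<And>i. i < n \<Longrightarrow> s i \<le> s (Suc i) \<and> (s i < s (Suc i) \<longrightarrow> R (s i) (s (Suc i)))"
  shows "\<exists>m t. partition m t (s 0) (s n) \<and> (\<forall>i<m. R (t i) (t (Suc i)))"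
  using assms
proof (induction n)
  case (Suc n)
  have le: "s n \<le> s (Suc n)" "s n < s (Suc n) \<longrightarrow> R (s n) (s (Suc n))" using Suc.prems(2)[of n] by auto
  have "s 0 \<le> s n"
  proof -
    have "s 0 \<le> s i" if "i \<le> n" for i
      using that by (induction i) (use Suc.prems(2) in \<open>auto intro: order_trans simp: Suc_le_eq\<close>)
    then show ?thesis by simp
  qed
  then consider "s n = s (Suc n)" | "s 0 = s n" "s n < s (Suc n)" | "s 0 < s n" "s n < s (Suc n)"
    using le by linarith
  then show ?case
  proof cases
    case 1
    then show ?thesis using Suc by auto
  next
    case 2
    then show ?thesis
      using le by (intro exI[of _ 1] exI[of _ "\<lambda>i. if i = 0 then s 0 else s (Suc n)"]) (auto simp: partition_def)
  next
    case 3
    then obtain m t where t: "partition m t (s 0) (s n)" "\<forall>i<m. R (t i) (t (Suc i))"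
      using Suc by (metis less_SucI)
    show ?thesis
      by (intro exI[of _ "Suc m"] exI[of _ "t(Suc m := s (Suc n))"])
        (use t 3 le in \<open>auto simp: partition_def less_Suc_eq\<close>)
  qed
qed simp

text \<open>Integrates |h| \<le> T + h^2 / T. With the norms bounded, a large \<open>T\<close> makes
  the second term small, after which y - x can be taken small: this is the equicontinuity of the
  primitives.\<close>

lemma prim_modulus:
  assumes L2: "L2_on {a<..<b} h" and T: "0 < T" and xy: "a \<le> x" "x \<le> y" "y \<le> b"
  shows "\<bar>prim a h y - prim a h x\<bar> \<le> T * (y - x) + sqn a b h / T"
proof -
  have hi: "L1_on {a..b} h" by (rule L2_on_imp_L1_on[OF L2])
  have h2: "L1_on {a..b} (\<lambda>x. (h x)\<^sup>2)"
    using L2 by (simp add: L2_on_def L1_on_Ioo_iff_Icc)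
  have h2xy: "(\<lambda>x. (h x)\<^sup>2) integrable_on {x..y}" by (rule L1_on_imp_HK[OF L1_on_subset[OF h2]]) (use xy in auto)
  have le: "integral {x..y} (\<lambda>x. (h x)\<^sup>2) \<le> sqn a b h"
    unfolding sqn_def L1_on_Ioo_integral[OF h2]
    by (rule Henstock_Kurzweil_Integration.integral_subset_le[OF _ h2xy L1_on_imp_HK[OF h2]]) (use xy in auto)
  have "norm (integral {x..y} h) \<le> integral {x..y} (\<lambda>t. T + (h t)\<^sup>2 / T)"
  proof (rule integral_norm_bound_integral)
    show "h integrable_on {x..y}" by (rule L1_on_imp_HK[OF L1_on_subset[OF hi]]) (use xy in auto)
    show "(\<lambda>t. T + (h t)\<^sup>2 / T) integrable_on {x..y}"
      by (intro integrable_add integrable_const_ivl integrable_on_divide h2xy)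
    fix t
    show "norm (h t) \<le> T + (h t)\<^sup>2 / T"
    proof (cases "\<bar>h t\<bar> \<le> T")
      case True
      then show ?thesis using T by (simp add: add_increasing2)
    next
      case False
      then have "\<bar>h t\<bar> * T \<le> \<bar>h t\<bar> * \<bar>h t\<bar>" by (intro mult_left_mono) auto
      then have "\<bar>h t\<bar> \<le> (h t)\<^sup>2 / T" using T by (simp add: field_simps power2_eq_square)
      then show ?thesis using T by simp
    qed
  qed
  also have "\<dots> = T * (y - x) + integral {x..y} (\<lambda>x. (h x)\<^sup>2) / T"
    using xy by (subst HK_integral_add) (auto intro: integrable_const_ivl integrable_on_divide h2xy simp: mult.commute)
  also have "\<dots> \<le> T * (y - x) + sqn a b h / T" using le T by (simp add: divide_right_mono)
  finally show ?thesis using prim_diff[OF hi xy] by simp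
qed

lemma prim_diff_bound:
  assumes "continuous_on {a..b} p" "continuous_on {a..b} q" "\<And>x. x \<in> {a..b} \<Longrightarrow> \<bar>p x - q x\<bar> \<le> e" "x \<in> {a..b}"
  shows "\<bar>prim a p x - prim a q x\<bar> \<le> e * (b - a)"
proof -
  have i: "p integrable_on {a..x}" "q integrable_on {a..x}"
    using assms by (auto intro!: integrable_continuous_real intro: continuous_on_subset)
  have e0: "0 \<le> e" using assms(3)[OF assms(4)] by linarith
  have "prim a p x - prim a q x = integral {a..x} (\<lambda>t. p t - q t)"
    unfolding prim_def using i by (simp add: Henstock_Kurzweil_Integration.integral_diff)
  also have "norm \<dots> \<le> integral {a..x} (\<lambda>t. e)"
    by (rule integral_norm_bound_integral) (use i assms in \<open>auto intro: integrable_diff integrable_const_ivl\<close>)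
  also have "\<dots> = e * (x - a)" using assms(4) by simp
  also have "\<dots> \<le> e * (b - a)" using assms(4) e0 by (intro mult_left_mono) auto
  finally show ?thesis by simp
qed

text \<open>Expanded around the midpoint, the constant and the linear part are orthogonal on [c,d].
  The integral is thus a sum of two nonnegative terms, each controlling one coefficient.\<close>

lemma affine_sq_integral:
  fixes A B :: real
  assumes "c \<le> d"
  shows "integral {c..d} (\<lambda>x. (A + B * x)\<^sup>2) = (d - c) * (A + B * ((c + d) / 2))\<^sup>2 + B\<^sup>2 * (d - c)^3 / 12"
proof -
  have "((\<lambda>x. (A + B * x)\<^sup>2) has_integral (A\<^sup>2 * d + A * B * d\<^sup>2 + B\<^sup>2 * d^3 / 3) - (A\<^sup>2 * c + A * B * c\<^sup>2 + B\<^sup>2 * c^3 / 3)) {c..d}"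
    by (rule fundamental_theorem_of_calculus[OF assms])
      (auto simp: has_real_derivative_iff_has_vector_derivative[symmetric] power2_eq_square power3_eq_cube algebra_simps
        intro!: derivative_eq_intros)
  then show ?thesis
    by (simp add: integral_unique) (simp add: power2_eq_square power3_eq_cube field_simps)
qed

text \<open>The affine part is \<open>v - dprim a h\<close>, whose square is at most 2 v^2 + 2 D^2;
  the factor 12 and the cube are those of the exact integral of a squared affine function.\<close>

lemma affine_coefficients_bounded:
  assumes aff: "affine_on a h v c d A B" and v: "L2_on {a<..<b} v" and h: "L2_on {a<..<b} h"
    and D: "\<And>x. x \<in> {a..b} \<Longrightarrow> \<bar>dprim a h x\<bar> \<le> D"
    and cd: "a \<le> c" "c < d" "d \<le> b"
  defines "M \<equiv> 2 * sqn a b v + 2 * D\<^sup>2 * (b - a)"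
  shows "B\<^sup>2 \<le> 12 * M / (d - c)^3" "(A + B * ((c + d) / 2))\<^sup>2 \<le> M / (d - c)"
proof -
  have ab: "a < b" using cd by auto
  have v2: "L1_on {a..b} (\<lambda>x. (v x)\<^sup>2)"
    using v by (simp add: L2_on_def L1_on_Ioo_iff_Icc)
  have v2cd: "L1_on {c..d} (\<lambda>x. (v x)\<^sup>2)" by (rule L1_on_subset[OF v2]) (use cd in auto)
  have le: "integral {c..d} (\<lambda>x. (v x)\<^sup>2) \<le> sqn a b v"
    unfolding sqn_def L1_on_Ioo_integral[OF v2]
    by (rule Henstock_Kurzweil_Integration.integral_subset_le[OF _ L1_on_imp_HK[OF v2cd] L1_on_imp_HK[OF v2]]) (use cd in auto)
  have ia: "L1_on {c<..<d} (\<lambda>x. (A + B * x)\<^sup>2)"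
    unfolding L1_on_Ioo_iff_Icc by (intro L1_on_continuous continuous_intros)
  have ib: "L1_on {c..d} (\<lambda>x. 2 * (v x)\<^sup>2 + 2 * D\<^sup>2)"
    by (intro set_integral_add set_integrable_mult_right v2cd L1_on_continuous continuous_intros)
  have "integral {c..d} (\<lambda>x. (A + B * x)\<^sup>2) = (LINT x:{c<..<d}|lebesgue. (A + B * x)\<^sup>2)"
    using ia L1_on_Ioo_integral by (metis L1_on_Ioo_iff_Icc)
  also have "\<dots> \<le> (LINT x:{c<..<d}|lebesgue. 2 * (v x)\<^sup>2 + 2 * D\<^sup>2)"
    unfolding set_lebesgue_integral_def
  proof (rule integral_mono_AE)
    show "integrable lebesgue (\<lambda>x. indicat_real {c<..<d} x *\<^sub>R (A + B * x)\<^sup>2)"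
      "integrable lebesgue (\<lambda>x. indicat_real {c<..<d} x *\<^sub>R (2 * (v x)\<^sup>2 + 2 * D\<^sup>2))"
      using ia ib[unfolded L1_on_Ioo_iff_Icc[symmetric]] unfolding set_integrable_def .
    show "AE x in lebesgue. indicat_real {c<..<d} x *\<^sub>R (A + B * x)\<^sup>2 \<le> indicat_real {c<..<d} x *\<^sub>R (2 * (v x)\<^sup>2 + 2 * D\<^sup>2)"
      using aff unfolding affine_on_def
    proof eventually_elim
      case (elim x)
      have sq: "(p - q)\<^sup>2 \<le> 2 * p\<^sup>2 + 2 * q\<^sup>2" for p q :: real
        using zero_le_power2[of "p + q"] by (simp add: power2_eq_square algebra_simps)
      have "(A + B * x)\<^sup>2 \<le> 2 * (v x)\<^sup>2 + 2 * D\<^sup>2" if x: "x \<in> {c<..<d}"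
      proof -
        have "(A + B * x)\<^sup>2 = (v x - dprim a h x)\<^sup>2" using elim x by simp
        also have "\<dots> \<le> 2 * (v x)\<^sup>2 + 2 * (dprim a h x)\<^sup>2" by (rule sq)
        also have "(dprim a h x)\<^sup>2 \<le> D\<^sup>2"
          using D[of x] x cd by (intro abs_le_square_iff[THEN iffD1]) auto
        finally show ?thesis by simp
      qed
      then show ?case by (auto simp: indicator_def)
    qed
  qed
  also have "\<dots> = integral {c..d} (\<lambda>x. 2 * (v x)\<^sup>2 + 2 * D\<^sup>2)" by (rule L1_on_Ioo_integral[OF ib])
  also have "\<dots> = 2 * integral {c..d} (\<lambda>x. (v x)\<^sup>2) + 2 * D\<^sup>2 * (d - c)"
    using L1_on_imp_HK[OF v2cd] cd by (subst HK_integral_add) (auto intro!: integrable_on_cmult_left)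
  also have "\<dots> \<le> M"
    unfolding M_def using le cd by (intro add_mono mult_left_mono) auto
  finally have *: "(d - c) * (A + B * ((c + d) / 2))\<^sup>2 + B\<^sup>2 * (d - c)^3 / 12 \<le> M"
    using affine_sq_integral[of c d A B] cd by simp
  have "0 \<le> (d - c) * (A + B * ((c + d) / 2))\<^sup>2" "0 \<le> B\<^sup>2 * (d - c)^3 / 12" using cd by auto
  then have "B\<^sup>2 * (d - c)^3 \<le> 12 * M" "(A + B * ((c + d) / 2))\<^sup>2 * (d - c) \<le> M"
    using * by (simp_all add: mult.commute)
  then show "B\<^sup>2 \<le> 12 * M / (d - c)^3" "(A + B * ((c + d) / 2))\<^sup>2 \<le> M / (d - c)"
    using cd by (simp_all add: pos_le_divide_eq)
qed

lemma Bseq_eventuallyI: "\<forall>\<^sub>F k in sequentially. \<bar>x k\<bar> \<le> (M::real) \<Longrightarrow> Bseq x"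
  by (rule BfunI[where K = M]) simp

lemma prim_uniform_subsequence:
  assumes ab: "a < b" and h: "\<And>k. L2_on {a<..<b} (h k)" and C: "\<And>k. sqn a b (h k) \<le> C"
  obtains r H where "strict_mono (r :: nat \<Rightarrow> nat)"
    "\<And>e. 0 < e \<Longrightarrow> \<exists>N. \<forall>k\<ge>N. \<forall>x\<in>{a..b}. \<bar>prim a (h (r k)) x - H x\<bar> \<le> e"
proof -
  have C0: "0 \<le> C" using sqn_nonneg[of a b "h 0"] C[of 0] by linarith
  have mod: "\<bar>prim a (h k) y - prim a (h k) x\<bar> \<le> T * \<bar>y - x\<bar> + C / T"
    if "0 < T" "x \<in> {a..b}" "y \<in> {a..b}" for k x y T
  proof -
    have "sqn a b (h k) / T \<le> C / T" using C that by (simp add: divide_right_mono)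
    then show ?thesis
      using prim_modulus[OF h[of k] that(1), of x y] prim_modulus[OF h[of k] that(1), of y x] that
      by (cases "x \<le> y") (auto simp: abs_minus_commute)
  qed
  have bound: "norm (prim a (h k) x) \<le> (b - a) + C" if "x \<in> {a..b}" for k x
    using mod[of 1 a x k] that ab by auto
  have equi: "\<exists>d. 0 < d \<and> (\<forall>n y. y \<in> {a..b} \<and> norm (x - y) < d \<longrightarrow> norm (prim a (h n) x - prim a (h n) y) < e)"
    if "x \<in> {a..b}" "0 < e" for x e
  proof (intro exI conjI allI impI)
    \<comment> \<open>Makes C / T \<le> e / 4, and the radius e / (2 T) makes the linear term less
      than e / 2; \<open>C + 1\<close> avoids a zero when C = 0.\<close>
    define T where "T = 4 * (C + 1) / e"
    have T: "0 < T" using C0 that by (simp add: T_def)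
    show "0 < e / (2 * T)" using T that by simp
    fix n y assume y: "y \<in> {a..b} \<and> norm (x - y) < e / (2 * T)"
    have "\<bar>prim a (h n) x - prim a (h n) y\<bar> \<le> T * \<bar>x - y\<bar> + C / T"
      using mod[OF T] that y by auto
    also have "T * \<bar>x - y\<bar> < T * (e / (2 * T))"
      using y T by (intro mult_strict_left_mono) auto
    also have "T * (e / (2 * T)) = e / 2" using T by simp
    also have "C / T \<le> e / 4"
    proof -
      have "C / T = e / 4 * (C / (C + 1))" using C0 that by (simp add: T_def field_simps)
      also have "\<dots> \<le> e / 4 * 1" using C0 that by (intro mult_left_mono) auto
      finally show ?thesis by simp
    qed
    finally show "norm (prim a (h n) x - prim a (h n) y) < e" using that by simp
  qed
  show ?thesis
  proof (rule Arzela_Ascoli[of "{a..b}" "\<lambda>k. prim a (h k)" "(b - a) + C", OF compact_Icc bound equi])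
    fix H r assume r: "strict_mono (r :: nat \<Rightarrow> nat)"
      and N: "\<And>e. 0 < e \<Longrightarrow> \<exists>N. \<forall>n x. n \<ge> N \<and> x \<in> {a..b} \<longrightarrow> norm (prim a (h (r n)) x - H x) < e"
    show thesis
    proof (rule that[OF r])
      fix e :: real assume "0 < e"
      from N[OF this] obtain N where "\<forall>n x. n \<ge> N \<and> x \<in> {a..b} \<longrightarrow> norm (prim a (h (r n)) x - H x) < e" ..
      then show "\<exists>N. \<forall>k\<ge>N. \<forall>x\<in>{a..b}. \<bar>prim a (h (r k)) x - H x\<bar> \<le> e"
        by (intro exI[of _ N]) (auto intro: less_imp_le)
    qed
  qed
qed

lemma dprim_bound:
  assumes ab: "a < b" and h: "L2_on {a<..<b} h" and C: "sqn a b h \<le> C" and x: "x \<in> {a..b}"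
  shows "\<bar>dprim a h x\<bar> \<le> ((b - a) + C) * (b - a)"
proof -
  have hi: "L1_on {a..b} h" by (rule L2_on_imp_L1_on[OF h])
  have "\<bar>prim a h y - 0\<bar> \<le> (b - a) + C" if "y \<in> {a..b}" for y
    using prim_modulus[OF h zero_less_one, of a y] that C by auto
  from prim_diff_bound[OF continuous_on_prim[OF hi] continuous_on_const this x]
  show ?thesis by (simp add: dprim_def prim_def[of a "\<lambda>_. 0"])
qed

lemma partition_limit_pieces:
  assumes "\<And>k. nform a b (h k) n (s k) (A k) (B k) (v k)" and "i < n"
    and "(\<lambda>k. s k i) \<longlonglongrightarrow> p" "(\<lambda>k. s k (Suc i)) \<longlonglongrightarrow> q" "p < c" "d < q"
  shows "\<forall>\<^sub>F k in sequentially. affine_on a (h k) (v k) c d (A k i) (B k i)"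
proof -
  have "\<forall>\<^sub>F k in sequentially. s k i < c" "\<forall>\<^sub>F k in sequentially. d < s k (Suc i)"
    using order_tendstoD assms by blast+
  then show ?thesis
  proof eventually_elim
    case (elim k)
    have "affine_on a (h k) (v k) (s k i) (s k (Suc i)) (A k i) (B k i)"
      using assms(1)[of k] assms(2) by (simp add: nform_def)
    then show ?case by (rule affine_on_subset) (use elim in auto)
  qed
qed

text \<open>Coefficients on pieces that collapse in the limit may be unbounded; they are ignored.\<close>

lemma coefficients_Bseq:
  assumes nf: "\<And>k. nform a b (h k) n (s k) (A k) (B k) (v k)" and i: "i < n"
    and lim: "(\<lambda>k. s k i) \<longlonglongrightarrow> p" "(\<lambda>k. s k (Suc i)) \<longlonglongrightarrow> q" and pq: "p < q" "a \<le> p" "q \<le> b"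
    and h: "\<And>k. sqn a b (h k) \<le> C" and v: "\<And>k. L2_on {a<..<b} (v k)" "\<And>k. sqn a b (v k) \<le> C"
  shows "Bseq (\<lambda>k. A k i)" "Bseq (\<lambda>k. B k i)"
proof -
  \<comment> \<open>The middle third of the limit piece lies inside the i-th piece of all but
    finitely many partitions, and its length does not depend on k.\<close>
  define c d where "c = p + (q - p) / 3" and "d = q - (q - p) / 3"
  have cd: "p < c" "c < d" "d < q" "a \<le> c" "d \<le> b" "a < b" using pq by (auto simp: c_def d_def field_simps)
  define D where "D = ((b - a) + C) * (b - a)"
  define M where "M = 2 * C + 2 * D\<^sup>2 * (b - a)"
  have hL: "L2_on {a<..<b} (h k)" for k using nf[of k] by (simp add: nform_def)
  have "\<forall>\<^sub>F k in sequentially. (B k i)\<^sup>2 \<le> 12 * M / (d - c)^3 \<and> (A k i + B k i * ((c + d) / 2))\<^sup>2 \<le> M / (d - c)"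
    using partition_limit_pieces[OF nf i lim cd(1,3)]
  proof eventually_elim
    case (elim k)
    have "\<bar>dprim a (h k) x\<bar> \<le> D" if "x \<in> {a..b}" for x
      unfolding D_def by (rule dprim_bound[OF cd(6) hL h that])
    note * = affine_coefficients_bounded[OF elim v(1) hL this cd(4,2,5)]
    have le: "2 * sqn a b (v k) + 2 * D\<^sup>2 * (b - a) \<le> M" using v(2)[of k] by (simp add: M_def)
    have "12 * (2 * sqn a b (v k) + 2 * D\<^sup>2 * (b - a)) / (d - c)^3 \<le> 12 * M / (d - c)^3"
      "(2 * sqn a b (v k) + 2 * D\<^sup>2 * (b - a)) / (d - c) \<le> M / (d - c)"
      using le cd by (intro divide_right_mono; simp)+
    then show ?case using * by linarith
  qed
  then have ev: "\<forall>\<^sub>F k in sequentially. \<bar>B k i\<bar> \<le> sqrt (12 * M / (d - c)^3) \<and>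
      \<bar>A k i + B k i * ((c + d) / 2)\<bar> \<le> sqrt (M / (d - c))"
    by eventually_elim (auto intro: real_le_rsqrt)
  then show "Bseq (\<lambda>k. B k i)" by (intro Bseq_eventuallyI) (auto elim: eventually_mono)
  have "\<forall>\<^sub>F k in sequentially. \<bar>A k i\<bar> \<le> sqrt (M / (d - c)) + sqrt (12 * M / (d - c)^3) * \<bar>(c + d) / 2\<bar>"
    using ev
  proof eventually_elim
    case (elim k)
    have "\<bar>A k i\<bar> \<le> \<bar>A k i + B k i * ((c + d) / 2)\<bar> + \<bar>B k i\<bar> * \<bar>(c + d) / 2\<bar>"
      unfolding abs_mult[symmetric] by linarith
    also have "\<dots> \<le> sqrt (M / (d - c)) + sqrt (12 * M / (d - c)^3) * \<bar>(c + d) / 2\<bar>"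
      using elim by (intro add_mono mult_right_mono) auto
    finally show ?case .
  qed
  then show "Bseq (\<lambda>k. A k i)" by (rule Bseq_eventuallyI)
qed

text \<open>Knots collapsing to one point pay at least as much as the resulting singularity, since
  \<open>\<alpha> \<le> 2\<beta>\<close>.\<close>

lemma merged_cost_le:
  fixes p :: "nat \<Rightarrow> real"
  assumes ab: "0 < \<beta>" "\<beta> \<le> \<alpha>" "\<alpha> \<le> 2 * \<beta>" and I: "finite I" "J \<subseteq> I"
    and S: "S \<union> S' \<subseteq> p ` I"
    and single: "\<And>j. j \<in> I - J \<Longrightarrow> {i\<in>I. p i = p j} = {j} \<Longrightarrow> p j \<notin> S"
  shows "\<alpha> * real (card S) + \<beta> * real (card (S' - S)) \<le> \<alpha> * real (card J) + \<beta> * real (card (I - J))"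
proof -
  \<comment> \<open>Each knot carries its own price, and \<open>W q\<close> collects the prices of
    all knots sitting at \<open>q\<close>; regrouping by position reduces the claim to single
    points.\<close>
  define w where "w j = (if j \<in> J then \<alpha> else \<beta>)" for j
  have w: "\<beta> \<le> w j" "0 \<le> w j" for j using ab by (auto simp: w_def)
  define W where "W q = (\<Sum>j\<in>{j\<in>I. p j = q}. w j)" for q
  have finS: "finite S" "finite (S' - S)" using S I finite_subset[of _ "p ` I"] by auto
  have W\<alpha>: "\<alpha> \<le> W q" if q: "q \<in> S" for q
  proof -
    have ge: "w j \<le> W q" if "j \<in> I" "p j = q" for j
      unfolding W_def using that I w by (intro member_le_sum) auto
    obtain j where j: "j \<in> I" "p j = q" using S q by blast
    show ?thesis
    proof (cases "\<exists>j\<in>J. p j = q")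
      case True
      then show ?thesis using ge I by (force simp: w_def)
    next
      case False
      then have "j \<in> I - J" using j by auto
      with single[OF this] j q have "{i\<in>I. p i = q} \<noteq> {j}" by auto
      then obtain i where i: "i \<in> I" "p i = q" "i \<noteq> j" using j by blast
      have "\<alpha> \<le> w i + w j" using w(1)[of i] w(1)[of j] ab by linarith
      also have "\<dots> = (\<Sum>j\<in>{i,j}. w j)" using i by simp
      also have "\<dots> \<le> W q" unfolding W_def using i j I w by (intro sum_mono2) auto
      finally show ?thesis .
    qed
  qed
  have W\<beta>: "\<beta> \<le> W q" if q: "q \<in> S' - S" for q
  proof -
    obtain j where j: "j \<in> I" "p j = q" using S q by blast
    have "w j \<le> W q" unfolding W_def using j I w by (intro member_le_sum) auto
    then show ?thesis using w(1)[of j] by linarith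
  qed
  have "\<alpha> * real (card S) + \<beta> * real (card (S' - S)) = (\<Sum>q\<in>S. \<alpha>) + (\<Sum>q\<in>S' - S. \<beta>)" by simp
  also have "\<dots> \<le> (\<Sum>q\<in>S. W q) + (\<Sum>q\<in>S' - S. W q)"
    by (intro add_mono sum_mono W\<alpha> W\<beta>)
  also have "\<dots> = (\<Sum>q\<in>S \<union> (S' - S). W q)"
    using finS by (intro sum.union_disjoint[symmetric]) auto
  also have "\<dots> \<le> (\<Sum>q\<in>p ` I. W q)"
    using S I w by (intro sum_mono2) (auto simp: W_def intro: sum_nonneg)
  also have "\<dots> = (\<Sum>j\<in>I. w j)"
    unfolding W_def by (rule sum.image_gen[OF I(1), symmetric])
  also have "\<dots> = \<alpha> * real (card J) + \<beta> * real (card (I - J))"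
  proof -
    have "(\<Sum>j\<in>I. w j) = (\<Sum>j\<in>J. w j) + (\<Sum>j\<in>I - J. w j)"
      using I by (metis sum.subset_diff add.commute)
    also have "(\<Sum>j\<in>J. w j) = \<alpha> * real (card J)" by (simp add: w_def)
    also have "(\<Sum>j\<in>I - J. w j) = \<beta> * real (card (I - J))" by (simp add: w_def)
    finally show ?thesis .
  qed
  finally show ?thesis .
qed

text \<open>The two counting terms as real numbers. \<open>card\<close> is 0 on infinite sets, but
  both sets are finite for every function with a normal form.\<close>

definition singular_cost :: "real \<Rightarrow> real \<Rightarrow> real \<Rightarrow> real \<Rightarrow> (real \<Rightarrow> real) \<Rightarrow> real" where
  "singular_cost a b \<alpha> \<beta> v = \<alpha> * real (card (discontinuity_set a b v)) +
     \<beta> * real (card (discontinuity_set a b (ac_derivative a b v) - discontinuity_set a b v))"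

text \<open>The knots in \<open>J\<close> are charged as jumps, those outside \<open>J\<close> are
  creases for all k. Thresholds \<open>c\<close> reached infinitely often express that the squared
  norm of \<open>g\<close> is at most the lower limit of the others.\<close>

lemma nform_compactness:
  fixes h v :: "nat \<Rightarrow> real \<Rightarrow> real"
  assumes ab: "a < b" and nf: "\<And>k. nform a b (h k) n (s k) (A k) (B k) (v k)"
    and J: "J \<subseteq> {1..<n}" "\<forall>j\<in>{1..<n} - J. \<forall>k. A k (j - 1) + B k (j - 1) * s k j = A k j + B k j * s k j"
    and C: "\<And>k. sqn a b (h k) \<le> C" "\<And>k. sqn a b (v k) \<le> C"
    and \<alpha>\<beta>: "0 < \<beta>" "\<beta> \<le> \<alpha>" "\<alpha> \<le> 2 * \<beta>"
  shows "\<exists>r u g m t A' B'. strict_mono (r :: nat \<Rightarrow> nat) \<and> nform a b g m t A' B' u \<and>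
    (AE x\<in>{a<..<b} in lebesgue. (\<lambda>k. v (r k) x) \<longlonglongrightarrow> u x) \<and>
    (\<forall>c. (\<forall>N. \<exists>k\<ge>N. sqn a b (h (r k)) \<le> c) \<longrightarrow> sqn a b g \<le> c) \<and>
    singular_cost a b \<alpha> \<beta> u \<le> \<alpha> * real (card J) + \<beta> * real (card ({1..<n} - J))"
proof -
  have part: "partition n (s k) a b" and hL: "L2_on {a<..<b} (h k)" for k
    using nf[of k] by (auto simp: nform_def)
  have vL: "L2_on {a<..<b} (v k)" for k by (rule piecewise_H2_imp_L2_on[OF nform_imp_piecewise_H2[OF nf]])
  have "Bseq (\<lambda>k. s k i)" if "i < Suc n" for i
    using partition_bounds[OF part, of i] that
    by (intro Bseq_eventuallyI[of _ "max \<bar>a\<bar> \<bar>b\<bar>"] always_eventually) (auto simp: abs_le_iff max_def, (smt (verit))+)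
  then obtain r1 p where r1: "strict_mono (r1 :: nat \<Rightarrow> nat)" "\<And>i. i < Suc n \<Longrightarrow> (\<lambda>k. s (r1 k) i) \<longlonglongrightarrow> p i"
    using convergent_subsequence_family[of "Suc n" "\<lambda>i k. s k i"] by blast
  obtain r2 H where r2: "strict_mono (r2 :: nat \<Rightarrow> nat)"
    "\<And>e. 0 < e \<Longrightarrow> \<exists>N. \<forall>k\<ge>N. \<forall>x\<in>{a..b}. \<bar>prim a (h (r1 (r2 k))) x - H x\<bar> \<le> e"
    using prim_uniform_subsequence[of a b "\<lambda>k. h (r1 k)" C, OF ab hL C(1)] by blast
  define r12 where "r12 = r1 \<circ> r2"
  have s12: "(\<lambda>k. s (r12 k) i) \<longlonglongrightarrow> p i" if "i \<le> n" for i
    using LIMSEQ_subseq_LIMSEQ[OF r1(2) r2(1), of i] that by (simp add: r12_def o_def)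
  have p0: "p 0 = a" "p n = b"
    using LIMSEQ_unique[OF s12[of 0] tendsto_eventually[of _ a]] LIMSEQ_unique[OF s12[of n] tendsto_eventually[of _ b]] part
    by (auto simp: partition_def)
  have pmono: "p i \<le> p (Suc i)" if "i < n" for i
    by (rule LIMSEQ_le[OF s12[of i] s12[of "Suc i"]]) (use that part in \<open>auto simp: partition_def less_imp_le\<close>)
  have pbd: "a \<le> p i" "p i \<le> b" if "i \<le> n" for i
    using LIMSEQ_le_const[OF s12[OF that], of a] LIMSEQ_le_const2[OF s12[OF that], of b] partition_bounds[OF part that] by auto
  \<comment> \<open>Zero replaces the coefficients on collapsing pieces, so that subsequences can be
    extracted for all indices at once.\<close>
  define X where "X i k = (if p i < p (Suc i) then A (r12 k) i else 0)" for i k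
  define Y where "Y i k = (if p i < p (Suc i) then B (r12 k) i else 0)" for i k
  have "Bseq (X i) \<and> Bseq (Y i)" if i: "i < n" for i
  proof (cases "p i < p (Suc i)")
    case True
    then show ?thesis
      using coefficients_Bseq[of a b "\<lambda>k. h (r12 k)" n "\<lambda>k. s (r12 k)" "\<lambda>k. A (r12 k)" "\<lambda>k. B (r12 k)" "\<lambda>k. v (r12 k)" i "p i" "p (Suc i)" C,
          OF nf i s12 s12 True _ _ C(1) vL C(2)] i pbd by (simp add: X_def[abs_def] Y_def[abs_def])
  qed (simp add: X_def[abs_def] Y_def[abs_def] Bseq_def exI[of _ 1])
  then have XB: "\<And>i. i < n \<Longrightarrow> Bseq (X i)" and YB: "\<And>i. i < n \<Longrightarrow> Bseq (Y i)" by auto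
  obtain r3 Al where r3: "strict_mono (r3 :: nat \<Rightarrow> nat)" "\<And>i. i < n \<Longrightarrow> (\<lambda>k. X i (r3 k)) \<longlonglongrightarrow> Al i"
    using convergent_subsequence_family[of n X] XB by blast
  have YB': "Bseq (\<lambda>k. Y i (r3 k))" if "i < n" for i using Bseq_subseq[OF YB[OF that]] .
  obtain r4 Bl where r4: "strict_mono (r4 :: nat \<Rightarrow> nat)" "\<And>i. i < n \<Longrightarrow> (\<lambda>k. Y i (r3 (r4 k))) \<longlonglongrightarrow> Bl i"
    using convergent_subsequence_family[of n "\<lambda>i k. Y i (r3 k)"] YB' by blast
  define r34 where "r34 = r3 \<circ> r4"
  define r where "r = r12 \<circ> r34"
  have sm34: "strict_mono r34" using r3 r4 by (simp add: r34_def strict_mono_o)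
  have smr: "strict_mono r" unfolding r_def r12_def using r1 r2 sm34 by (intro strict_mono_o) auto
  have sl: "(\<lambda>k. s (r k) i) \<longlonglongrightarrow> p i" if "i \<le> n" for i
    using LIMSEQ_subseq_LIMSEQ[OF s12[OF that] sm34] by (simp add: r_def o_def)
  have Al: "(\<lambda>k. A (r k) i) \<longlonglongrightarrow> Al i" and Bl: "(\<lambda>k. B (r k) i) \<longlonglongrightarrow> Bl i" if "i < n" "p i < p (Suc i)" for i
    using LIMSEQ_subseq_LIMSEQ[OF r3(2)[OF that(1)] r4(1)] r4(2)[OF that(1)] that(2)
    by (simp_all add: X_def Y_def r_def r34_def o_def)
  have Hu: "\<exists>N. \<forall>k\<ge>N. \<forall>x\<in>{a..b}. \<bar>prim a (h (r k)) x - H x\<bar> \<le> e" if e: "0 < e" for e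
  proof -
    obtain N where N: "\<forall>k\<ge>N. \<forall>x\<in>{a..b}. \<bar>prim a (h (r1 (r2 k))) x - H x\<bar> \<le> e" using r2(2)[OF e] by blast
    have "N \<le> r34 k" if "N \<le> k" for k using seq_suble[OF sm34, of k] that by linarith
    then show ?thesis using N by (intro exI[of _ N]) (auto simp: r_def r12_def)
  qed
  obtain g where g: "L2_on {a<..<b} g" "\<And>x. x \<in> {a..b} \<Longrightarrow> prim a g x = H x"
    "\<And>c. (\<And>N. \<exists>k\<ge>N. sqn a b (h (r k)) \<le> c) \<Longrightarrow> sqn a b g \<le> c"
    using L2_weak_limit[of a b "\<lambda>k. h (r k)" C H, OF ab hL C(1) Hu] by blast
  have dl: "(\<lambda>k. dprim a (h (r k)) x) \<longlonglongrightarrow> dprim a g x" if x: "x \<in> {a..b}" for x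
  proof (rule LIMSEQ_I)
    fix e :: real assume "0 < e"
    then have "0 < e / (2 * (b - a))" using ab by simp
    from Hu[OF this] obtain N where N: "\<forall>k\<ge>N. \<forall>x\<in>{a..b}. \<bar>prim a (h (r k)) x - H x\<bar> \<le> e / (2 * (b - a))" by blast
    have "norm (dprim a (h (r k)) x - dprim a g x) < e" if "k \<ge> N" for k
    proof -
      have "\<bar>dprim a (h (r k)) x - dprim a g x\<bar> \<le> e / (2 * (b - a)) * (b - a)"
        unfolding dprim_def using N that g(2)
        by (intro prim_diff_bound continuous_on_prim L2_on_imp_L1_on hL g(1) x) auto
      also have "\<dots> = e / 2"
      proof -
        have "e / (2 * l) * l = e / 2" if "l \<noteq> 0" for l :: real using that by simp
        from this[of "b - a"] ab show ?thesis by linarith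
      qed
      finally show ?thesis using \<open>0 < e\<close> by simp
    qed
    then show "\<exists>N. \<forall>k\<ge>N. norm (dprim a (h (r k)) x - dprim a g x) < e" by blast
  qed
  \<comment> \<open>The values of \<open>lim\<close> where the sequence diverges are immaterial: it
    converges a.e., since the nondegenerate limit pieces cover (a,b) up to a null set.\<close>
  define u where "u x = lim (\<lambda>k. v (r k) x)" for x
  have "AE x in lebesgue. \<forall>k. \<forall>i\<in>{..<n}. x \<in> {s (r k) i<..<s (r k) (Suc i)} \<longrightarrow> v (r k) x = A (r k) i + B (r k) i * x + dprim a (h (r k)) x"
    unfolding AE_all_countable
    by (intro allI AE_finite_allI) (use nf in \<open>auto simp: nform_def affine_on_def\<close>)
  then have conv: "AE x in lebesgue. \<forall>i<n. x \<in> {p i<..<p (Suc i)} \<longrightarrow>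
      (\<lambda>k. v (r k) x) \<longlonglongrightarrow> Al i + Bl i * x + dprim a g x"
  proof eventually_elim
    case (elim x)
    show ?case
    proof (intro allI impI)
      fix i assume i: "i < n" and x: "x \<in> {p i<..<p (Suc i)}"
      have "\<forall>\<^sub>F k in sequentially. s (r k) i < x" "\<forall>\<^sub>F k in sequentially. x < s (r k) (Suc i)"
        using order_tendstoD(2)[OF sl[of i]] order_tendstoD(1)[OF sl[of "Suc i"]] i x by auto
      then have ev: "\<forall>\<^sub>F k in sequentially. A (r k) i + B (r k) i * x + dprim a (h (r k)) x = v (r k) x"
        by eventually_elim (use elim i in auto)
      have "x \<in> {a..b}" using pbd[of i] pbd[of "Suc i"] i x by auto
      then have "(\<lambda>k. A (r k) i + B (r k) i * x + dprim a (h (r k)) x) \<longlonglongrightarrow> Al i + Bl i * x + dprim a g x"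
        using Al[OF i] Bl[OF i] x dl by (intro tendsto_intros) auto
      then show "(\<lambda>k. v (r k) x) \<longlonglongrightarrow> Al i + Bl i * x + dprim a g x"
        by (rule Lim_transform_eventually[OF _ ev])
    qed
  qed
  have affu: "affine_on a g u (p i) (p (Suc i)) (Al i) (Bl i)" if "i < n" for i
    unfolding affine_on_def using conv by eventually_elim (use that in \<open>auto simp: u_def intro: limI\<close>)
  have "AE x\<in>{p 0<..<p n} in lebesgue. (\<exists>i<n. x \<in> {p i<..<p (Suc i)} \<and> True)"
    by (rule AE_pieces) simp
  with conv have vu: "AE x\<in>{a<..<b} in lebesgue. (\<lambda>k. v (r k) x) \<longlonglongrightarrow> u x"
    unfolding p0 by eventually_elim (metis u_def limI)
  \<comment> \<open>Coinciding limit knots are merged here; the coefficients on the remaining pieces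
    are those of the limit.\<close>
  have "\<exists>m t. partition m t (p 0) (p n) \<and> (\<forall>i<m. \<exists>A B. affine_on a g u (t i) (t (Suc i)) A B)"
    by (rule compress_partition) (use p0 ab pmono affu in auto)
  then obtain m t A' B' where nfu: "nform a b g m t A' B' u"
    unfolding p0 nform_def using g(1) by metis
  note du = nform_second_ac_derivative(1)[OF nfu ab]
  let ?S = "discontinuity_set a b u" and ?S' = "discontinuity_set a b (ac_derivative a b u)"
  have sub: "?S \<union> ?S' \<subseteq> p ` {1..<n}"
    using discontinuity_sets_subset_knots[OF du g(1) affu p0] pbd by auto
  \<comment> \<open>A knot alone at an interior point has nondegenerate limit pieces on both sides
    (the end knots stay at \<open>a\<close> and \<open>b\<close>). The coefficients on both sides
    converge, and the equality of the traces at \<open>s (r k) j\<close> passes to the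
    limit.\<close>
  have single: "p j \<notin> ?S" if j: "j \<in> {1..<n} - J" "{i\<in>{1..<n}. p i = p j} = {j}" for j
  proof
    assume S: "p j \<in> ?S"
    then have qab: "a < p j" "p j < b" by (auto simp: discontinuity_set_def)
    have jn: "1 \<le> j" "j < n" "j \<notin> J" using j by auto
    have "p (j - 1) \<noteq> p j"
    proof (cases "j = 1")
      case False
      then have "j - 1 \<in> {1..<n}" "j - 1 \<noteq> j" using jn by auto
      then show ?thesis using j(2) by blast
    qed (use qab p0 in auto)
    moreover have "p (j - 1) \<le> p j" using pmono[of "j - 1"] jn by (simp add: less_imp_diff_less)
    ultimately have l: "p (j - 1) < p j" by simp
    have "p (Suc j) \<noteq> p j"
    proof (cases "Suc j = n")
      case False
      then have "Suc j \<in> {1..<n}" "Suc j \<noteq> j" using jn by auto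
      then show ?thesis using j(2) by blast
    qed (use qab p0 in auto)
    then have r: "p j < p (Suc j)" using pmono[of j] jn by auto
    have "(\<lambda>k. A (r k) (j - 1) + B (r k) (j - 1) * s (r k) j) \<longlonglongrightarrow> Al (j - 1) + Bl (j - 1) * p j"
      using Al[of "j - 1"] Bl[of "j - 1"] jn l sl[of j] by (intro tendsto_intros) auto
    moreover have "(\<lambda>k. A (r k) j + B (r k) j * s (r k) j) \<longlonglongrightarrow> Al j + Bl j * p j"
      using Al[of j] Bl[of j] jn r sl[of j] by (intro tendsto_intros) auto
    ultimately have eq: "Al (j - 1) + Bl (j - 1) * p j = Al j + Bl j * p j"
      using J(2) j(1) LIMSEQ_unique by simp
    have "affine_on a g u (p (j - 1)) (p j) (Al (j - 1)) (Bl (j - 1))" "affine_on a g u (p j) (p (Suc j)) (Al j) (Bl j)"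
      using affu[of "j - 1"] affu[of j] jn by auto
    from affine_discontinuity_iff(1)[OF du g(1) _ l r _ this] pbd[of "j - 1"] pbd[of "Suc j"] jn S eq
    show False by auto
  qed
  have cost: "singular_cost a b \<alpha> \<beta> u \<le> \<alpha> * real (card J) + \<beta> * real (card ({1..<n} - J))"
    unfolding singular_cost_def
    by (rule merged_cost_le[OF \<alpha>\<beta> _ J(1) sub single]) auto
  have "\<forall>c. (\<forall>N. \<exists>k\<ge>N. sqn a b (h (r k)) \<le> c) \<longrightarrow> sqn a b g \<le> c" using g(3) by meson
  with smr nfu vu cost show ?thesis by blast
qed

section \<open>The functional\<close>

text \<open>Integrating the classical second derivative twice makes \<open>w\<close> a single piece.
  So \<open>w\<close> itself is admissible, and it can be compared with other normal forms on the
  outer strips.\<close>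

lemma C2_on_imp_nform:
  assumes "C2_on a b w" "a < b"
  obtains h s A B where "nform a b h 1 s A B w" "continuous_on {a..b} w"
proof -
  obtain w1 w2 where d: "\<And>x. x \<in> {a..b} \<Longrightarrow> (w has_real_derivative w1 x) (at x within {a..b})"
     "\<And>x. x \<in> {a..b} \<Longrightarrow> (w1 has_real_derivative w2 x) (at x within {a..b})" and c2: "continuous_on {a..b} w2"
    using assms(1) unfolding C2_on_def by blast
  have ftc: "k x = k a + prim a k' x" if "\<And>x. x \<in> {a..b} \<Longrightarrow> (k has_real_derivative k' x) (at x within {a..b})" "x \<in> {a..b}"
    for k k' x
  proof -
    have "(k' has_integral (k x - k a)) {a..x}"
    proof (rule fundamental_theorem_of_calculus)
      fix y assume "y \<in> {a..x}"
      then have "(k has_real_derivative k' y) (at y within {a..b})" using that by auto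
      from DERIV_subset[OF this, of "{a..x}"]
      show "(k has_vector_derivative k' y) (at y within {a..x})"
        using that(2) by (auto simp: has_real_derivative_iff_has_vector_derivative[symmetric])
    qed (use that in auto)
    then show ?thesis by (simp add: prim_def integral_unique)
  qed
  have cw: "continuous_on {a..b} w" using d(1) DERIV_continuous_on by blast
  have i2: "L1_on {a..b} w2" by (rule L1_on_continuous[OF c2])
  have key: "w x = (w a - w1 a * a) + w1 a * x + dprim a w2 x" if x: "x \<in> {a..b}" for x
  proof -
    have "w x = w a + prim a w1 x" by (rule ftc[OF d(1) x])
    also have "prim a w1 x = prim a (\<lambda>t. w1 a + prim a w2 t) x"
    proof (rule prim_cong_restrict[of a b])
      show "w1 t = w1 a + prim a w2 t" if "t \<in> {a..b}" for t by (rule ftc[OF d(2) that])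
    qed (rule x)
    also have "\<dots> = w1 a * (x - a) + dprim a w2 x"
      unfolding dprim_def by (rule prim_affine[OF continuous_on_prim[OF i2]]) (use x in auto)
    finally show ?thesis by (simp add: algebra_simps)
  qed
  have "affine_on a w2 w a b (w a - w1 a * a) (w1 a)"
    unfolding affine_on_def by (rule AE_I2, rule impI, rule key) auto
  then have "nform a b w2 1 (\<lambda>i. if i = 0 then a else b) (\<lambda>_. w a - w1 a * a) (\<lambda>_. w1 a) w"
    using partition_singleton[OF assms(2)] L2_on_continuous[OF c2] by (simp add: nform_def)
  then show ?thesis using that cw by blast
qed

lemma counting_finite: "finite S \<Longrightarrow> counting S = ereal (real (card S))"
  by (simp add: counting_def emeasure_count_space_finite ennreal_of_nat_eq_real_of_nat enn2ereal_ennreal)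

text \<open>Completing the square in \<open>v\<close>.\<close>

lemma E1_nform:
  assumes nf: "nform (-2) 2 h n s A B v" and f: "L2_on {-1<..<1} f" and w: "L2_on {-1<..<1} w" and \<mu>: "\<mu> > 0"
  defines "z \<equiv> \<lambda>x. w x + f x / (2 * \<mu>)"
  shows "E1 \<alpha> \<beta> \<eta> \<mu> f w v = ereal (singular_cost (-2) 2 \<alpha> \<beta> v + \<eta> * sqn (-1) 1 h + \<mu> * sqn (-1) 1 (\<lambda>x. v x - z x)
     - \<mu> * (sqn (-1) 1 z - sqn (-1) 1 w))"
proof -
  let ?I = "{-1<..<1::real}"
  let ?S = "discontinuity_set (-2) 2 v" and ?S' = "discontinuity_set (-2) 2 (ac_derivative (-2) 2 v)"
  have lt: "-2 < (2 :: real)" by simp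
  have fin: "finite ?S" "finite (?S' - ?S)" using nform_discontinuity_sets[OF nf lt] by auto
  have sub: "L2_on ?I k" if "L2_on {-2<..<2} k" for k by (rule L2_on_subset[OF that]) auto
  have h: "L2_on ?I h" using nf by (intro sub) (simp add: nform_def)
  have v: "L2_on ?I v" by (intro sub piecewise_H2_imp_L2_on[OF nform_imp_piecewise_H2[OF nf]])
  have z: "L2_on ?I z" unfolding z_def using L2_on_add[OF w L2_on_cmult[OF f, of "1 / (2 * \<mu>)"]] by simp
  have sq: "L1_on ?I (\<lambda>x. (k x)\<^sup>2)" if "L2_on ?I k" for k using that by (simp add: L2_on_def)
  have "AE x in lebesgue. x \<in> ?I \<longrightarrow> \<eta> * \<bar>ac_derivative (-2) 2 (ac_derivative (-2) 2 v) x\<bar>\<^sup>2 - f x * v x = \<eta> * (h x)\<^sup>2 - f x * v x"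
    using nform_second_ac_derivative(2)[OF nf lt] by eventually_elim auto
  then have "(LINT x:?I|lebesgue. \<eta> * \<bar>ac_derivative (-2) 2 (ac_derivative (-2) 2 v) x\<bar>\<^sup>2 - f x * v x)
     = (LINT x:?I|lebesgue. \<eta> * (h x)\<^sup>2 - f x * v x)"
    by (rule set_integral_lebesgue_AE_cong(2))
  also have "\<dots> = \<eta> * sqn (-1) 1 h - (LINT x:?I|lebesgue. f x * v x)"
    unfolding sqn_def using sq[OF h] L2_on_mult[OF f v] by (subst set_integral_diff(2)) auto
  finally have 1: "(LINT x:?I|lebesgue. \<eta> * \<bar>ac_derivative (-2) 2 (ac_derivative (-2) 2 v) x\<bar>\<^sup>2 - f x * v x)
     = \<eta> * sqn (-1) 1 h - (LINT x:?I|lebesgue. f x * v x)" .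
  have "\<mu> * (LINT x:?I|lebesgue. \<bar>v x - w x\<bar>\<^sup>2) - (LINT x:?I|lebesgue. f x * v x)
     = (LINT x:?I|lebesgue. \<mu> * (v x - w x)\<^sup>2 - f x * v x)"
    using sq[OF L2_on_diff[OF v w]] L2_on_mult[OF f v] by (subst set_integral_diff(2)) auto
  \<comment> \<open>z = w + f / (2\<mu>) minimises \<mu> (v - w)^2 - f v pointwise in v; the
    remaining term \<mu> (w^2 - z^2) does not involve v.\<close>
  also have "\<dots> = (LINT x:?I|lebesgue. \<mu> * (v x - z x)\<^sup>2 - (\<mu> * (z x)\<^sup>2 - \<mu> * (w x)\<^sup>2))"
    using \<mu> by (intro set_lebesgue_integral_cong) (auto simp: z_def power2_eq_square field_simps)
  also have "\<dots> = \<mu> * sqn (-1) 1 (\<lambda>x. v x - z x) - (\<mu> * sqn (-1) 1 z - \<mu> * sqn (-1) 1 w)"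
    unfolding sqn_def using sq[OF L2_on_diff[OF v z]] sq[OF z] sq[OF w]
    by (simp add: set_integral_diff)
  finally have 2: "\<mu> * (LINT x:?I|lebesgue. \<bar>v x - w x\<bar>\<^sup>2) = (LINT x:?I|lebesgue. f x * v x)
      + \<mu> * sqn (-1) 1 (\<lambda>x. v x - z x) - (\<mu> * sqn (-1) 1 z - \<mu> * sqn (-1) 1 w)" by simp
  show ?thesis
    unfolding E1_def Let_def counting_finite[OF fin(1)] counting_finite[OF fin(2)] 1 2 singular_cost_def
    by (simp add: algebra_simps)
qed

text \<open>Local uniqueness of the density is used twice, for the first and for the second
  derivative. It fixes the part of the norm of \<open>h\<close> over the outer strips, which the
  energy does not contain.\<close>

lemma nform_second_derivative_eq:
  assumes v: "nform a b h n s A B v" and w: "nform a b k m t A' B' w" and cd: "a \<le> c" "c < d" "d \<le> b"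
    and eq: "AE x\<in>{c<..<d} in lebesgue. v x = w x"
  shows "sqn c d h = sqn c d k"
proof -
  have ab: "a < b" using cd by auto
  note dv = nform_second_ac_derivative[OF v ab] and dw = nform_second_ac_derivative[OF w ab]
  have "AE x\<in>{c<..<d} in lebesgue. ac_derivative a b v x = ac_derivative a b w x"
    by (rule is_ac_derivative_unique_on[OF dv(1) dw(1) cd eq])
  then have "AE x\<in>{c<..<d} in lebesgue. h x = k x"
    by (rule is_ac_derivative_unique_on[OF dv(3) dw(3) cd])
  then show ?thesis unfolding sqn_def
    by (intro set_integral_lebesgue_AE_cong(2)) (auto elim: eventually_mono)
qed

lemma sqn_cong:
  assumes "AE x\<in>{c<..<d} in lebesgue. v x = w x"
  shows "sqn c d v = sqn c d w"
  unfolding sqn_def by (rule set_integral_lebesgue_AE_cong(2)) (use assms in \<open>auto elim: eventually_mono\<close>)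

lemma sqn_combine:
  assumes "L2_on {a<..<b} y" "a \<le> c" "c \<le> b"
  shows "sqn a b y = sqn a c y + sqn c b y"
proof -
  have i: "L1_on {a..b} (\<lambda>x. (y x)\<^sup>2)"
    using assms(1) by (simp add: L2_on_def L1_on_Ioo_iff_Icc)
  have i1: "L1_on {a..c} (\<lambda>x. (y x)\<^sup>2)" and i2: "L1_on {c..b} (\<lambda>x. (y x)\<^sup>2)"
    using L1_on_subset[OF i] assms by auto
  show ?thesis unfolding sqn_def L1_on_Ioo_integral[OF i] L1_on_Ioo_integral[OF i1] L1_on_Ioo_integral[OF i2]
    using Henstock_Kurzweil_Integration.integral_combine[of a c b "\<lambda>x. (y x)\<^sup>2"] assms L1_on_imp_HK[OF i] by simp
qed

lemma sqn_split:
  assumes "L2_on {-2<..<2} y"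
  shows "sqn (-2) 2 y = sqn (-2) (-1) y + sqn (-1) 1 y + sqn 1 2 y"
proof -
  have "L2_on {-1<..<2} y" by (rule L2_on_subset[OF assms]) auto
  then show ?thesis using sqn_combine[OF assms, of "-1"] sqn_combine[of "-1" 2 y 1] by simp
qed

text \<open>The parallelogram law for \<open>y - z\<close> and \<open>z\<close>; it converts a bound
  on the fidelity term into a bound on \<open>v\<close>.\<close>

lemma sqn_le_diff:
  assumes "L2_on {a<..<b} y" "L2_on {a<..<b} z"
  shows "sqn a b y \<le> 2 * sqn a b (\<lambda>x. y x - z x) + 2 * sqn a b z"
  using sqn_parallelogram[OF L2_on_diff[OF assms] assms(2)] sqn_nonneg[of a b "\<lambda>x. y x - z x - z x"] by simp

lemma sqn_fatou:
  assumes "\<And>k. L2_on {a<..<b} (y k)" "L2_on {a<..<b} u"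
    and lim: "AE x\<in>{a<..<b} in lebesgue. (\<lambda>k. y k x) \<longlonglongrightarrow> u x" and q: "(\<lambda>k. sqn a b (y k)) \<longlonglongrightarrow> Q"
  shows "sqn a b u \<le> Q"
proof -
  have "AE x in lebesgue. (\<lambda>k. (indicat_real {a<..<b} x * y k x)\<^sup>2) \<longlonglongrightarrow> (indicat_real {a<..<b} x * u x)\<^sup>2"
    using lim by eventually_elim (auto simp: indicator_def intro!: tendsto_power)
  moreover have "(\<lambda>x. (indicat_real {a<..<b} x * u x)\<^sup>2) \<in> borel_measurable lebesgue"
    using assms(2) by (auto simp: L2_on_iff)
  moreover have "integrable lebesgue (\<lambda>x. (indicat_real {a<..<b} x * y k x)\<^sup>2)" for k
    using assms(1)[of k] by (simp add: L2_on_iff)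
  ultimately show ?thesis
    using fatou_bound(2)[of lebesgue "\<lambda>k x. (indicat_real {a<..<b} x * y k x)\<^sup>2" "\<lambda>x. (indicat_real {a<..<b} x * u x)\<^sup>2"
        "\<lambda>k. sqn a b (y k)" Q] q by (simp add: sqn_eq)
qed

text \<open>At a knot outside \<open>J\<close> the two affine traces agree, so equal slopes would
  force equal intercepts, against \<open>act\<close>: every such knot is a crease. The knots are
  distinct, so counting points is counting indices.\<close>

lemma singular_cost_minimal:
  assumes nf: "nform (-2) 2 h n s A B v" and act: "\<And>j. j \<in> {1..<n} \<Longrightarrow> A (j - 1) \<noteq> A j \<or> B (j - 1) \<noteq> B j"
  defines "J \<equiv> {j\<in>{1..<n}. A (j - 1) + B (j - 1) * s j \<noteq> A j + B j * s j}"
  shows "singular_cost (-2) 2 \<alpha> \<beta> v = \<alpha> * real (card J) + \<beta> * real (card ({1..<n} - J))"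
proof -
  have part: "partition n s (-2) 2" using nf by (simp add: nform_def)
  have JI: "J \<subseteq> {1..<n}" by (auto simp: J_def)
  have inj: "inj_on s {1..<n}"
    by (rule linorder_inj_onI) (use partition_less[OF part] in force)+
  have S: "discontinuity_set (-2) 2 v = s ` J"
    using nform_discontinuity_sets(1)[OF nf] by (simp add: J_def)
  have "discontinuity_set (-2) 2 (ac_derivative (-2) 2 v) - s ` J = s ` {j\<in>{1..<n}. B (j - 1) \<noteq> B j} - s ` J"
    using nform_discontinuity_sets(2)[OF nf] by simp
  also have "\<dots> = s ` ({j\<in>{1..<n}. B (j - 1) \<noteq> B j} - J)"
    by (rule inj_on_image_set_diff[OF inj, symmetric]) (auto simp: J_def)
  also have "{j\<in>{1..<n}. B (j - 1) \<noteq> B j} - J = {1..<n} - J"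
    using act by (auto simp: J_def)
  finally have "discontinuity_set (-2) 2 (ac_derivative (-2) 2 v) - s ` J = s ` ({1..<n} - J)" .
  then show ?thesis unfolding singular_cost_def S
    using card_image[OF inj_on_subset[OF inj JI]] card_image[OF inj_on_subset[OF inj Diff_subset[of _ J]]]
    by simp
qed

theorem theorem3p1:
  fixes w f :: "real \<Rightarrow> real" and \<alpha> \<beta> \<eta> \<mu> :: real
  assumes "C2_on (-2) 2 w"
    and "\<eta> > 0" and "\<mu> > 0"
    and "L2_on {-1<..<1} f"
    and "0 < \<beta>" and "\<beta> \<le> \<alpha>" and "\<alpha> \<le> 2 * \<beta>"
  shows "\<exists>u \<in> admissible w. \<bar>E1 \<alpha> \<beta> \<eta> \<mu> f w u\<bar> \<noteq> \<infinity> \<and>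
           (\<forall>v \<in> admissible w. E1 \<alpha> \<beta> \<eta> \<mu> f w u \<le> E1 \<alpha> \<beta> \<eta> \<mu> f w v)"
proof -
  note \<alpha>\<beta> = assms(5-7)
  have lt: "-2 < (2 :: real)" by simp
  obtain hw sw Aw Bw where w: "nform (-2) 2 hw 1 sw Aw Bw w" and cw: "continuous_on {-2..2} w"
    using C2_on_imp_nform[OF assms(1) lt] by blast
  have sub: "L2_on {-1<..<1} k" if "L2_on {-2<..<2} k" for k by (rule L2_on_subset[OF that]) auto
  have wL: "L2_on {-1<..<1} w" by (intro sub L2_on_continuous cw)
  define z where "z x = w x + f x / (2 * \<mu>)" for x
  have zL: "L2_on {-1<..<1} z"
    unfolding z_def using L2_on_add[OF wL L2_on_cmult[OF assms(4), of "1 / (2 * \<mu>)"]] by simp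
  define K where "K = \<mu> * (sqn (-1) 1 z - sqn (-1) 1 w)"
  \<comment> \<open>Admissible functions have finite energy, so the infimum can be taken among real
    numbers.\<close>
  define e where "e v = real_of_ereal (E1 \<alpha> \<beta> \<eta> \<mu> f w v)" for v
  \<comment> \<open>The contribution of the outer strips to the squared norm of \<open>h\<close>,
    the same for all admissible functions; \<open>V\<close> is its analogue for
    \<open>v\<close>.\<close>
  define W where "W = sqn (-2) (-1) hw + sqn 1 2 hw"
  define V where "V = sqn (-2) (-1) w + sqn 1 2 w"
  have E: "E1 \<alpha> \<beta> \<eta> \<mu> f w v = ereal (e v)"
    "e v = singular_cost (-2) 2 \<alpha> \<beta> v + \<eta> * sqn (-1) 1 h + \<mu> * sqn (-1) 1 (\<lambda>x. v x - z x) - K"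
    if "nform (-2) 2 h n s A B v" for h n s A B v
    using E1_nform[OF that assms(4) wL assms(3)] by (simp_all add: e_def K_def z_def[abs_def])
  have cost0: "0 \<le> singular_cost (-2) 2 \<alpha> \<beta> v" for v using \<alpha>\<beta> by (simp add: singular_cost_def)
  have outer: "AE x\<in>{-2<..<-1} in lebesgue. v x = w x" "AE x\<in>{1<..<2} in lebesgue. v x = w x"
    if "v \<in> admissible w" for v
    using that unfolding admissible_def by (auto elim: eventually_mono)
  have hsplit: "sqn (-2) 2 h = sqn (-1) 1 h + W" if v: "v \<in> admissible w" "nform (-2) 2 h n s A B v" for h n s A B v
  proof -
    have "sqn (-2) (-1) h = sqn (-2) (-1) hw" "sqn 1 2 h = sqn 1 2 hw"
      by (rule nform_second_derivative_eq[OF v(2) w]; use outer[OF v(1)] in simp)+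
    then show ?thesis using sqn_split[of h] v(2) by (simp add: nform_def W_def)
  qed
  have vsplit: "sqn (-2) 2 v = sqn (-1) 1 v + V" if v: "v \<in> admissible w" for v
  proof -
    have "sqn (-2) (-1) v = sqn (-2) (-1) w" "sqn 1 2 v = sqn 1 2 w"
      using sqn_cong outer[OF v] by blast+
    moreover have "L2_on {-2<..<2} v" using v by (auto simp: admissible_def intro: piecewise_H2_imp_L2_on)
    ultimately show ?thesis using sqn_split[of v] by (simp add: V_def)
  qed
  have wadm: "w \<in> admissible w"
    using nform_imp_piecewise_H2[OF w] by (simp add: admissible_def)
  define m where "m = (INF v\<in>admissible w. e v)"
  have eK: "- K \<le> e v" if v: "v \<in> admissible w" for v
  proof -
    obtain h n s A B where nf: "nform (-2) 2 h n s A B v"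
      using piecewise_H2_imp_nform v unfolding admissible_def by blast
    show ?thesis using E(2)[OF nf] cost0[of v] sqn_nonneg assms(2,3) by simp
  qed
  have bdd: "bdd_below (e ` admissible w)" using eK by (intro bdd_belowI[of _ "- K"]) auto
  have mle: "m \<le> e v" if "v \<in> admissible w" for v unfolding m_def by (rule cINF_lower[OF bdd that])
  have "\<exists>v h n s A B. v \<in> admissible w \<and> e v < m + 1 / real (Suc k) \<and> nform (-2) 2 h n s A B v \<and>
     (\<forall>j\<in>{1..<n}. A (j - 1) \<noteq> A j \<or> B (j - 1) \<noteq> B j)" for k
  proof -
    have "(INF v\<in>admissible w. e v) < m + 1 / real (Suc k)" by (simp add: m_def)
    then obtain v where v: "v \<in> admissible w" "e v < m + 1 / real (Suc k)"
      using wadm by (subst (asm) cINF_less_iff[OF _ bdd]) auto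
    moreover obtain h n s A B where "nform (-2) 2 h n s A B v" "\<And>j. j \<in> {1..<n} \<Longrightarrow> A (j - 1) \<noteq> A j \<or> B (j - 1) \<noteq> B j"
      using nform_minimal v unfolding admissible_def by blast
    ultimately show ?thesis by blast
  qed
  then obtain v h n s A B where v: "\<And>k. v k \<in> admissible w" "\<And>k. e (v k) < m + 1 / real (Suc k)"
     and nf: "\<And>k. nform (-2) 2 (h k) (n k) (s k) (A k) (B k) (v k)"
     and act: "\<And>k. \<forall>j\<in>{1..<n k}. A k (j - 1) \<noteq> A k j \<or> B k (j - 1) \<noteq> B k j"
    by metis
  define J where "J k = {j\<in>{1..<n k}. A k (j - 1) + B k (j - 1) * s k j \<noteq> A k j + B k j * s k j}" for k
  have cost: "singular_cost (-2) 2 \<alpha> \<beta> (v k) = \<alpha> * real (card (J k)) + \<beta> * real (card ({1..<n k} - J k))" for k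
    unfolding J_def by (rule singular_cost_minimal[OF nf]) (use act in blast)
  \<comment> \<open>The minimising sequence has energy below m + 1, and adding \<open>K\<close>
    leaves a sum of three nonnegative terms, each therefore at most \<open>M\<close>.\<close>
  define M where "M = m + 1 + K"
  have eM: "singular_cost (-2) 2 \<alpha> \<beta> (v k) \<le> M" "\<eta> * sqn (-1) 1 (h k) \<le> M" "\<mu> * sqn (-1) 1 (\<lambda>x. v k x - z x) \<le> M" for k
  proof -
    have "1 / real (Suc k) \<le> 1" by simp
    then have "singular_cost (-2) 2 \<alpha> \<beta> (v k) + \<eta> * sqn (-1) 1 (h k) + \<mu> * sqn (-1) 1 (\<lambda>x. v k x - z x) \<le> M"
      using v(2)[of k] E(2)[OF nf[of k]] unfolding M_def by linarith
    moreover have "0 \<le> \<eta> * sqn (-1) 1 (h k)" "0 \<le> \<mu> * sqn (-1) 1 (\<lambda>x. v k x - z x)"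
      using assms(2,3) sqn_nonneg by simp_all
    ultimately show "singular_cost (-2) 2 \<alpha> \<beta> (v k) \<le> M" "\<eta> * sqn (-1) 1 (h k) \<le> M" "\<mu> * sqn (-1) 1 (\<lambda>x. v k x - z x) \<le> M"
      using cost0[of "v k"] by linarith+
  qed
  \<comment> \<open>Each of the \<open>n k - 1\<close> interior knots costs at least \<beta>, as
    \<beta> \<le> \<alpha>; the added 1 turns knots into pieces.\<close>
  define N where "N = nat \<lceil>M / \<beta>\<rceil> + 1"
  have nN: "n k \<le> N" for k
  proof -
    have JI: "J k \<subseteq> {1..<n k}" "finite (J k)" by (auto simp: J_def)
    have c: "n k - 1 = card (J k) + card ({1..<n k} - J k)"
      using JI card_mono[of "{1..<n k}" "J k"] by (simp add: card_Diff_subset)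
    have "\<beta> * real (n k - 1) = \<beta> * real (card (J k)) + \<beta> * real (card ({1..<n k} - J k))"
      unfolding c by (simp add: distrib_left)
    also have "\<dots> \<le> M" using cost[of k] eM(1)[of k] \<alpha>\<beta> mult_right_mono[of \<beta> \<alpha> "real (card (J k))"] by simp
    finally have "real (n k - 1) \<le> M / \<beta>" using \<alpha>\<beta> by (simp add: pos_le_divide_eq mult.commute)
    then show ?thesis unfolding N_def by linarith
  qed
  \<comment> \<open>The number of pieces and the set of jump indices range over a finite set, so
    both are constant along a subsequence.\<close>
  have "finite ({..N} \<times> Pow {..N})" by simp
  moreover have "(n k, J k) \<in> {..N} \<times> Pow {..N}" for k using nN[of k] by (auto simp: J_def)
  ultimately obtain r1 c where r1: "strict_mono (r1 :: nat \<Rightarrow> nat)" "\<And>k. (n (r1 k), J (r1 k)) = c"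
    using constant_subsequence[of "{..N} \<times> Pow {..N}" "\<lambda>k. (n k, J k)"] by blast
  define n0 J0 where "n0 = fst c" and "J0 = snd c"
  have nJ: "n (r1 k) = n0" "J (r1 k) = J0" for k using r1(2)[of k] by (auto simp: n0_def J0_def)
  \<comment> \<open>One bound for both squared norms on (-2,2): the energy bounds the part on
    (-1,1), for \<open>v\<close> by way of \<open>z\<close>, and the outer strips add
    \<open>W\<close> and \<open>V\<close>.\<close>
  define C where "C = max (M / \<eta> + W) (2 * (M / \<mu>) + 2 * sqn (-1) 1 z + V)"
  have hC: "sqn (-2) 2 (h k) \<le> C" for k
  proof -
    have "sqn (-1) 1 (h k) \<le> M / \<eta>" using eM(2)[of k] assms(2) by (simp add: pos_le_divide_eq mult.commute)
    then show ?thesis using hsplit[OF v(1) nf, of k] by (simp add: C_def)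
  qed
  have vL: "L2_on {-1<..<1} (v k)" for k
    by (rule sub, rule piecewise_H2_imp_L2_on) (use v(1)[of k] in \<open>simp add: admissible_def\<close>)
  have vC: "sqn (-2) 2 (v k) \<le> C" for k
  proof -
    have "sqn (-1) 1 (\<lambda>x. v k x - z x) \<le> M / \<mu>" using eM(3)[of k] assms(3) by (simp add: pos_le_divide_eq mult.commute)
    then have "sqn (-1) 1 (v k) \<le> 2 * (M / \<mu>) + 2 * sqn (-1) 1 z"
      using sqn_le_diff[OF vL[of k] zL] by linarith
    then show ?thesis using vsplit[OF v(1), of k] by (simp add: C_def)
  qed
  \<comment> \<open>With the singular cost constant and the energies tending to \<open>m\<close>,
    convergence of these norms forces the fidelity terms to converge as well.\<close>
  have "Bseq (\<lambda>k. sqn (-2) 2 (h (r1 k)))"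
    using hC sqn_nonneg by (intro Bseq_eventuallyI[of _ C] always_eventually) auto
  then obtain a r2 where "strict_mono (r2 :: nat \<Rightarrow> nat)" "((\<lambda>k. sqn (-2) 2 (h (r1 k))) \<circ> r2) \<longlonglongrightarrow> a"
    using bounded_imp_convergent_subsequence[of "\<lambda>k. sqn (-2) 2 (h (r1 k))"] unfolding Bseq_eq_bounded by blast
  then have r2: "strict_mono r2" "(\<lambda>k. sqn (-2) 2 (h (r1 (r2 k)))) \<longlonglongrightarrow> a" by (simp_all add: o_def)
  define \<rho> where "\<rho> = r1 \<circ> r2"
  have nf\<rho>: "nform (-2) 2 (h (\<rho> k)) n0 (s (\<rho> k)) (A (\<rho> k)) (B (\<rho> k)) (v (\<rho> k))" for k
    using nf[of "\<rho> k"] nJ by (simp add: \<rho>_def)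
  have J\<rho>: "J (\<rho> k) = J0" for k using nJ by (simp add: \<rho>_def)
  have n\<rho>: "n (\<rho> k) = n0" for k using nJ by (simp add: \<rho>_def)
  have J0: "J0 \<subseteq> {1..<n0}" using J\<rho>[of 0] n\<rho>[of 0] by (auto simp: J_def)
  have crease: "\<forall>j\<in>{1..<n0} - J0. \<forall>k.
      A (\<rho> k) (j - 1) + B (\<rho> k) (j - 1) * s (\<rho> k) j = A (\<rho> k) j + B (\<rho> k) j * s (\<rho> k) j"
  proof (intro ballI allI)
    fix j k assume "j \<in> {1..<n0} - J0"
    then have "j \<in> {1..<n (\<rho> k)}" "j \<notin> J (\<rho> k)" unfolding J\<rho> n\<rho> by auto
    then show "A (\<rho> k) (j - 1) + B (\<rho> k) (j - 1) * s (\<rho> k) j = A (\<rho> k) j + B (\<rho> k) j * s (\<rho> k) j"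
      unfolding J_def by blast
  qed
  from nform_compactness[where h = "\<lambda>k. h (\<rho> k)" and v = "\<lambda>k. v (\<rho> k)",
    OF lt nf\<rho> J0 crease hC vC \<alpha>\<beta>]
  obtain r u g l t A' B' where r: "strict_mono (r :: nat \<Rightarrow> nat)" and nfu: "nform (-2) 2 g l t A' B' u"
    and vu: "AE x\<in>{-2<..<2} in lebesgue. (\<lambda>k. v (\<rho> (r k)) x) \<longlonglongrightarrow> u x"
    and gc: "\<forall>c. (\<forall>N. \<exists>k\<ge>N. sqn (-2) 2 (h (\<rho> (r k))) \<le> c) \<longrightarrow> sqn (-2) 2 g \<le> c"
    and cu: "singular_cost (-2) 2 \<alpha> \<beta> u \<le> \<alpha> * real (card J0) + \<beta> * real (card ({1..<n0} - J0))"
    by blast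
  define \<tau> where "\<tau> = \<rho> \<circ> r"
  have sm\<tau>: "strict_mono \<tau>" unfolding \<tau>_def \<rho>_def using r1 r2 r by (intro strict_mono_o) auto
  have al: "(\<lambda>k. sqn (-2) 2 (h (\<tau> k))) \<longlonglongrightarrow> a"
    using LIMSEQ_subseq_LIMSEQ[OF r2(2) r] by (simp add: \<tau>_def \<rho>_def o_def)
  have uadm: "u \<in> admissible w"
  proof -
    have "AE x in lebesgue. \<forall>k. x \<in> {-2<..<-1} \<union> {1<..<2} \<longrightarrow> v (\<tau> k) x = w x"
      unfolding AE_all_countable using v(1) by (simp add: admissible_def)
    with vu have "AE x in lebesgue. x \<in> {-2<..<-1} \<union> {1<..<2} \<longrightarrow> u x = w x"
    proof eventually_elim
      case (elim x)
      show ?case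
      proof
        assume x: "x \<in> {-2<..<-1} \<union> {1<..<2}"
        then have "(\<lambda>k. w x) \<longlonglongrightarrow> u x" using elim by (auto simp: \<tau>_def)
        then show "u x = w x" by (rule LIMSEQ_unique) (rule tendsto_const)
      qed
    qed
    then show ?thesis using nform_imp_piecewise_H2[OF nfu] by (simp add: admissible_def)
  qed
  \<comment> \<open>Norms tending to \<open>a\<close> lie below a + \<epsilon> infinitely often,
    which is the form in which lower semicontinuity is available.\<close>
  have ga: "sqn (-2) 2 g \<le> a"
  proof (rule field_le_epsilon, rule gc[rule_format])
    fix \<epsilon> :: real and N assume "0 < \<epsilon>"
    then have "\<forall>\<^sub>F k in sequentially. sqn (-2) 2 (h (\<tau> k)) < a + \<epsilon>" using order_tendstoD(2)[OF al] by simp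
    then obtain N' where "\<forall>k\<ge>N'. sqn (-2) 2 (h (\<tau> k)) < a + \<epsilon>" by (auto simp: eventually_sequentially)
    then show "\<exists>k\<ge>N. sqn (-2) 2 (h (\<rho> (r k))) \<le> a + \<epsilon>"
      by (intro exI[of _ "max N N'"]) (auto simp: \<tau>_def intro: less_imp_le)
  qed
  define c0 where "c0 = \<alpha> * real (card J0) + \<beta> * real (card ({1..<n0} - J0))"
  have el: "(\<lambda>k. e (v (\<tau> k))) \<longlonglongrightarrow> m"
  proof (rule LIMSEQ_subseq_LIMSEQ[OF _ sm\<tau>, unfolded o_def])
    show "(\<lambda>k. e (v k)) \<longlonglongrightarrow> m"
    proof (rule tendsto_sandwich[OF _ _ tendsto_const])
      show "\<forall>\<^sub>F k in sequentially. m \<le> e (v k)" using mle v(1) by simp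
      show "\<forall>\<^sub>F k in sequentially. e (v k) \<le> m + 1 / real (Suc k)" using v(2) by (simp add: less_imp_le)
      show "(\<lambda>k. m + 1 / real (Suc k)) \<longlonglongrightarrow> m"
        using tendsto_add[OF tendsto_const[of m] LIMSEQ_inverse_real_of_nat] by (simp add: inverse_eq_divide)
    qed
  qed
  have e\<tau>: "e (v (\<tau> k)) = c0 + \<eta> * (sqn (-2) 2 (h (\<tau> k)) - W) + \<mu> * sqn (-1) 1 (\<lambda>x. v (\<tau> k) x - z x) - K" for k
    using E(2)[OF nf[of "\<tau> k"]] cost[of "\<tau> k"] hsplit[OF v(1) nf, of "\<tau> k"] J\<rho>[of "r k"] n\<rho>[of "r k"]
    by (simp add: c0_def \<tau>_def)
  \<comment> \<open>The limit forced on the fidelity terms: \<open>b\<close> solves c0 + \<eta> (a -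
    W) + \<mu> b - K = m.\<close>
  define b where "b = (m + K - c0 - \<eta> * (a - W)) / \<mu>"
  have "(\<lambda>k. (e (v (\<tau> k)) + K - c0 - \<eta> * (sqn (-2) 2 (h (\<tau> k)) - W)) / \<mu>) \<longlonglongrightarrow> b"
    unfolding b_def using assms(3) by (intro tendsto_intros el al) auto
  then have bl: "(\<lambda>k. sqn (-1) 1 (\<lambda>x. v (\<tau> k) x - z x)) \<longlonglongrightarrow> b"
    using assms(3) by (simp add: e\<tau>)
  have uL: "L2_on {-1<..<1} u" by (intro sub piecewise_H2_imp_L2_on[OF nform_imp_piecewise_H2[OF nfu]])
  have ub: "sqn (-1) 1 (\<lambda>x. u x - z x) \<le> b"
  proof (rule sqn_fatou[OF L2_on_diff[OF vL zL] L2_on_diff[OF uL zL] _ bl])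
    show "AE x\<in>{-1<..<1} in lebesgue. (\<lambda>k. v (\<tau> k) x - z x) \<longlonglongrightarrow> u x - z x"
      using vu by eventually_elim (auto simp: \<tau>_def intro!: tendsto_diff)
  qed
  have "e u = singular_cost (-2) 2 \<alpha> \<beta> u + \<eta> * (sqn (-2) 2 g - W) + \<mu> * sqn (-1) 1 (\<lambda>x. u x - z x) - K"
    using E(2)[OF nfu] hsplit[OF uadm nfu] by simp
  also have "\<dots> \<le> c0 + \<eta> * (a - W) + \<mu> * b - K"
    using cu ga ub assms(2,3) by (intro diff_mono add_mono mult_left_mono) (auto simp: c0_def)
  also have "\<dots> = m" using assms(3) by (simp add: b_def)
  finally have um: "e u \<le> m" .
  show ?thesis
  proof (intro bexI[OF _ uadm] conjI ballI)
    show "\<bar>E1 \<alpha> \<beta> \<eta> \<mu> f w u\<bar> \<noteq> \<infinity>" using E(1)[OF nfu] by simp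
    fix y assume y: "y \<in> admissible w"
    obtain h n s A B where nfy: "nform (-2) 2 h n s A B y"
      using piecewise_H2_imp_nform y unfolding admissible_def by blast
    show "E1 \<alpha> \<beta> \<eta> \<mu> f w u \<le> E1 \<alpha> \<beta> \<eta> \<mu> f w y"
      unfolding E(1)[OF nfu] E(1)[OF nfy] using um mle[OF y] by simp
  qed
qed

end
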